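(* Let $p$ be a prime, $\mathcal{A}=\mathbb{Z}/p\mathbb{Z}$, let $(\mathcal{A}^{\mathbb{Z}},F)$ be a nontrivial linear cellular automaton and let $\mu$ be an $(F,\sigma)$-invariant Borel probability measure on $\mathcal{A}^{\mathbb{Z}}$. Assume that: 1. $\mu$ is ergodic for the $\mathbb{N}\times\mathbb{Z}$-action $(F,\sigma)$; 2. $\mathcal{I}_\mu(\sigma)=\mathcal{I}_\mu(\sigma^{p\,p_1})$, where $p_1$ is the smallest common $\sigma$-period of all elements of $\mathrm{Ker}(F)$; 3. the measure entropy $h_\mu(F)$ is positive. Then: (a) $\mu=\lambda_{\mathcal{A}^{\mathbb{Z}}}$, the uniform Bernoulli measure. (b) Moreover $p_1$ divides $\prod_{i=0}^{r-1}(p^r-p^i)$, where $r=\max(\mathbb{U}\cup\{0\})-\min(\mathbb{U}\cup\{0\})$ and $\mathbb{U}$ is the smallest neighborhood of $F$.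
   Context: $\mathcal{A}^{\mathbb{Z}}$ has the product topology and the product group structure, and $\sigma(x)_i=x_{i+1}$ is the shift. A cellular automaton (CA) is a continuous map $F:\mathcal{A}^{\mathbb{Z}}\to\mathcal{A}^{\mathbb{Z}}$ commuting with $\sigma$; equivalently there are a finite interval $\mathbb{U}\subset\mathbb{Z}$ (a neighborhood) and a local rule $\overline{F}:\mathcal{A}^{\mathbb{U}}\to\mathcal{A}$ with $F(x)_m=\overline{F}((x_{m+u})_{u\in\mathbb{U}})$ for all $m$. The smallest such interval is the smallest neighborhood; $F$ is trivial if it is a single point, and nontrivial otherwise. $F$ is linear if it is a group endomorphism; for $\mathcal{A}=\mathbb{Z}/p\mathbb{Z}$ this means $F=\sum_{u\in\mathbb{U}}f_u\sigma^u$ with $f_u\in\mathbb{Z}/p\mathbb{Z}$. A measure $\mu$ is $(F,\sigma)$-invariant if $\mu(F^{-1}B)=\mu(\sigma^{-1}B)=\mu(B)$ for all Borel $B$. $\mathcal{I}_\mu(\sigma^n)=\{B \text{ Borel}:\mu(\sigma^{-n}(B)\triangle B)=0\}$. $\lambda_{\mathcal{A}^{\mathbb{Z}}}$ is the Haar measure of $\mathcal{A}^{\mathbb{Z}}$, which gives every cylinder set fixing $n$ coordinates the mass $|\mathcal{A}|^{-n}$. $h_\mu(F)$ is the Kolmogorov–Sinai entropy. *)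

theory Defs
  imports
    "HOL-Probability.Probability"
    "Berlekamp_Zassenhaus.Finite_Field"
begin

text \<open>
  The alphabet $\mathbb{Z}/p\mathbb{Z}$ is \<^typ>\<open>'p mod_ring\<close> with \<open>'p\<close> of class \<^class>\<open>prime_card\<close>, so that
  $p$ is \<open>CARD('p)\<close>.  It is made a discrete space.  The function type \<open>int \<Rightarrow> 'p mod_ring\<close> then carries
  the product topology of \<^theory>\<open>HOL-Analysis.Function_Topology\<close>, and \<^const>\<open>borel\<close> and \<^const>\<open>continuous_on\<close>
  refer to that topology.
\<close>

instantiation mod_ring :: (finite) discrete_topology
begin
definition open_mod_ring :: "'a mod_ring set \<Rightarrow> bool"
  where "open_mod_ring S \<longleftrightarrow> True"
instance
  by standard (simp_all add: open_mod_ring_def)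
end

instance mod_ring :: (finite) second_countable_topology
proof
  have "open = generate_topology (UNIV :: 'a mod_ring set set)"
    by (auto simp: fun_eq_iff open_mod_ring_def intro: generate_topology.Basis)
  then show "\<exists>B :: 'a mod_ring set set. countable B \<and> open = generate_topology B"
    by (intro exI[of _ UNIV]) (simp add: countable_finite)
qed


subsection \<open>Cellular automata\<close>

definition shift_map :: "(int \<Rightarrow> 'a) \<Rightarrow> (int \<Rightarrow> 'a)"
  where "shift_map x = (\<lambda>i. x (i + 1))"

definition cellular_automaton :: "((int \<Rightarrow> 'a::topological_space) \<Rightarrow> (int \<Rightarrow> 'a)) \<Rightarrow> bool"
  where "cellular_automaton F \<longleftrightarrow> continuous_on UNIV F \<and> F \<circ> shift_map = shift_map \<circ> F"

definition linear_ca :: "((int \<Rightarrow> 'a::{topological_space, plus}) \<Rightarrow> (int \<Rightarrow> 'a)) \<Rightarrow> bool"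
  where "linear_ca F \<longleftrightarrow> cellular_automaton F \<and>
    (\<forall>x y. F (\<lambda>i. x i + y i) = (\<lambda>i. F x i + F y i))"

text \<open>
  The empty interval is admitted as a neighborhood: a constant cellular automaton has it as
  smallest neighborhood, all others have a nonempty one.
\<close>

definition neighborhood :: "((int \<Rightarrow> 'a) \<Rightarrow> (int \<Rightarrow> 'a)) \<Rightarrow> int set \<Rightarrow> bool"
  where "neighborhood F U \<longleftrightarrow> (\<exists>a b. U = {a..b}) \<and>
    (\<exists>f :: (int \<Rightarrow> 'a) \<Rightarrow> 'a. \<forall>x m. F x m = f (\<lambda>u\<in>U. x (m + u)))"

definition smallest_neighborhood :: "((int \<Rightarrow> 'a) \<Rightarrow> (int \<Rightarrow> 'a)) \<Rightarrow> int set"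
  where "smallest_neighborhood F = (LEAST U. neighborhood F U)"

definition trivial_ca :: "((int \<Rightarrow> 'a) \<Rightarrow> (int \<Rightarrow> 'a)) \<Rightarrow> bool"
  where "trivial_ca F \<longleftrightarrow> (\<exists>u. smallest_neighborhood F = {u})"

definition kernel :: "((int \<Rightarrow> 'a::zero) \<Rightarrow> (int \<Rightarrow> 'a)) \<Rightarrow> (int \<Rightarrow> 'a) set"
  where "kernel F = {x. F x = (\<lambda>_. 0)}"

definition kernel_period :: "((int \<Rightarrow> 'a::zero) \<Rightarrow> (int \<Rightarrow> 'a)) \<Rightarrow> nat"
  where "kernel_period F = (LEAST n. n > 0 \<and> (\<forall>x\<in>kernel F. (shift_map ^^ n) x = x))"


subsection \<open>Invariant measures\<close>

definition invariant_measure :: "'a measure \<Rightarrow> ('a \<Rightarrow> 'a) \<Rightarrow> bool"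
  where "invariant_measure M T \<longleftrightarrow>
    (\<forall>B\<in>sets M. emeasure M (T -` B \<inter> space M) = emeasure M B)"

definition invariant_sets :: "'a measure \<Rightarrow> ('a \<Rightarrow> 'a) \<Rightarrow> 'a set set"
  where "invariant_sets M T =
    {B \<in> sets M. emeasure M (sym_diff (T -` B \<inter> space M) B) = 0}"

text \<open>
  Ergodicity of the action generated by two commuting maps: a set invariant (modulo null sets) under
  both generators is null or conull.
\<close>

definition jointly_ergodic :: "'a measure \<Rightarrow> ('a \<Rightarrow> 'a) \<Rightarrow> ('a \<Rightarrow> 'a) \<Rightarrow> bool"
  where "jointly_ergodic M T S \<longleftrightarrow>
    (\<forall>B \<in> invariant_sets M T \<inter> invariant_sets M S. measure M B = 0 \<or> measure M B = 1)"

definition uniform_bernoulli :: "(int \<Rightarrow> 'a::finite) measure"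
  where "uniform_bernoulli = PiM UNIV (\<lambda>_. uniform_count_measure UNIV)"


subsection \<open>Kolmogorov--Sinai entropy\<close>

definition finite_partition :: "'a measure \<Rightarrow> 'a set set \<Rightarrow> bool"
  where "finite_partition M P \<longleftrightarrow>
    finite P \<and> P \<subseteq> sets M \<and> disjoint P \<and> \<Union>P = space M"

text \<open>Since \<open>ln 0 = 0\<close> in HOL, null cells contribute nothing.\<close>

definition partition_entropy :: "'a measure \<Rightarrow> 'a set set \<Rightarrow> real"
  where "partition_entropy M P = - (\<Sum>A\<in>P. measure M A * ln (measure M A))"

text \<open>\<open>refinement M T P n\<close> is the join of $T^{-i}P$ over $i < n$.\<close>

primrec refinement :: "'a measure \<Rightarrow> ('a \<Rightarrow> 'a) \<Rightarrow> 'a set set \<Rightarrow> nat \<Rightarrow> 'a set set"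
  where
    "refinement M T P 0 = {space M}"
  | "refinement M T P (Suc n) =
      {A \<inter> ((T ^^ n) -` B \<inter> space M) | A B. A \<in> refinement M T P n \<and> B \<in> P}"

definition entropy_wrt :: "'a measure \<Rightarrow> ('a \<Rightarrow> 'a) \<Rightarrow> 'a set set \<Rightarrow> real"
  where "entropy_wrt M T P = lim (\<lambda>n. partition_entropy M (refinement M T P n) / real n)"

definition ks_entropy :: "'a measure \<Rightarrow> ('a \<Rightarrow> 'a) \<Rightarrow> ereal"
  where "ks_entropy M T = (SUP P\<in>{P. finite_partition M P}. ereal (entropy_wrt M T P))"


subsection \<open>Basic facts\<close>

lemma sets_uniform_bernoulli:
  "sets (uniform_bernoulli :: (int \<Rightarrow> 'a::finite mod_ring) measure) = sets borel"
proof -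
  have "sets (uniform_count_measure UNIV :: 'a mod_ring measure) = sets borel"
    by (auto simp: sets_uniform_count_measure open_mod_ring_def intro: borel_open)
  then have "sets (uniform_bernoulli :: (int \<Rightarrow> 'a mod_ring) measure)
      = sets (PiM UNIV (\<lambda>_. borel))"
    unfolding uniform_bernoulli_def by (intro sets_PiM_cong) auto
  then show ?thesis
    by (simp add: sets_PiM_equal_borel)
qed

lemma uniform_bernoulli_cylinder:
  fixes a :: "int \<Rightarrow> 'a::finite"
  assumes "finite J"
  shows "emeasure uniform_bernoulli {x. \<forall>i\<in>J. x i = a i} = (1 / CARD('a)) ^ card J"
proof -
  interpret product_prob_space "\<lambda>_::int. uniform_count_measure (UNIV :: 'a set)" UNIV
    by (intro product_prob_spaceI prob_space_uniform_count_measure) auto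
  have eq: "{x. \<forall>i\<in>J. x i = a i} =
      prod_emb UNIV (\<lambda>_. uniform_count_measure UNIV) J (Pi\<^sub>E J (\<lambda>i. {a i}))"
    by (auto simp: prod_emb_def space_uniform_count_measure PiE_def Pi_def)
  have "emeasure uniform_bernoulli {x. \<forall>i\<in>J. x i = a i} =
      (\<Prod>i\<in>J. emeasure (uniform_count_measure UNIV) {a i})"
    unfolding uniform_bernoulli_def eq
    by (rule emeasure_PiM_emb) (use assms in \<open>auto simp: sets_uniform_count_measure\<close>)
  also have "\<dots> = (\<Prod>i\<in>J. ennreal (1 / CARD('a)))"
    by (intro prod.cong refl) (simp add: emeasure_uniform_count_measure)
  finally show ?thesis
    by (simp add: ennreal_power)
qed

lemma neighborhood_iff:
  fixes F :: "(int \<Rightarrow> 'a) \<Rightarrow> (int \<Rightarrow> 'a)"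
  shows "neighborhood F U \<longleftrightarrow> (\<exists>a b. U = {a..b}) \<and>
    (\<forall>x y m n. (\<forall>u\<in>U. x (m + u) = y (n + u)) \<longrightarrow> F x m = F y n)"
proof (intro iffI conjI; (elim conjE)?)
  assume *: "\<forall>x y m n. (\<forall>u\<in>U. x (m + u) = y (n + u)) \<longrightarrow> F x m = F y n"
    and U: "\<exists>a b. U = {a..b}"
  define f where "f w = F w 0" for w
  have "F x m = f (\<lambda>u\<in>U. x (m + u))" for x m
    unfolding f_def by (rule *[rule_format]) auto
  with U show "neighborhood F U"
    unfolding neighborhood_def by blast
next
  assume "neighborhood F U"
  then obtain f where f: "\<And>x m. F x m = f (\<lambda>u\<in>U. x (m + u))"
    unfolding neighborhood_def by blast
  show "\<forall>x y m n. (\<forall>u\<in>U. x (m + u) = y (n + u)) \<longrightarrow> F x m = F y n"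
  proof (intro allI impI)
    fix x y :: "int \<Rightarrow> 'a" and m n assume "\<forall>u\<in>U. x (m + u) = y (n + u)"
    then have "(\<lambda>u\<in>U. x (m + u)) = (\<lambda>u\<in>U. y (n + u))"
      by (auto simp: fun_eq_iff)
    then show "F x m = F y n"
      by (simp only: f)
  qed
qed (simp add: neighborhood_def)

lemma neighborhood_Int:
  fixes F :: "(int \<Rightarrow> 'a) \<Rightarrow> (int \<Rightarrow> 'a)"
  assumes "neighborhood F U" "neighborhood F V"
  shows "neighborhood F (U \<inter> V)"
  unfolding neighborhood_iff
proof (intro conjI allI impI)
  obtain a b c d where "U = {a..b}" "V = {c..d}"
    using assms by (auto simp: neighborhood_def)
  then show "\<exists>a b. U \<inter> V = {a..b}"
    by (metis Int_atLeastAtMost)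
next
  fix x y :: "int \<Rightarrow> 'a" and m n assume eq: "\<forall>u\<in>U \<inter> V. x (m + u) = y (n + u)"
  define z where "z i = (if i - m \<in> U then x i else y (i - m + n))" for i
  have "F x m = F z m"
    using assms(1)[unfolded neighborhood_iff] by (auto simp: z_def)
  also have "F z m = F y n"
  proof (rule assms(2)[unfolded neighborhood_iff, THEN conjunct2, rule_format])
    fix u assume "u \<in> V"
    with eq show "z (m + u) = y (n + u)"
      by (auto simp: z_def add.commute)
  qed
  finally show "F x m = F y n" .
qed

lemma smallest_neighborhood:
  assumes "neighborhood F W"
  shows "neighborhood F (smallest_neighborhood F)"
    and "neighborhood F V \<Longrightarrow> smallest_neighborhood F \<subseteq> V"
proof -
  obtain U where U: "neighborhood F U" and min: "\<And>V. neighborhood F V \<Longrightarrow> card U \<le> card V"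
    using ex_has_least_nat[of "neighborhood F" W card] assms by blast
  have "finite U"
    using U by (auto simp: neighborhood_def)
  have sub: "U \<subseteq> V" if "neighborhood F V" for V
  proof -
    have "card U \<le> card (U \<inter> V)"
      using min[OF neighborhood_Int[OF U that]] .
    then have "U \<inter> V = U"
      using \<open>finite U\<close> by (metis Int_lower1 card_seteq)
    then show ?thesis by blast
  qed
  have "smallest_neighborhood F = U"
    unfolding smallest_neighborhood_def using U sub by (rule Least_equality)
  with U sub show "neighborhood F (smallest_neighborhood F)"
    and "neighborhood F V \<Longrightarrow> smallest_neighborhood F \<subseteq> V"
    by auto
qed

lemma shift_funpow: "(shift_map ^^ n) x i = x (i + int n)"
  by (induction n arbitrary: x i) (auto simp: shift_map_def algebra_simps funpow_swap1)

lemma cellular_automaton_translate: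
  assumes "cellular_automaton F"
  shows "F (\<lambda>i. x (i + k)) m = F x (m + k)"
proof -
  have comm: "F (shift_map x) = shift_map (F x)" for x
    using assms by (auto simp: cellular_automaton_def fun_eq_iff)
  have pow: "F ((shift_map ^^ n) x) = (shift_map ^^ n) (F x)" for n x
    by (induction n) (auto simp: comm)
  have nonneg: "F (\<lambda>i. x (i + int n)) m = F x (m + int n)" for n x m
  proof -
    have "(\<lambda>i. x (i + int n)) = (shift_map ^^ n) x"
      by (auto simp: shift_funpow)
    then show ?thesis
      by (simp add: pow shift_funpow)
  qed
  show ?thesis
  proof (cases "k \<ge> 0")
    case True
    then show ?thesis using nonneg[of x "nat k" m] by simp
  next
    case False
    then show ?thesis
      using nonneg[of "\<lambda>i. x (i + k)" "nat (- k)" "m + k"] by simp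
  qed
qed

lemma cellular_automaton_has_neighborhood:
  fixes F :: "(int \<Rightarrow> 'a::finite mod_ring) \<Rightarrow> (int \<Rightarrow> 'a mod_ring)"
  assumes F: "cellular_automaton F"
  shows "\<exists>U. neighborhood F U"
proof -
  let ?C = "\<lambda>J x. {y::int \<Rightarrow> 'a mod_ring. \<forall>i\<in>J. y i = x i}"
  have openC: "open (?C J x)" if "finite J" for J x
  proof -
    have "?C J x = Pi\<^sub>E UNIV (\<lambda>i. if i \<in> J then {x i} else UNIV)"
      by (auto simp: PiE_def Pi_def split: if_splits)
    moreover have "open \<dots>"
      using that by (intro open_PiE) (auto simp: open_mod_ring_def intro: finite_subset[of _ J])
    ultimately show ?thesis by simp
  qed
  have "\<exists>J. finite J \<and> (\<forall>y\<in>?C J x. F y 0 = F x 0)" for x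
  proof -
    let ?V = "{y. F y 0 = F x 0}"
    have "continuous_on UNIV (\<lambda>y. F y 0)"
      by (rule continuous_on_product_then_coordinatewise)
        (use F in \<open>simp add: cellular_automaton_def\<close>)
    then have "open ((\<lambda>y. F y 0) -` {F x 0})"
      by (rule open_vimage[rotated]) (simp add: open_mod_ring_def)
    then have "openin (product_topology (\<lambda>_. euclidean) UNIV) ?V"
      by (simp add: open_fun_def vimage_def)
    then obtain X where X: "x \<in> Pi\<^sub>E UNIV X" "finite {i. X i \<noteq> topspace euclidean}"
      "Pi\<^sub>E UNIV X \<subseteq> ?V"
      using product_topology_open_contains_basis[of "\<lambda>_. euclidean" UNIV ?V x] by auto
    show ?thesis
    proof (intro exI[of _ "{i. X i \<noteq> UNIV}"] conjI ballI)
      fix y assume "y \<in> ?C {i. X i \<noteq> UNIV} x"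
      with X(1) have "y \<in> Pi\<^sub>E UNIV X"
        unfolding PiE_UNIV_domain Pi_iff by (metis (mono_tags, lifting) UNIV_I mem_Collect_eq)
      with X(3) show "F y 0 = F x 0" by blast
    qed (use X(2) in simp)
  qed
  then have "\<forall>x. \<exists>J. finite J \<and> (\<forall>y\<in>?C J x. F y 0 = F x 0)"
    by blast
  from choice[OF this] obtain J
    where J': "\<forall>x. finite (J x) \<and> (\<forall>y\<in>?C (J x) x. F y 0 = F x 0)" ..
  then have J: "\<And>x. finite (J x)" "\<And>x y. y \<in> ?C (J x) x \<Longrightarrow> F y 0 = F x 0"
    by blast+
  have "compact_space (product_topology (\<lambda>_::int. euclidean :: 'a mod_ring topology) UNIV)"
    by (subst compact_space_product_topology)
      (auto simp: compact_space_def compactin_euclidean_iff finite_imp_compact)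
  then have "compact (UNIV :: (int \<Rightarrow> 'a mod_ring) set)"
    by (simp add: euclidean_product_topology compact_space_def)
  moreover have "UNIV \<subseteq> (\<Union>x\<in>UNIV. ?C (J x) x)"
    by blast
  ultimately obtain D where D: "finite D" "UNIV \<subseteq> (\<Union>x\<in>D. ?C (J x) x)"
    using openC[OF J(1)] by (elim compactE_image) auto
  define K where "K = (\<Union>x\<in>D. J x)"
  have "finite K"
    using D J by (auto simp: K_def)
  have K: "F y 0 = F z 0" if "\<forall>i\<in>K. y i = z i" for y z
  proof -
    obtain x where x: "x \<in> D" "y \<in> ?C (J x) x"
      using D by blast
    then have "z \<in> ?C (J x) x"
      using that by (auto simp: K_def)
    then have "F z 0 = F x 0"
      by (rule J(2))
    with J(2)[OF x(2)] show ?thesis by simp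
  qed
  obtain a b where ab: "K \<subseteq> {a..b}"
  proof -
    obtain k where "abs ` K \<subseteq> {..k}"
      using \<open>finite K\<close> by (auto simp: finite_int_iff_bounded_le)
    then have "K \<subseteq> {-k..k}"
      by (auto simp: image_subset_iff abs_le_iff)
    then show ?thesis by (rule that)
  qed
  have "neighborhood F {a..b}"
    unfolding neighborhood_iff
  proof (intro conjI allI impI)
    fix x y :: "int \<Rightarrow> 'a mod_ring" and m n assume eq: "\<forall>u\<in>{a..b}. x (m + u) = y (n + u)"
    have "F (\<lambda>i. x (i + m)) 0 = F (\<lambda>i. y (i + n)) 0"
      using eq ab by (intro K) (auto simp: add.commute)
    then show "F x m = F y n"
      by (simp add: cellular_automaton_translate[OF F])
  qed blast
  then show ?thesis ..
qed

end

theory Submission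
  imports Defs "HOL-Combinatorics.Cycles"
begin

text \<open>
  After composing with a power of the shift, \<open>F\<close> becomes \<open>act c\<close>, a polynomial \<open>c\<close> in the shift with
  nonzero constant coefficient. Positive entropy of \<open>F\<close> makes the entropy rate \<open>h\<close> of the shift positive,
  and comparing entropies of windows shows that, given \<open>act c\<^sup>n x\<close>, the point \<open>x\<close> retains at least
  \<open>h\<close> times \<open>degree c\<^sup>n\<close> of entropy. Hence on a set of measure bounded below many points of the
  fibre \<open>x + ker c\<^sup>n\<close> have positive conditional probability \<open>rho (x + d)\<close>.

  A power of the shift fixes every \<open>d \<in> ker c\<^sup>n\<close>, so \<open>x \<mapsto> rho (x + d)\<close> is invariant under that power and,
  by the hypothesis on invariant sets, under the shift \<open>\<sigma>\<close>. Where \<open>rho (x + d) > 0\<close>, translation by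
  \<open>d\<close> exchanges weighted copies of \<open>\<mu>\<close>. Comparing it with its conjugate by \<open>\<sigma>\<close>, a linear functional
  \<open>g\<close> with \<open>g (\<sigma> d) \<noteq> g d\<close> is equidistributed on the invariant set in question; only boundedly many
  \<open>d\<close> fail this for all translates of \<open>g\<close>. So all nontrivial functionals are equidistributed on the
  set \<open>G\<close> of points with unboundedly large fibre supports, \<open>\<mu>\<close> restricted to \<open>G\<close> is a multiple of the
  Bernoulli measure, and \<open>G\<close> is invariant under \<open>F\<close> as well; ergodicity gives \<open>\<mu> G = 1\<close>.

  For the divisibility, the shift permutes the ordered bases of the kernel in orbits of length \<open>p\<^sub>1\<close>.
\<close>

hide_const (open) up_ring.coeff Module.smult UnivPoly.monom

subsection \<open>Polynomials in the shift\<close>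

text \<open>One kernel alone gives an entropy inequality spoiled by constants. Replacing
  \<open>c\<close> by \<open>c ^ n\<close> multiplies the entropy to be accounted for by
  \<open>n\<close>, while the loss \<open>ln L + 1\<close> stays fixed; so the lower bound
  \<open>h / (4 * ln p)\<close> for the mass of points with more than \<open>L\<close> fibre
  companions is independent of \<open>L\<close>. The price is that the kernel of
  \<open>c ^ n\<close> has the period \<open>p ^ n * p\<^sub>1\<close>. The hypothesis at
  \<open>p * p\<^sub>1\<close> climbs to these exponents, because multiplying an exponent already
  divisible by \<open>p\<close> by another \<open>p\<close> creates no new invariant sets.

  The obstacle is that ergodicity holds for the joint action only, so no shift-invariant function
  may be taken as constant. Equidistribution is therefore proved on arbitrary shift-invariant
  pieces, and ergodicity enters once, at the very end.

  As the fibres are finite, the density of \<open>\<mu>\<close> against the sum of its kernel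
  translates replaces a disintegration. The exceptional \<open>d\<close> for a functional
  \<open>g\<close> are those killed by \<open>(X - 1) * g\<close>, and the size of that kernel is
  bounded by the degree of \<open>g\<close> alone, whatever \<open>n\<close> is.\<close>

definition act :: "'a::comm_ring_1 poly \<Rightarrow> (int \<Rightarrow> 'a) \<Rightarrow> int \<Rightarrow> 'a" where
  "act c x m = (\<Sum>i\<le>degree c. coeff c i * x (m + int i))"

lemma periodic_mult:
  fixes f :: "int \<Rightarrow> 'b"
  assumes "\<And>i. f (i + s) = f i"
  shows "f (i + s * k) = f i"
proof (induction k arbitrary: i rule: int_induct[of _ 0])
  case (step1 k)
  then show ?case using assms[of "i + s * k"] by (simp add: algebra_simps)
next
  case (step2 k)
  then show ?case using assms[of "i + s * (k - 1)"] by (simp add: algebra_simps)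
qed simp

lemma act_eq: "degree c \<le> n \<Longrightarrow> act c x m = (\<Sum>i\<le>n. coeff c i * x (m + int i))"
  unfolding act_def by (rule sum.mono_neutral_left) (auto simp: coeff_eq_0)

lemma act_0 [simp]: "act 0 x m = 0"
  by (simp add: act_def)

lemma act_pCons: "act (pCons a c) x m = a * x m + act c x (m + 1)"
proof -
  have "act (pCons a c) x m = (\<Sum>i\<le>Suc (degree c). coeff (pCons a c) i * x (m + int i))"
    by (rule act_eq) (simp add: degree_pCons_le)
  also have "\<dots> = a * x m + (\<Sum>i\<le>degree c. coeff c i * x (m + int (Suc i)))"
    by (subst sum.atMost_Suc_shift) simp
  also have "\<dots> = a * x m + act c x (m + 1)"
    by (simp add: act_def algebra_simps)
  finally show ?thesis .
qed

lemma act_1 [simp]: "act 1 x = x"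
  by (auto simp: fun_eq_iff act_def)

lemma act_add: "act (c + d) x m = act c x m + act d x m"
proof -
  let ?n = "max (degree c) (degree d)"
  have "degree (c + d) \<le> ?n" by (rule degree_add_le_max)
  then show ?thesis
    by (simp add: act_eq[of _ ?n] algebra_simps sum.distrib)
qed

lemma act_smult: "act (smult a c) x m = a * act c x m"
  by (subst act_eq[of _ "degree c"]) (auto simp: act_def degree_smult_le sum_distrib_left algebra_simps)

text \<open>Configurations are a module over polynomials, the indeterminate acting as the shift; the
  Horner recursion \<open>act_pCons\<close> reduces this to an induction on the left factor. It
  turns iterates of the automaton into powers of one polynomial.\<close>

lemma act_mult: "act (c * d) x = act c (act d x)"
proof (rule ext)
  show "act (c * d) x m = act c (act d x) m" for m
    by (induction c arbitrary: m) (auto simp: act_pCons act_add act_smult)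
qed

lemma act_power: "act (c ^ n) = act c ^^ n"
  by (induction n) (simp_all add: act_mult o_def)

lemma act_plus: "act c (\<lambda>i. x i + y i) m = act c x m + act c y m"
  by (simp add: act_def algebra_simps sum.distrib)

lemma act_minus: "act c (\<lambda>i. x i - y i) m = act c x m - act c y m"
  by (simp add: act_def algebra_simps sum_subtractf)

lemma act_translate: "act c (\<lambda>i. x (i + k)) m = act c x (m + k)"
  by (simp add: act_def algebra_simps)

lemma act_cong:
  "(\<And>i. m \<le> i \<Longrightarrow> i \<le> m + int (degree c) \<Longrightarrow> x i = y i) \<Longrightarrow> act c x m = act c y m"
  by (simp add: act_def)

definition ker :: "'a::comm_ring_1 poly \<Rightarrow> (int \<Rightarrow> 'a) set" where
  "ker c = {x. \<forall>m. act c x m = 0}"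

lemma ker_0: "(\<lambda>_. 0) \<in> ker c"
  by (simp add: ker_def act_def)

lemma ker_add: "x \<in> ker c \<Longrightarrow> y \<in> ker c \<Longrightarrow> (\<lambda>i. x i + y i) \<in> ker c"
  by (simp add: ker_def act_plus)

lemma ker_diff: "x \<in> ker c \<Longrightarrow> y \<in> ker c \<Longrightarrow> (\<lambda>i. x i - y i) \<in> ker c"
  by (simp add: ker_def act_minus)

lemma ker_uminus: "x \<in> ker c \<Longrightarrow> (\<lambda>i. - x i) \<in> ker c"
  using ker_diff[OF ker_0, of x c] by simp

lemma ker_translate: "x \<in> ker c \<Longrightarrow> (\<lambda>i. x (i + k)) \<in> ker c"
  by (simp add: ker_def act_translate)

text \<open>The recurrence is solved for its highest term, so zeros propagate to the right from a
  block of \<open>degree c\<close> zeros. Equations at places below \<open>b\<close> reach exactly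
  the places below \<open>b + degree c\<close>.\<close>

lemma vanish_right:
  fixes c :: "'a::field poly"
  assumes "c \<noteq> 0" and act: "\<And>i. a \<le> i \<Longrightarrow> i < b \<Longrightarrow> act c x i = 0"
    and zero: "\<And>i. a \<le> i \<Longrightarrow> i < a + int (degree c) \<Longrightarrow> x i = 0"
    and i: "a \<le> i" "i < b + int (degree c)"
  shows "x i = 0"
  using i
proof (induction "nat (i - a)" arbitrary: i rule: less_induct)
  case less
  show ?case
  proof (cases "i < a + int (degree c)")
    case True
    then show ?thesis using zero less by simp
  next
    case False
    let ?m = "i - int (degree c)"
    have "0 = act c x ?m"
      using act[of ?m] False less.prems by simp
    also have "\<dots> = (\<Sum>j<degree c. coeff c j * x (?m + int j)) + lead_coeff c * x i"
      by (simp add: act_def lessThan_Suc_atMost[symmetric])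
    also have "(\<Sum>j<degree c. coeff c j * x (?m + int j)) = 0"
      by (intro sum.neutral ballI) (use less.hyps less.prems False in simp)
    finally show ?thesis using assms(1) by simp
  qed
qed

text \<open>Here the recurrence is solved for its lowest term, which needs an invertible constant
  coefficient; this is why the automaton is first normalized by a power of the shift.\<close>

lemma vanish_left:
  fixes c :: "'a::field poly"
  assumes "coeff c 0 \<noteq> 0" and act: "\<And>i. i < a \<Longrightarrow> act c x i = 0"
    and zero: "\<And>i. a \<le> i \<Longrightarrow> i < a + int (degree c) \<Longrightarrow> x i = 0"
    and i: "i < a + int (degree c)"
  shows "x i = 0"
  using i
proof (induction "nat (a - i)" arbitrary: i rule: less_induct)
  case less
  show ?case
  proof (cases "a \<le> i")
    case True
    then show ?thesis using zero less by simp
  next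
    case False
    have "0 = act c x i"
      using act[of i] False by simp
    also have "\<dots> = coeff c 0 * x i + (\<Sum>j\<in>{1..degree c}. coeff c j * x (i + int j))"
      by (simp add: act_def atMost_atLeast0 sum.atLeast_Suc_atMost)
    also have "(\<Sum>j\<in>{1..degree c}. coeff c j * x (i + int j)) = 0"
      by (intro sum.neutral ballI) (use less.hyps less.prems False in simp)
    finally show ?thesis using assms(1) by simp
  qed
qed

lemma ker_eqI:
  fixes c :: "'a::field poly"
  assumes c: "coeff c 0 \<noteq> 0" and x: "x \<in> ker c" and y: "y \<in> ker c"
    and eq: "\<And>i. a \<le> i \<Longrightarrow> i < a + int (degree c) \<Longrightarrow> x i = y i"
  shows "x = y"
proof -
  have c0: "c \<noteq> 0" using c by auto
  let ?z = "\<lambda>i. x i - y i"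
  have z: "act c ?z m = 0" for m
    using ker_diff[OF x y] by (simp add: ker_def)
  have "?z i = 0" for i
  proof (cases "a \<le> i")
    case True
    show ?thesis
      by (rule vanish_right[of c a "i + 1" ?z, OF c0]) (use z eq True in auto)
  next
    case False
    show ?thesis
      by (rule vanish_left[of c a ?z, OF c]) (use z eq False in auto)
  qed
  then show ?thesis by (simp add: fun_eq_iff)
qed

text \<open>The companion map of a linear recurrence permutes the finite set of states, so it has finite
  order; this lets one run the recurrence in both directions.\<close>

lemma finite_inj_funpow_id:
  assumes "finite S" "inj_on f S" "f ` S \<subseteq> S"
  shows "\<exists>n>0. \<forall>x\<in>S. (f ^^ n) x = x"
proof -
  define g where "g x = (if x \<in> S then f x else x)" for x
  have fS: "f ` S = S" using assms by (simp add: endo_inj_surj)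
  then have "bij_betw g S S"
    using assms(2) by (auto simp: bij_betw_def g_def inj_on_def)
  then have "g permutes S"
    by (intro bij_imp_permutes) (auto simp: g_def)
  then have "permutation g"
    using assms(1) unfolding permutation_permutes by blast
  from permutation_is_nilpotent[OF this] obtain n where n: "g ^^ n = id" "n > 0" by auto
  have "(g ^^ m) x = (f ^^ m) x \<and> (f ^^ m) x \<in> S" if "x \<in> S" for m x
    using that assms(3) by (induction m) (auto simp: g_def)
  with n show ?thesis by (metis id_apply)
qed

text \<open>A block of \<open>degree c\<close> arbitrary values is a state of the companion map
  \<open>step\<close>. Together with \<open>ker_eqI\<close> this gives the kernel its full
  size.\<close>

lemma ker_extend:
  fixes c :: "'a::{finite,field} poly"
  assumes c: "coeff c 0 \<noteq> 0"
  shows "\<exists>d\<in>ker c. \<forall>i. a \<le> i \<longrightarrow> i < a + int (degree c) \<longrightarrow> d i = w i"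
proof (cases "degree c = 0")
  case True
  then show ?thesis using ker_0 by auto
next
  case False
  define e where "e = degree c"
  have e: "e > 0" using False by (simp add: e_def)
  define S where "S = {s :: nat \<Rightarrow> 'a. \<forall>i\<ge>e. s i = 0}"
  define step where "step s = (\<lambda>i. if i + 1 < e then s (i + 1)
      else if i + 1 = e then - (\<Sum>j<e. coeff c j * s j) / lead_coeff c else 0)" for s :: "nat \<Rightarrow> 'a"
  have lc: "lead_coeff c \<noteq> 0" using c by auto
  have "S = {f. f ` {i. i < e} \<subseteq> UNIV \<and> (\<forall>i. i \<notin> {i. i < e} \<longrightarrow> f i = 0)}" by (auto simp: S_def)
  then have "S \<subseteq> {f. \<forall>i. (i \<in> {i. i < e} \<longrightarrow> f i \<in> UNIV) \<and> (i \<notin> {i. i < e} \<longrightarrow> f i = 0)}" by auto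
  then have fin: "finite S"
    by (rule finite_subset) (rule finite_set_of_finite_funs; simp)
  have into: "step ` S \<subseteq> S" by (auto simp: step_def S_def)
  have inj: "inj_on step S"
  proof (rule inj_onI)
    fix s t assume st: "s \<in> S" "t \<in> S" "step s = step t"
    have pos: "s i = t i" if "i > 0" for i
    proof (cases "i < e")
      case True
      then show ?thesis using fun_cong[OF st(3), of "i - 1"] that by (simp add: step_def)
    next
      case False
      then show ?thesis using st by (simp add: S_def)
    qed
    \<comment> \<open>The map forgets only the oldest entry \<open>s 0\<close>, and the appended
      entry determines it because \<open>coeff c 0\<close> is nonzero.\<close>
    have "(\<Sum>j<e. coeff c j * s j) = (\<Sum>j<e. coeff c j * t j)"
      using fun_cong[OF st(3), of "e - 1"] e lc by (simp add: step_def)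
    then have "coeff c 0 * s 0 = coeff c 0 * t 0"
      using e pos by (simp add: sum.remove[of "{..<e}" 0])
    then have "s 0 = t 0" using c by simp
    with pos show "s = t" by (metis ext gr0I)
  qed
  obtain M where M: "M > 0" "\<And>s. s \<in> S \<Longrightarrow> (step ^^ M) s = s"
    using finite_inj_funpow_id[OF fin inj into] by blast
  define s where "s = (\<lambda>i. if i < e then w (a + int i) else 0)"
  have sS: "s \<in> S" by (simp add: s_def S_def)
  have stS: "(step ^^ k) s \<in> S" for k using sS into by (induction k) auto
  have per: "(step ^^ (k + M * q)) s = (step ^^ k) s" for k q
  proof (induction q)
    case (Suc q)
    have "(step ^^ (k + M * Suc q)) s = (step ^^ (k + M * q)) ((step ^^ M) s)"
      by (simp add: funpow_add[symmetric, unfolded o_def fun_eq_iff, rule_format] algebra_simps)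
    then show ?case using Suc M(2)[OF sS] by simp
  qed simp
  have modM: "(step ^^ (k mod M)) s = (step ^^ k) s" for k
    using per[of "k mod M" "k div M"] by simp
  \<comment> \<open>Time is reduced modulo the order \<open>M\<close> of the companion map, so the
    orbit makes sense at negative places as well.\<close>
  define d where "d i = (step ^^ (nat ((i - a) mod int M))) s 0" for i
  have d_shift: "d (m + int j) = (step ^^ (nat ((m - a) mod int M) + j)) s 0" for m j
  proof -
    have "nat ((m + int j - a) mod int M) = (nat ((m - a) mod int M) + j) mod M"
    proof -
      have "(m + int j - a) mod int M = ((m - a) mod int M + int j) mod int M"
        by (simp add: mod_simps algebra_simps)
      also have "\<dots> = int ((nat ((m - a) mod int M) + j) mod M)"
        using M(1) by (simp add: zmod_int)
      finally show ?thesis by simp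
    qed
    then show ?thesis by (simp add: d_def modM)
  qed
  have coord: "j < e \<Longrightarrow> (step ^^ (k + j)) s 0 = (step ^^ k) s j" for k j
  proof (induction j arbitrary: k)
    case (Suc j)
    have "(step ^^ (k + Suc j)) s 0 = (step ^^ (Suc k + j)) s 0" by simp
    also have "\<dots> = (step ^^ Suc k) s j" using Suc by (subst Suc.IH) auto
    also have "\<dots> = (step ^^ k) s (Suc j)" using Suc.prems by (simp add: step_def)
    finally show ?case .
  qed simp
  have "act c d m = 0" for m
  proof -
    define k where "k = nat ((m - a) mod int M)"
    have "act c d m = (\<Sum>j<e. coeff c j * d (m + int j)) + lead_coeff c * d (m + int e)"
      by (simp add: act_def lessThan_Suc_atMost[symmetric] e_def)
    also have "(\<Sum>j<e. coeff c j * d (m + int j)) = (\<Sum>j<e. coeff c j * (step ^^ k) s j)"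
      by (intro sum.cong refl) (simp add: d_shift coord flip: k_def)
    also have "d (m + int e) = (step ^^ (Suc k + (e - 1))) s 0"
      using e by (simp add: d_shift flip: k_def)
    also have "\<dots> = (step ^^ Suc k) s (e - 1)"
      by (rule coord) (use e in simp)
    also have "\<dots> = - (\<Sum>j<e. coeff c j * (step ^^ k) s j) / lead_coeff c"
      using e by (simp add: step_def)
    finally show ?thesis using lc by simp
  qed
  then have "d \<in> ker c" by (simp add: ker_def)
  moreover have "d i = w i" if "a \<le> i" "i < a + int (degree c)" for i
  proof -
    have "d i = (step ^^ (0 + nat (i - a))) s 0"
      using d_shift[of a "nat (i - a)"] that M(1) by simp
    also have "\<dots> = s (nat (i - a))" using that by (subst coord) (auto simp: e_def)
    also have "\<dots> = w i" using that by (simp add: s_def e_def)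
    finally show ?thesis .
  qed
  ultimately show ?thesis by blast
qed

lemma ker_bij:
  fixes c :: "'a::{finite,field} poly"
  assumes c: "coeff c 0 \<noteq> 0"
  shows "bij_betw (\<lambda>x. restrict x {a..<a + int (degree c)}) (ker c)
           ({a..<a + int (degree c)} \<rightarrow>\<^sub>E UNIV)"
proof (rule bij_betwI')
  let ?I = "{a..<a + int (degree c)}"
  fix x y assume xy: "x \<in> ker c" "y \<in> ker c"
  show "(restrict x ?I = restrict y ?I) = (x = y)"
  proof
    assume eq: "restrict x ?I = restrict y ?I"
    show "x = y"
      by (rule ker_eqI[OF c xy, of a]) (metis eq atLeastLessThan_iff restrict_apply')
  qed simp
next
  fix y assume y: "y \<in> {a..<a + int (degree c)} \<rightarrow>\<^sub>E (UNIV :: 'a set)"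
  obtain d where "d \<in> ker c" "\<forall>i. a \<le> i \<longrightarrow> i < a + int (degree c) \<longrightarrow> d i = y i"
    using ker_extend[OF c] by blast
  with y show "\<exists>x\<in>ker c. y = restrict x {a..<a + int (degree c)}"
    by (intro bexI[of _ d]) (auto simp: fun_eq_iff PiE_def extensional_def)
qed auto

lemma card_ker:
  fixes c :: "'a::{finite,field} poly"
  assumes c: "coeff c 0 \<noteq> 0"
  shows "card (ker c) = CARD('a) ^ degree c" and "finite (ker c)"
proof -
  note bij = ker_bij[OF c, of 0]
  have "finite ({0..<0 + int (degree c)} \<rightarrow>\<^sub>E (UNIV :: 'a set))"
    by (intro finite_PiE) auto
  then show "finite (ker c)" using bij_betw_finite[OF bij] by simp
  show "card (ker c) = CARD('a) ^ degree c"
    using bij_betw_same_card[OF bij] by (simp add: card_PiE)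
qed

text \<open>A vanishing constant coefficient is a factor equal to the shift, which is injective and
  can be cancelled. The bound will be applied to \<open>[:- 1, 1:] * g\<close>, whose constant
  coefficient may vanish.\<close>

lemma card_ker_le:
  fixes c :: "'a::{finite,field} poly"
  assumes "c \<noteq> 0"
  shows "finite (ker c) \<and> card (ker c) \<le> CARD('a) ^ degree c"
  using assms
proof (induction c rule: pCons_induct)
  case (pCons a c)
  show ?case
  proof (cases "a = 0")
    case False
    then show ?thesis using card_ker[of "pCons a c"] by simp
  next
    case True
    then have c: "c \<noteq> 0" using pCons.hyps by simp
    have "act c x m = 0" if "x \<in> ker (pCons a c)" for x m
    proof -
      have "act (pCons a c) x (m - 1) = 0" using that by (simp add: ker_def)
      then show ?thesis using True by (simp add: act_pCons)
    qed
    then have "ker (pCons a c) \<subseteq> ker c" by (auto simp: ker_def)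
    moreover have "CARD('a) ^ degree c \<le> CARD('a) ^ degree (pCons a c)"
      using c by (intro power_increasing) (auto simp: Suc_leI)
    ultimately show ?thesis
      using pCons.IH[OF c] by (meson card_mono finite_subset le_trans)
  qed
qed simp

text \<open>The window form of the fact that fibres of \<open>act c\<close> are cosets of the
  kernel. The kernel element is read off from the first \<open>degree c\<close> places, and the
  recurrence propagates the agreement through the rest of the longer window.\<close>

lemma act_eq_on_iff:
  fixes c :: "'a::{finite,field} poly"
  assumes c: "coeff c 0 \<noteq> 0" and ab: "a \<le> b"
  shows "(\<forall>i\<in>{a..<b}. act c x i = act c y i) \<longleftrightarrow>
         (\<exists>d\<in>ker c. \<forall>i\<in>{a..<b + int (degree c)}. x i = y i + d i)"
proof
  assume eq: "\<forall>i\<in>{a..<b}. act c x i = act c y i"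
  have c0: "c \<noteq> 0" using c by auto
  obtain d where d: "d \<in> ker c" "\<And>i. a \<le> i \<Longrightarrow> i < a + int (degree c) \<Longrightarrow> d i = x i - y i"
    using ker_extend[OF c, of a "\<lambda>i. x i - y i"] by blast
  let ?z = "\<lambda>i. x i - y i - d i"
  have "?z i = 0" if "a \<le> i" "i < b + int (degree c)" for i
    by (rule vanish_right[of c a b ?z, OF c0])
      (use d eq that in \<open>auto simp: act_minus ker_def\<close>)
  then have "\<forall>i\<in>{a..<b + int (degree c)}. x i = y i + d i" by (auto simp: algebra_simps)
  with d(1) show "\<exists>d\<in>ker c. \<forall>i\<in>{a..<b + int (degree c)}. x i = y i + d i" by blast
next
  assume "\<exists>d\<in>ker c. \<forall>i\<in>{a..<b + int (degree c)}. x i = y i + d i"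
  then obtain d where d: "d \<in> ker c" "\<forall>i\<in>{a..<b + int (degree c)}. x i = y i + d i" by blast
  show "\<forall>i\<in>{a..<b}. act c x i = act c y i"
  proof
    fix i assume "i \<in> {a..<b}"
    then have "act c x i = act c (\<lambda>i. y i + d i) i"
      using d(2) by (intro act_cong) auto
    then show "act c x i = act c y i" using d(1) by (simp add: act_plus ker_def)
  qed
qed

subsection \<open>Linear cellular automata\<close>

text \<open>Additivity already gives homogeneity, since every scalar of the prime field is some
  \<open>of_nat n\<close>.\<close>

lemma linear_ca_sum:
  fixes F :: "(int \<Rightarrow> 'p::prime_card mod_ring) \<Rightarrow> int \<Rightarrow> 'p mod_ring"
  assumes F: "linear_ca F" and J: "finite J"
  shows "F (\<lambda>i. if i \<in> J then x i else 0) m = (\<Sum>u\<in>J. x u * F (\<lambda>i. if i = u then 1 else 0) m)"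
proof -
  have add: "F (\<lambda>i. x i + y i) m = F x m + F y m" for x y
    using F by (simp add: linear_ca_def fun_eq_iff)
  have "F (\<lambda>_. 0) m + 0 = F (\<lambda>_. 0) m + F (\<lambda>_. 0) m"
    using add[of "\<lambda>_. 0" "\<lambda>_. 0"] by (simp only: add_0_right)
  then have zero: "F (\<lambda>_. 0) m = 0"
    by (simp only: add_left_cancel)
  have smult_nat: "F (\<lambda>i. of_nat n * y i) m = of_nat n * F y m" for n y
    by (induction n) (simp_all add: zero add algebra_simps)
  have smult: "F (\<lambda>i. a * y i) m = a * F y m" for a y
  proof -
    obtain n where "a = of_nat n" using surj_of_nat_mod_ring[of a] by blast
    then show ?thesis using smult_nat by simp
  qed
  show ?thesis
    using J
  proof induction
    case empty
    then show ?case using zero by simp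
  next
    case (insert u J)
    have "(\<lambda>i. if i \<in> insert u J then x i else 0) =
        (\<lambda>i. x u * (if i = u then 1 else 0) + (if i \<in> J then x i else 0))"
      using insert.hyps by (auto simp: fun_eq_iff)
    then show ?case
      using insert by (simp only: add smult) simp
  qed
qed

lemma linear_ca_act:
  fixes F :: "(int \<Rightarrow> 'p::prime_card mod_ring) \<Rightarrow> int \<Rightarrow> 'p mod_ring"
  assumes F: "linear_ca F" and U: "neighborhood F {a..b}" and ab: "a \<le> b"
  obtains c where "degree c \<le> nat (b - a)" "\<And>x m. F x m = act c x (m + a)"
proof -
  define f where "f i = F (\<lambda>k. if k = a + int i then 1 else 0) 0" for i :: nat
  define n where "n = nat (b - a)"
  define c where "c = (\<Sum>i\<le>n. monom (f i) i)"
  have coeff: "coeff c i = (if i \<le> n then f i else 0)" for i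
    by (simp add: c_def coeff_sum)
  have deg: "degree c \<le> n"
    by (rule degree_le) (simp add: coeff)
  have ca: "cellular_automaton F" using F by (simp add: linear_ca_def)
  have at0: "F x 0 = act c x a" for x
  proof -
    have "F x 0 = F (\<lambda>i. if i \<in> {a..b} then x i else 0) 0"
      using U unfolding neighborhood_iff by (auto intro!: spec2[where P="\<lambda>x y. _ x y"])
    also have "\<dots> = (\<Sum>u\<in>{a..b}. x u * F (\<lambda>i. if i = u then 1 else 0) 0)"
      by (rule linear_ca_sum[OF F]) simp
    also have "\<dots> = (\<Sum>i\<le>n. coeff c i * x (a + int i))"
      by (rule sum.reindex_bij_witness[of _ "\<lambda>i. a + int i" "\<lambda>u. nat (u - a)"])
        (use ab in \<open>auto simp: coeff f_def n_def\<close>)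
    also have "\<dots> = act c x a" using act_eq[OF deg] by metis
    finally show ?thesis .
  qed
  have "F x m = act c x (m + a)" for x m
    using cellular_automaton_translate[OF ca, of x m 0] at0[of "\<lambda>i. x (i + m)"]
    by (simp add: act_translate algebra_simps)
  with deg that show ?thesis by (simp add: n_def)
qed

text \<open>If an end coefficient vanished, a shorter interval would still be a neighborhood,
  against minimality. The two invertible end coefficients are what both directions of the recurrence
  rely on.\<close>

lemma linear_ca_bipermutative:
  fixes F :: "(int \<Rightarrow> 'p::prime_card mod_ring) \<Rightarrow> int \<Rightarrow> 'p mod_ring"
  assumes F: "linear_ca F" and U: "smallest_neighborhood F = {a..b}" and ab: "a < b"
  obtains c where "degree c = nat (b - a)" "coeff c 0 \<noteq> 0" "\<And>x m. F x m = act c x (m + a)"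
proof -
  have ca: "cellular_automaton F" using F by (simp add: linear_ca_def)
  obtain W where W: "neighborhood F W"
    using cellular_automaton_has_neighborhood[OF ca] by blast
  have N: "neighborhood F {a..b}"
    and least: "\<And>V. neighborhood F V \<Longrightarrow> {a..b} \<subseteq> V"
    using smallest_neighborhood[OF W] U by auto
  obtain c where c: "degree c \<le> nat (b - a)" "\<And>x m. F x m = act c x (m + a)"
    using linear_ca_act[OF F N] ab by auto
  have "degree c = nat (b - a)"
  proof (rule ccontr)
    assume "degree c \<noteq> nat (b - a)"
    then have lt: "a + int (degree c) \<le> b - 1" using c(1) ab by linarith
    have "neighborhood F {a..b - 1}"
      unfolding neighborhood_iff
    proof (intro conjI allI impI)
      fix x y :: "int \<Rightarrow> 'p mod_ring" and m n
      assume eq: "\<forall>u\<in>{a..b - 1}. x (m + u) = y (n + u)"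
      show "F x m = F y n"
        unfolding c(2) act_def
        by (intro sum.cong refl arg_cong2[where f="(*)"])
          (use eq[rule_format, of "a + int _"] lt in \<open>auto simp: add.assoc\<close>)
    qed blast
    from least[OF this] ab show False by auto
  qed
  moreover have "coeff c 0 \<noteq> 0"
  proof
    assume 0: "coeff c 0 = 0"
    have "neighborhood F {a + 1..b}"
      unfolding neighborhood_iff
    proof (intro conjI allI impI)
      fix x y :: "int \<Rightarrow> 'p mod_ring" and m n
      assume eq: "\<forall>u\<in>{a + 1..b}. x (m + u) = y (n + u)"
      show "F x m = F y n"
        unfolding c(2) act_def
      proof (intro sum.cong refl)
        fix i assume i: "i \<in> {..degree c}"
        show "coeff c i * x (m + a + int i) = coeff c i * y (n + a + int i)"
        proof (cases "i = 0")
          case False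
          then have "a + int i \<in> {a + 1..b}" using i c(1) ab by auto
          then show ?thesis using eq by (metis add.assoc)
        qed (simp add: 0)
      qed
    qed blast
    from least[OF this] ab show False by auto
  qed
  ultimately show ?thesis using that c(2) by blast
qed

subsection \<open>The period of the kernel\<close>

text \<open>With \<open>?N = p ^ n * q\<close>, the difference \<open>y\<close> of \<open>x\<close>
  shifted by \<open>?N\<close> and \<open>x\<close> lies in the kernel of \<open>c ^ n\<close>, so
  it has period \<open>?N\<close> by induction. Along multiples of \<open>?N\<close> the values of
  \<open>x\<close> thus form an arithmetic progression with increment \<open>y i\<close>, which
  closes up after \<open>p\<close> steps.\<close>

lemma ker_power_periodic:
  fixes c :: "'p::nontriv mod_ring poly"
  assumes q: "\<And>x i. x \<in> ker c \<Longrightarrow> x (i + int q) = x i"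
    and x: "x \<in> ker (c ^ n)"
  shows "x (i + int (CARD('p) ^ n * q)) = x i"
  using x
proof (induction n arbitrary: x i)
  case 0
  then show ?case by (simp add: ker_def)
next
  case (Suc n)
  let ?N = "CARD('p) ^ n * q"
  have mult: "z (i + int (k * q)) = z i" if "z \<in> ker c" for z i k
    using periodic_mult[of z "int q" i "int k", OF q[OF that]] by (simp add: mult.commute)
  define y where "y i = x (i + int ?N) - x i" for i
  have "act (c ^ n) x \<in> ker c"
    using Suc.prems by (simp add: ker_def act_mult)
  then have "act (c ^ n) y m = 0" for m
    using mult[of "act (c ^ n) x" m "CARD('p) ^ n"]
    by (simp add: y_def[abs_def] act_minus act_translate)
  then have "y \<in> ker (c ^ n)" by (simp add: ker_def)
  then have y: "y (i + int ?N) = y i" for i by (rule Suc.IH)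
  have "x (i + int (k * ?N)) = x i + of_nat k * y i" for k
  proof (induction k)
    case (Suc k)
    have yk: "y (i + int (k * ?N)) = y i"
      using periodic_mult[of y "int ?N" i "int k", OF y] by (simp add: mult.commute)
    have "x (i + int (Suc k * ?N)) = x (i + int (k * ?N)) + y (i + int (k * ?N))"
      by (simp add: y_def algebra_simps)
    then show ?case using Suc yk by (simp add: algebra_simps)
  qed simp
  from this[of "CARD('p)"] show ?case by (simp add: algebra_simps)
qed

text \<open>A common period exists because the shift permutes the finite kernel. For the
  divisibility, a nonzero remainder would be a smaller positive common period.\<close>

lemma kernel_period:
  fixes c :: "'a::{finite,field} poly"
  assumes c: "coeff c 0 \<noteq> 0" and K: "kernel F = ker c"
  shows "kernel_period F > 0"
    and "x \<in> ker c \<Longrightarrow> (shift_map ^^ kernel_period F) x = x"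
    and "(\<And>x. x \<in> ker c \<Longrightarrow> (shift_map ^^ n) x = x) \<Longrightarrow> kernel_period F dvd n"
proof -
  have "inj_on shift_map (ker c)"
    by (auto simp: inj_on_def shift_map_def fun_eq_iff) (metis diff_add_cancel)
  moreover have "shift_map ` ker c \<subseteq> ker c"
    by (auto simp: shift_map_def ker_translate)
  ultimately have "\<exists>n>0. \<forall>x\<in>ker c. (shift_map ^^ n) x = x"
    by (intro finite_inj_funpow_id card_ker c)
  from LeastI_ex[OF this]
  have *: "kernel_period F > 0 \<and> (\<forall>x\<in>ker c. (shift_map ^^ kernel_period F) x = x)"
    unfolding kernel_period_def K .
  then show "kernel_period F > 0" "x \<in> ker c \<Longrightarrow> (shift_map ^^ kernel_period F) x = x"
    by auto
  assume n: "\<And>x. x \<in> ker c \<Longrightarrow> (shift_map ^^ n) x = x"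
  let ?p = "kernel_period F"
  have "(shift_map ^^ (n mod ?p)) x = x" if x: "x \<in> ker c" for x
  proof -
    have "(shift_map ^^ (?p * k)) x = x" for k
      using * x by (simp add: funpow_mult[symmetric]) (induction k; simp)
    then have "(shift_map ^^ (n mod ?p)) x = (shift_map ^^ (n mod ?p + ?p * (n div ?p))) x"
      by (simp only: funpow_add o_apply)
    then show ?thesis using n[OF x] by simp
  qed
  then have "\<not> (n mod ?p > 0 \<and> n mod ?p < ?p)"
    using not_less_Least[of "n mod ?p" "\<lambda>n. n > 0 \<and> (\<forall>x\<in>kernel F. (shift_map ^^ n) x = x)"] K
    unfolding kernel_period_def by blast
  then show "?p dvd n" using * by (auto simp: dvd_eq_mod_eq_0)
qed

section \<open>Counting ordered bases of the kernel\<close>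

primrec lspan :: "('b \<Rightarrow> 'a::field) list \<Rightarrow> ('b \<Rightarrow> 'a) set" where
  "lspan [] = {\<lambda>_. 0}"
| "lspan (x # xs) = {\<lambda>i. a * x i + y i | a y. y \<in> lspan xs}"

text \<open>Each vector is asked to avoid the span of the later ones, to match a count that prepends
  one vector at a time.\<close>

primrec lindep :: "('b \<Rightarrow> 'a::field) list \<Rightarrow> bool" where
  "lindep [] = True"
| "lindep (x # xs) = (x \<notin> lspan xs \<and> lindep xs)"

lemma lspan_smult: "y \<in> lspan xs \<Longrightarrow> (\<lambda>i. a * y i) \<in> lspan xs"
proof (induction xs arbitrary: y)
  case (Cons x xs)
  then obtain b z where "y = (\<lambda>i. b * x i + z i)" "z \<in> lspan xs" by auto
  with Cons.IH[of z] show ?case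
    by (auto simp: algebra_simps intro!: exI[of _ "a * b"] exI[of _ "\<lambda>i. a * z i"])
qed simp

lemma lspan_add: "y \<in> lspan xs \<Longrightarrow> z \<in> lspan xs \<Longrightarrow> (\<lambda>i. y i + z i) \<in> lspan xs"
proof (induction xs arbitrary: y z)
  case (Cons x xs)
  from Cons.prems obtain b y' b' z' where "y = (\<lambda>i. b * x i + y' i)" "y' \<in> lspan xs"
     "z = (\<lambda>i. b' * x i + z' i)" "z' \<in> lspan xs" by auto
  with Cons.IH[of y' z'] show ?case
    by (auto simp: algebra_simps intro!: exI[of _ "b + b'"] exI[of _ "\<lambda>i. y' i + z' i"])
qed simp

lemma card_lspan:
  fixes xs :: "('b \<Rightarrow> 'a::{finite,field}) list"
  assumes "lindep xs"
  shows "finite (lspan xs) \<and> card (lspan xs) = CARD('a) ^ length xs"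
  using assms
proof (induction xs)
  case (Cons x xs)
  let ?f = "\<lambda>(a, y) i. a * x i + y i"
  have eq: "lspan (x # xs) = ?f ` (UNIV \<times> lspan xs)" by auto
  have "inj_on ?f (UNIV \<times> lspan xs)"
  proof (clarsimp simp: inj_on_def)
    fix a y b z assume y: "y \<in> lspan xs" and z: "z \<in> lspan xs"
      and e: "(\<lambda>i. a * x i + y i) = (\<lambda>i. b * x i + z i)"
    have ab: "a = b"
    proof (rule ccontr)
      assume ne: "a \<noteq> b"
      have "x i = 1 / (a - b) * (z i + (- 1) * y i)" for i
        using fun_cong[OF e, of i] ne by (simp add: field_simps)
      then have "x = (\<lambda>i. 1 / (a - b) * (z i + (- 1) * y i))" by (rule ext)
      also have "\<dots> \<in> lspan xs"
        by (intro lspan_smult lspan_add y z)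
      finally show False using Cons.prems by simp
    qed
    with e show "a = b \<and> y = z" by (auto simp: fun_eq_iff)
  qed
  then show ?case
    using Cons unfolding eq by (simp add: card_image card_cartesian_product)
qed simp

lemma lspan_mono:
  assumes "set xs \<subseteq> ker c" shows "lspan xs \<subseteq> ker c"
  using assms
proof (induction xs)
  case Nil
  then show ?case using ker_0 by simp
next
  case (Cons x xs)
  have "(\<lambda>i. a * x i) \<in> ker c" for a
    using Cons.prems by (simp add: ker_def act_def sum_distrib_left[symmetric] mult.left_commute)
  with Cons show ?case by (auto intro!: ker_add)
qed

text \<open>Prepending to an independent list of length \<open>k\<close> excludes exactly the
  \<open>CARD('a) ^ k\<close> vectors of its span. At \<open>k = degree c\<close> this is the order
  of a general linear group.\<close>

lemma card_lindep_lists: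
  fixes c :: "'a::{finite,field} poly"
  assumes c: "coeff c 0 \<noteq> 0"
  defines "B \<equiv> \<lambda>k. {xs. set xs \<subseteq> ker c \<and> lindep xs \<and> length xs = k}"
  shows "finite (B k) \<and> card (B k) = (\<Prod>i<k. CARD('a) ^ degree c - CARD('a) ^ i)"
proof (induction k)
  case 0
  have "B 0 = {[]}" by (auto simp: B_def)
  then show ?case by simp
next
  case (Suc k)
  have eq: "B (Suc k) = (\<lambda>(xs, x). x # xs) ` (SIGMA xs:B k. ker c - lspan xs)"
    by (auto simp: B_def length_Suc_conv image_iff)
  have "finite (ker c - lspan xs)" for xs
    using card_ker(2)[OF c] by simp
  moreover have "card (ker c - lspan xs) = CARD('a) ^ degree c - CARD('a) ^ k" if "xs \<in> B k" for xs
    using that card_lspan[of xs] lspan_mono[of xs c] card_ker[OF c]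
    by (auto simp: B_def card_Diff_subset)
  ultimately show ?case
    unfolding eq using Suc by (subst card_image) (auto simp: inj_on_def card_SigmaI)
qed

text \<open>The hypothesis \<open>per\<close> gives every point the exact period \<open>q\<close>,
  so the orbits partition \<open>B\<close> into classes of size \<open>q\<close>.\<close>

lemma dvd_card_free_orbits:
  assumes B: "finite B" "f ` B \<subseteq> B"
    and per: "q > 0" "\<And>x n. x \<in> B \<Longrightarrow> (f ^^ n) x = x \<longleftrightarrow> q dvd n"
  shows "q dvd card B"
proof -
  define orb where "orb x = (\<lambda>i. (f ^^ i) x) ` {..<q}" for x
  have fB: "(f ^^ n) x \<in> B" if "x \<in> B" for x n
    using that B(2) by (induction n) auto
  have add_mult: "(f ^^ (n + q * k)) x = (f ^^ n) x" if "x \<in> B" for x n k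
  proof -
    have "(f ^^ (q * k)) x = x" using per(2)[OF that] by simp
    then show ?thesis by (simp only: funpow_add o_apply)
  qed
  have mod: "(f ^^ (n mod q)) x = (f ^^ n) x" if "x \<in> B" for x n
    using add_mult[OF that, of "n mod q" "n div q"] by simp
  have orb_eq: "orb x = range (\<lambda>i. (f ^^ i) x)" if x: "x \<in> B" for x
  proof -
    have "(f ^^ n) x \<in> orb x" for n
      unfolding orb_def mod[OF x, of n, symmetric] using per(1) by (intro imageI) simp
    then show ?thesis by (auto simp: orb_def)
  qed
  have orb_shift: "orb ((f ^^ i) y) = orb y" if y: "y \<in> B" for i y
  proof -
    have 1: "(f ^^ k) ((f ^^ i) y) = (f ^^ (k + i)) y" for k
      by (simp add: funpow_add)
    have "(f ^^ j) y = (f ^^ (j + (q - 1) * i)) ((f ^^ i) y)" for j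
    proof -
      \<comment> \<open>Only forward powers of \<open>f\<close> are available;
        \<open>(q - 1) * i\<close> further steps undo \<open>i\<close> steps.\<close>
      have "j + (q - 1) * i + i = j + q * i"
        using per(1) by (cases q) auto
      then show ?thesis using add_mult[OF y, of j i] by (simp only: 1)
    qed
    then have "(f ^^ j) y \<in> range (\<lambda>k. (f ^^ k) ((f ^^ i) y))" for j by blast
    then show ?thesis
      unfolding orb_eq[OF y] orb_eq[OF fB[OF y]] using 1 by auto
  qed
  have U: "\<Union> (orb ` B) = B"
  proof (intro equalityI subsetI)
    fix x assume "x \<in> B"
    then have "x \<in> orb x" using orb_eq[of x] rangeI[of "\<lambda>i. (f ^^ i) x" 0] by simp
    with \<open>x \<in> B\<close> show "x \<in> \<Union> (orb ` B)" by blast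
  qed (use fB in \<open>auto simp: orb_def\<close>)
  have "q dvd card (\<Union> (orb ` B))"
  proof (rule dvd_partition)
    show "finite (\<Union> (orb ` B))" using B(1) U by simp
    show "\<forall>C\<in>orb ` B. q dvd card C"
    proof
      fix C assume "C \<in> orb ` B"
      then obtain x where x: "x \<in> B" "C = orb x" by auto
      have "inj_on (\<lambda>i. (f ^^ i) x) {..<q}"
      proof (rule linorder_inj_onI')
        fix i j assume ij: "i \<in> {..<q}" "j \<in> {..<q}" "i < j"
        show "(f ^^ i) x \<noteq> (f ^^ j) x"
        proof
          assume e: "(f ^^ i) x = (f ^^ j) x"
          have "(f ^^ (j - i)) ((f ^^ i) x) = (f ^^ (j - i + i)) x"
            by (simp only: funpow_add o_apply)
          also have "\<dots> = (f ^^ i) x" using e ij by simp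
          finally have "q dvd j - i" using per(2) fB[OF x(1)] by blast
          then show False using ij by (auto dest: dvd_imp_le)
        qed
      qed
      then show "q dvd card C" using x by (simp add: orb_def card_image)
    qed
    show "\<forall>c1\<in>orb ` B. \<forall>c2\<in>orb ` B. c1 \<noteq> c2 \<longrightarrow> c1 \<inter> c2 = {}"
    proof (intro ballI impI)
      fix C1 C2 assume "C1 \<in> orb ` B" "C2 \<in> orb ` B" "C1 \<noteq> C2"
      moreover have "orb z = orb x" if "x \<in> B" "z \<in> orb x" for x z
        using that orb_shift[OF that(1)] by (auto simp: orb_def)
      ultimately show "C1 \<inter> C2 = {}" by blast
    qed
  qed
  with U show ?thesis by simp
qed

text \<open>A power of the shift fixes all entries of a basis exactly when it fixes the whole
  kernel, so every ordered basis has an orbit of length \<open>kernel_period F\<close>.\<close>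

lemma kernel_period_dvd:
  fixes c :: "'a::{finite,field} poly"
  assumes c: "coeff c 0 \<noteq> 0" and K: "kernel F = ker c"
  shows "kernel_period F dvd (\<Prod>i<degree c. CARD('a) ^ degree c - CARD('a) ^ i)"
proof -
  define B where "B = {xs. set xs \<subseteq> ker c \<and> lindep xs \<and> length xs = degree c}"
  have B: "finite B" "card B = (\<Prod>i<degree c. CARD('a) ^ degree c - CARD('a) ^ i)"
    using card_lindep_lists[OF c, of "degree c"] by (simp_all add: B_def)
  have inj: "shift_map x = shift_map y \<longleftrightarrow> x = y" for x y :: "int \<Rightarrow> 'a"
    by (auto simp: shift_map_def fun_eq_iff) (metis diff_add_cancel)
  have lspan_shift: "lspan (map shift_map xs) = shift_map ` lspan xs" for xs :: "(int \<Rightarrow> 'a) list"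
  proof (induction xs)
    case (Cons x xs)
    show ?case
    proof (intro equalityI subsetI)
      fix z assume "z \<in> lspan (map shift_map (x # xs))"
      then obtain a y where "y \<in> lspan xs" "z = (\<lambda>i. a * shift_map x i + shift_map y i)"
        using Cons by auto
      then show "z \<in> shift_map ` lspan (x # xs)"
        by (intro image_eqI[of _ _ "\<lambda>i. a * x i + y i"]) (auto simp: shift_map_def)
    next
      fix z assume "z \<in> shift_map ` lspan (x # xs)"
      then obtain a y where "y \<in> lspan xs" "z = (\<lambda>i. a * shift_map x i + shift_map y i)"
        by (auto simp: shift_map_def)
      then show "z \<in> lspan (map shift_map (x # xs))"
        using Cons by auto
    qed
  qed (auto simp: shift_map_def)
  have lindep_shift: "lindep (map shift_map xs) = lindep xs" for xs :: "(int \<Rightarrow> 'a) list"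
    by (induction xs) (auto simp: lspan_shift inj image_iff)
  have "map shift_map ` B \<subseteq> B"
    by (auto simp: B_def lindep_shift) (auto simp: shift_map_def ker_translate subset_iff)
  moreover have pow: "(map shift_map ^^ n) xs = map (shift_map ^^ n) xs" for n and xs :: "(int \<Rightarrow> 'a) list"
    by (induction n) auto
  have "(map shift_map ^^ n) xs = xs \<longleftrightarrow> kernel_period F dvd n" if xs: "xs \<in> B" for xs n
  proof
    assume "(map shift_map ^^ n) xs = xs"
    then have fix_xs: "\<forall>x\<in>set xs. (shift_map ^^ n) x = x"
      by (simp add: pow map_idI list_eq_iff_nth_eq all_set_conv_all_nth)
    have fix_span: "(shift_map ^^ n) y = y" if "y \<in> lspan ys" "\<forall>x\<in>set ys. (shift_map ^^ n) x = x" for y ys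
      using that
    proof (induction ys arbitrary: y)
      case (Cons x ys)
      then show ?case by (auto simp: shift_funpow fun_eq_iff)
    qed (auto simp: shift_funpow fun_eq_iff)
    have "lspan xs = ker c"
      by (rule card_subset_eq)
        (use xs card_lspan[of xs] lspan_mono[of xs c] card_ker[OF c] in \<open>auto simp: B_def\<close>)
    with fix_span fix_xs show "kernel_period F dvd n"
      by (intro kernel_period(3)[OF c K]) auto
  next
    assume "kernel_period F dvd n"
    then obtain k where n: "n = kernel_period F * k" by blast
    have "(shift_map ^^ n) x = x" if "x \<in> ker c" for x
      using kernel_period(2)[OF c K that] unfolding n by (simp add: funpow_mult[symmetric]) (induction k; simp)
    with xs show "(map shift_map ^^ n) xs = xs"
      by (auto simp: pow B_def intro!: map_idI)
  qed
  ultimately have "kernel_period F dvd card B"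
    by (intro dvd_card_free_orbits[of B "map shift_map"] B(1) kernel_period(1)[OF c K])
  with B show ?thesis by simp
qed

text \<open>Raising the dimension from \<open>r\<close> to \<open>r + 1\<close> multiplies the
  product by \<open>(p ^ (r + 1) - 1) * p ^ r\<close>. This bridges the gap between
  \<open>degree c\<close> and the \<open>r\<close> of the theorem, which counts 0 into the
  neighborhood.\<close>

lemma GL_order_dvd:
  fixes p d r :: nat
  assumes "d \<le> r"
  shows "(\<Prod>i<d. p ^ d - p ^ i) dvd (\<Prod>i<r. p ^ r - p ^ i)"
  using assms
proof (induction r rule: dec_induct)
  case (step r)
  have "(\<Prod>i<Suc r. p ^ Suc r - p ^ i) = (p ^ Suc r - 1) * (\<Prod>i<r. p * (p ^ r - p ^ i))"
    by (subst prod.lessThan_Suc_shift) (simp add: diff_mult_distrib2)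
  also have "\<dots> = (p ^ Suc r - 1) * (p ^ r) * (\<Prod>i<r. p ^ r - p ^ i)"
    by (simp add: prod.distrib)
  finally show ?case using step.IH by (metis dvd_mult)
qed simp

subsection \<open>Windows\<close>

lemma sets_borel_mod_ring: "sets (borel :: 'a::finite mod_ring measure) = UNIV"
  by (auto simp: open_mod_ring_def intro: borel_open)

lemma sets_borel_configuration:
  "sets (borel :: (int \<Rightarrow> 'a::finite mod_ring) measure) = sets (PiM UNIV (\<lambda>_. count_space UNIV))"
proof -
  have "sets (PiM (UNIV :: int set) (\<lambda>_. borel :: 'a mod_ring measure)) =
      sets (PiM UNIV (\<lambda>_. count_space UNIV))"
    by (intro sets_PiM_cong) (auto simp: sets_borel_mod_ring)
  then show ?thesis by (simp add: sets_PiM_equal_borel)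
qed

lemma measurable_coordinate:
  "(\<lambda>x :: int \<Rightarrow> 'a::finite mod_ring. x i) \<in> borel \<rightarrow>\<^sub>M count_space UNIV"
proof -
  have "(\<lambda>x. x i) \<in> PiM UNIV (\<lambda>_ :: int. count_space (UNIV :: 'a mod_ring set)) \<rightarrow>\<^sub>M count_space UNIV"
    by (rule measurable_component_singleton) simp
  then show ?thesis
    by (subst measurable_cong_sets[OF sets_borel_configuration refl])
qed

lemma measurable_configurationI:
  fixes f :: "'b \<Rightarrow> int \<Rightarrow> 'a::finite mod_ring"
  assumes "\<And>i. (\<lambda>x. f x i) \<in> M \<rightarrow>\<^sub>M count_space UNIV"
  shows "f \<in> borel_measurable M"
proof -
  have "f \<in> M \<rightarrow>\<^sub>M PiM UNIV (\<lambda>_. count_space UNIV)"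
    by (rule measurable_PiM_single') (use assms in auto)
  then show ?thesis
    by (subst measurable_cong_sets[OF refl sets_borel_configuration])
qed

lemma measurable_translate [measurable]:
  "(\<lambda>x i. x (i + k)) \<in> borel \<rightarrow>\<^sub>M (borel :: (int \<Rightarrow> 'a::finite mod_ring) measure)"
  by (rule measurable_configurationI) (rule measurable_coordinate)

lemma measurable_add_config [measurable]:
  "(\<lambda>x i. x i + d i) \<in> borel \<rightarrow>\<^sub>M (borel :: (int \<Rightarrow> 'a::finite mod_ring) measure)"
  by (rule measurable_configurationI) (rule measurable_compose[OF measurable_coordinate], simp)

text \<open>A one-sided implication suffices, since \<open>x\<close> and \<open>y\<close> may be
  exchanged.\<close>

definition determined :: "int set \<Rightarrow> (int \<Rightarrow> 'a) set \<Rightarrow> bool" where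
  "determined I B \<longleftrightarrow> (\<forall>x y. (\<forall>i\<in>I. x i = y i) \<longrightarrow> x \<in> B \<longrightarrow> y \<in> B)"

definition cylinder :: "int set \<Rightarrow> (int \<Rightarrow> 'a) \<Rightarrow> (int \<Rightarrow> 'a) set" where
  "cylinder I w = {x. \<forall>i\<in>I. x i = w i}"

lemma cylinder_measurable [measurable]:
  fixes w :: "int \<Rightarrow> 'a::finite mod_ring"
  assumes "finite I"
  shows "cylinder I w \<in> sets borel"
proof -
  note [measurable] = measurable_coordinate
  have "{x \<in> space borel. \<forall>i\<in>I. x i = w i} \<in> sets borel"
    using assms by measurable
  then show ?thesis by (simp add: cylinder_def)
qed

lemma determined_mono: "determined I B \<Longrightarrow> I \<subseteq> J \<Longrightarrow> determined J B"
  unfolding determined_def by blast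

lemma restrict_eq_iff_cylinder:
  "w \<in> I \<rightarrow>\<^sub>E UNIV \<Longrightarrow> restrict x I = w \<longleftrightarrow> x \<in> cylinder I w"
  by (auto simp: cylinder_def fun_eq_iff PiE_def extensional_def restrict_def)

lemma UN_cylinders: "(\<Union>w\<in>{w \<in> I \<rightarrow>\<^sub>E UNIV. P w}. cylinder I w) = {x. P (restrict x I)}"
proof (intro equalityI subsetI)
  fix x assume "x \<in> (\<Union>w\<in>{w \<in> I \<rightarrow>\<^sub>E UNIV. P w}. cylinder I w)"
  then obtain w where w: "w \<in> I \<rightarrow>\<^sub>E UNIV" "P w" "x \<in> cylinder I w" by blast
  with restrict_eq_iff_cylinder[OF w(1), of x] show "x \<in> {x. P (restrict x I)}" by simp
next
  fix x assume "x \<in> {x. P (restrict x I)}"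
  then show "x \<in> (\<Union>w\<in>{w \<in> I \<rightarrow>\<^sub>E UNIV. P w}. cylinder I w)"
    by (intro UN_I[of "restrict x I"]) (auto simp: cylinder_def)
qed

lemma determined_eq:
  assumes "determined I B"
  shows "B = {x. restrict x I \<in> B}"
proof -
  have "\<forall>i\<in>I. restrict x I i = x i" "\<forall>i\<in>I. x i = restrict x I i" for x by simp_all
  with assms show ?thesis unfolding determined_def by blast
qed

lemma restrict_eq_iff: "restrict x I = restrict y I \<longleftrightarrow> (\<forall>i\<in>I. x i = y i)"
  by (metis restrict_apply' restrict_ext)

lemma disjoint_cylinders:
  "v \<in> I \<rightarrow>\<^sub>E UNIV \<Longrightarrow> w \<in> I \<rightarrow>\<^sub>E UNIV \<Longrightarrow> v \<noteq> w \<Longrightarrow> cylinder I v \<inter> cylinder I w = {}"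
  by (auto simp: cylinder_def PiE_def extensional_def fun_eq_iff) metis

lemma finite_words [simp]: "finite I \<Longrightarrow> finite (I \<rightarrow>\<^sub>E (UNIV :: 'a::finite set))"
  by (rule finite_PiE) auto

lemma determined_measurable:
  fixes B :: "(int \<Rightarrow> 'a::finite mod_ring) set"
  assumes "finite I" "determined I B"
  shows "B \<in> sets borel"
proof -
  have "(\<Union>w\<in>{w \<in> I \<rightarrow>\<^sub>E UNIV. w \<in> B}. cylinder I w) \<in> sets borel"
    using assms(1) by (intro sets.finite_UN) auto
  also have "(\<Union>w\<in>{w \<in> I \<rightarrow>\<^sub>E UNIV. w \<in> B}. cylinder I w) = {x. restrict x I \<in> B}"
    by (rule UN_cylinders)
  finally show ?thesis using determined_eq[OF assms(2)] by simp
qed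

lemma emeasure_words:
  fixes M :: "(int \<Rightarrow> 'a::finite mod_ring) measure"
  assumes "finite I" "sets M = sets borel"
  shows "emeasure M {x. P (restrict x I)} = (\<Sum>w\<in>{w \<in> I \<rightarrow>\<^sub>E UNIV. P w}. emeasure M (cylinder I w))"
proof -
  let ?W = "{w \<in> I \<rightarrow>\<^sub>E UNIV. P w}"
  have "(\<Sum>w\<in>?W. emeasure M (cylinder I w)) = emeasure M (\<Union>w\<in>?W. cylinder I w)"
  proof (rule sum_emeasure)
    show "disjoint_family_on (cylinder I) ?W"
      unfolding disjoint_family_on_def using disjoint_cylinders by blast
  qed (use assms in auto)
  also have "(\<Union>w\<in>?W. cylinder I w) = {x. P (restrict x I)}"
    by (rule UN_cylinders)
  finally show ?thesis by simp
qed

lemma measure_words: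
  fixes M :: "(int \<Rightarrow> 'a::finite mod_ring) measure"
  assumes "finite_measure M" "sets M = sets borel" "finite I"
  shows "measure M {x. P (restrict x I)} = (\<Sum>w\<in>{w \<in> I \<rightarrow>\<^sub>E UNIV. P w}. measure M (cylinder I w))"
proof -
  interpret finite_measure M by fact
  show ?thesis
    using emeasure_words[OF assms(3,2), of P]
    by (simp only: emeasure_eq_measure sum_ennreal measure_nonneg ennreal_inj sum_nonneg)
qed

definition window :: "nat \<Rightarrow> int set" where
  "window n = {- int n..int n}"

lemma finite_window [simp]: "finite (window n)"
  by (simp add: window_def)

lemma window_mono: "m \<le> n \<Longrightarrow> window m \<subseteq> window n"
  by (auto simp: window_def)

definition window_sets :: "(int \<Rightarrow> 'a) set set" where
  "window_sets = {B. \<exists>n. determined (window n) B}"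

lemma sigma_sets_window_sets:
  "sigma_sets UNIV window_sets = sets (borel :: (int \<Rightarrow> 'a::finite mod_ring) measure)"
proof
  show "sigma_sets UNIV window_sets \<subseteq> sets (borel :: (int \<Rightarrow> 'a mod_ring) measure)"
    by (rule sets.sigma_sets_subset'[of _ borel, simplified])
      (use determined_measurable[OF finite_window] in \<open>auto simp: window_sets_def\<close>)
  have "sets (borel :: (int \<Rightarrow> 'a mod_ring) measure) =
     sigma_sets UNIV {{f. f i \<in> A} | i A. True}"
    unfolding sets_borel_configuration sets_PiM_single by simp
  also have "\<dots> \<subseteq> sigma_sets UNIV window_sets"
  proof (rule sigma_sets_mono', clarify)
    fix i :: int and A :: "'a mod_ring set"
    have "i \<in> window (nat \<bar>i\<bar>)" by (auto simp: window_def)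
    then have "determined (window (nat \<bar>i\<bar>)) {f. f i \<in> A}"
      unfolding determined_def by (metis mem_Collect_eq)
    then show "{f. f i \<in> A} \<in> window_sets" by (auto simp: window_sets_def)
  qed
  finally show "sets (borel :: (int \<Rightarrow> 'a mod_ring) measure) \<subseteq> sigma_sets UNIV window_sets" .
qed

lemma Int_stable_window_sets: "Int_stable window_sets"
proof (rule Int_stableI)
  fix A B :: "(int \<Rightarrow> 'a) set" assume "A \<in> window_sets" "B \<in> window_sets"
  then obtain m n where "determined (window m) A" "determined (window n) B"
    by (auto simp: window_sets_def)
  then have "determined (window (max m n)) A" "determined (window (max m n)) B"
    by (meson determined_mono max.cobounded1 max.cobounded2 window_mono)+
  then have "determined (window (max m n)) (A \<inter> B)"
    unfolding determined_def by blast
  then show "A \<inter> B \<in> window_sets" by (auto simp: window_sets_def)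
qed

lemma measure_eqI_cylinders:
  fixes M N :: "(int \<Rightarrow> 'a::finite mod_ring) measure"
  assumes M: "finite_measure M" "sets M = sets borel" and N: "sets N = sets borel"
    and eq: "\<And>n w. emeasure M (cylinder (window n) w) = emeasure N (cylinder (window n) w)"
  shows "M = N"
proof (rule measure_eqI_generator_eq[where A="\<lambda>_. UNIV" and \<Omega>=UNIV, OF Int_stable_window_sets])
  interpret finite_measure M by fact
  show "emeasure M X = emeasure N X" if "X \<in> window_sets" for X
  proof -
    from that obtain n where "determined (window n) X" by (auto simp: window_sets_def)
    then have X: "X = {x. restrict x (window n) \<in> X}" by (rule determined_eq)
    have "emeasure M {x. restrict x (window n) \<in> X} = emeasure N {x. restrict x (window n) \<in> X}"
      using emeasure_words[OF finite_window M(2), where P="\<lambda>w. w \<in> X"]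
        emeasure_words[OF finite_window N, where P="\<lambda>w. w \<in> X"] by (simp only: eq)
    with X show ?thesis by (simp only:)
  qed
  show "sets M = sigma_sets UNIV window_sets" "sets N = sigma_sets UNIV window_sets"
    using M N by (simp_all add: sigma_sets_window_sets)
  show "range (\<lambda>_. UNIV) \<subseteq> (window_sets :: (int \<Rightarrow> 'a mod_ring) set set)"
    by (auto simp: window_sets_def determined_def)
  show "emeasure M UNIV \<noteq> \<infinity>" by simp
qed auto

text \<open>The approximable sets contain a generating algebra and are closed under complements and
  countable unions, so induction over \<open>sigma_sets\<close> reaches every Borel set.\<close>

lemma window_approx:
  fixes M :: "(int \<Rightarrow> 'a::finite mod_ring) measure"
  assumes "finite_measure M" "sets M = sets borel" and A: "A \<in> sets borel"
    and "\<epsilon> > 0"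
  shows "\<exists>n B. determined (window n) B \<and> measure M (sym_diff A B) < \<epsilon>"
proof -
  interpret finite_measure M by fact
  note [simp] = assms(2)
  have space: "space M = UNIV" using sets_eq_imp_space_eq[OF assms(2)] by simp
  have "A \<in> sigma_sets UNIV window_sets" using A by (simp add: sigma_sets_window_sets)
  then show ?thesis
    using \<open>\<epsilon> > 0\<close>
  proof (induction arbitrary: \<epsilon>)
    case (Basic a)
    then obtain n where "determined (window n) a" by (auto simp: window_sets_def)
    then show ?case using Basic.prems by (intro exI[of _ n] exI[of _ a]) simp
  next
    case Empty
    then show ?case by (intro exI[of _ 0] exI[of _ "{}"]) (auto simp: determined_def)
  next
    case (Compl a)
    from Compl.IH[OF Compl.prems] obtain n B
      where B: "determined (window n) B" "measure M (sym_diff a B) < \<epsilon>" by blast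
    have "sym_diff (UNIV - a) (- B) = sym_diff a B" by auto
    moreover have "determined (window n) (- B)"
      unfolding determined_def
    proof (intro allI impI)
      fix x y assume "\<forall>i\<in>window n. x i = y i" "x \<in> - B"
      then show "y \<in> - B" using B(1)[unfolded determined_def, rule_format, of y x] by auto
    qed
    ultimately show ?case using B by metis
  next
    case (Union a)
    have a: "a i \<in> sets borel" for i
      using Union.hyps by (simp add: sigma_sets_window_sets)
    have "(\<lambda>m. measure M (\<Union>i<m. a i)) \<longlonglongrightarrow> measure M (\<Union>m. \<Union>i<m. a i)"
      by (rule finite_Lim_measure_incseq) (auto simp: a incseq_def intro: order.strict_trans2)
    also have "(\<Union>m. \<Union>i<m. a i) = (\<Union>i. a i)" by auto
    finally have "\<forall>\<^sub>F m in sequentially. dist (measure M (\<Union>i<m. a i)) (measure M (\<Union>i. a i)) < \<epsilon> / 2"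
      using Union.prems by (intro tendstoD) auto
    then obtain m where m: "dist (measure M (\<Union>i<m. a i)) (measure M (\<Union>i. a i)) < \<epsilon> / 2"
      using eventually_happens'[OF sequentially_bot] by blast
    \<comment> \<open>Half of \<open>\<epsilon>\<close> pays for cutting the union off after
      \<open>m\<close> sets, the other half is shared by the \<open>m\<close> approximations;
      \<open>real m + 1\<close> keeps the divisor positive for \<open>m = 0\<close>.\<close>
    have "\<forall>i. \<exists>n B. determined (window n) B \<and> measure M (sym_diff (a i) B) < \<epsilon> / 2 / (real m + 1)"
      using Union.IH Union.prems by auto
    then obtain n B where B: "\<And>i. determined (window (n i)) (B i)"
      "\<And>i. measure M (sym_diff (a i) (B i)) < \<epsilon> / 2 / (real m + 1)" by metis
    have Bm: "B i \<in> sets borel" for i using B(1) by (rule determined_measurable[rotated]) simp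
    define N where "N = Max (insert 0 (n ` {..<m}))"
    have det: "determined (window N) (B i)" if "i < m" for i
      by (rule determined_mono[OF B(1) window_mono]) (use that in \<open>auto simp: N_def\<close>)
    have "determined (window N) (\<Union>i<m. B i)"
      using det unfolding determined_def by blast
    moreover have "measure M (sym_diff (\<Union>i. a i) (\<Union>i<m. B i)) < \<epsilon>"
    proof -
      have "measure M (sym_diff (\<Union>i. a i) (\<Union>i<m. B i))
          \<le> measure M (((\<Union>i. a i) - (\<Union>i<m. a i)) \<union> (\<Union>i<m. sym_diff (a i) (B i)))"
        by (rule finite_measure_mono) (use a Bm in auto)
      also have "\<dots> \<le> measure M ((\<Union>i. a i) - (\<Union>i<m. a i)) + measure M (\<Union>i<m. sym_diff (a i) (B i))"
        by (rule measure_Un_le) (use a Bm in auto)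
      also have "measure M ((\<Union>i. a i) - (\<Union>i<m. a i)) = measure M (\<Union>i. a i) - measure M (\<Union>i<m. a i)"
        by (rule finite_measure_Diff) (use a in auto)
      also have "\<dots> < \<epsilon> / 2" using m unfolding dist_real_def by linarith
      also have "measure M (\<Union>i<m. sym_diff (a i) (B i)) \<le> (\<Sum>i<m. measure M (sym_diff (a i) (B i)))"
        by (rule measure_UNION_le) (use a Bm in auto)
      also have "\<dots> \<le> (\<Sum>i<m. \<epsilon> / 2 / (real m + 1))"
        by (intro sum_mono less_imp_le B(2))
      also have "\<dots> \<le> \<epsilon> / 2" using Union.prems by (simp add: field_simps)
      finally show ?thesis by simp
    qed
    ultimately show ?case by blast
  qed
qed

subsection \<open>Shift-invariant measures\<close>

text \<open>All integer powers of the shift in one family, so that inverses are at hand;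
  \<open>shift_map ^^ n\<close> reaches only the nonnegative ones.\<close>

definition tr :: "int \<Rightarrow> (int \<Rightarrow> 'a) \<Rightarrow> int \<Rightarrow> 'a" where
  "tr k x = (\<lambda>i. x (i + k))"

lemma tr_apply: "tr k x i = x (i + k)"
  by (simp add: tr_def)

lemma tr_tr [simp]: "tr j (tr k x) = tr (j + k) x"
  by (simp add: tr_def add_ac)

lemma tr_0 [simp]: "tr 0 x = x"
  by (simp add: tr_def)

lemma shift_map_eq_tr: "shift_map = tr 1"
  by (simp add: fun_eq_iff shift_map_def tr_apply)

lemma shift_funpow_eq_tr: "shift_map ^^ n = tr (int n)"
  by (simp add: fun_eq_iff shift_funpow tr_apply)

lemma act_tr: "act c (tr k x) m = act c x (m + k)"
  unfolding tr_def by (rule act_translate)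

lemma measurable_tr [measurable]:
  "tr k \<in> borel \<rightarrow>\<^sub>M (borel :: (int \<Rightarrow> 'a::finite mod_ring) measure)"
  unfolding tr_def[abs_def] by measurable

lemma invariant_sets_iff_AE:
  assumes "T \<in> M \<rightarrow>\<^sub>M M"
  shows "B \<in> invariant_sets M T \<longleftrightarrow> B \<in> sets M \<and> (AE x in M. T x \<in> B \<longleftrightarrow> x \<in> B)"
proof (cases "B \<in> sets M")
  case True
  let ?N = "sym_diff (T -` B \<inter> space M) B"
  have N: "?N \<in> sets M" using True assms by (intro sets.Un sets.Diff measurable_sets[OF assms]) auto
  have "?N = {x \<in> space M. \<not> (T x \<in> B \<longleftrightarrow> x \<in> B)}"
    using sets.sets_into_space[OF True] by auto
  then have "(AE x in M. T x \<in> B \<longleftrightarrow> x \<in> B) \<longleftrightarrow> emeasure M ?N = 0"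
    using N by (subst AE_iff_measurable[of ?N]) auto
  then show ?thesis using True by (simp add: invariant_sets_def)
qed (simp add: invariant_sets_def)

lemma distr_eq_invariant:
  assumes "T \<in> borel \<rightarrow>\<^sub>M borel" "sets M = sets borel" "invariant_measure M T"
  shows "distr M borel T = M"
proof (rule measure_eqI)
  show "sets (distr M borel T) = sets M" using assms by simp
  fix A assume "A \<in> sets (distr M borel T)"
  then have A: "A \<in> sets borel" by simp
  have "T \<in> M \<rightarrow>\<^sub>M borel" using assms by (simp cong: measurable_cong_sets)
  then have "emeasure (distr M borel T) A = emeasure M (T -` A \<inter> space M)"
    using A by (rule emeasure_distr)
  also have "\<dots> = emeasure M A"
    using assms A by (simp add: invariant_measure_def)
  finally show "emeasure (distr M borel T) A = emeasure M A" .
qed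

locale shift_invariant = prob_space \<mu>
  for \<mu> :: "(int \<Rightarrow> 'p::prime_card mod_ring) measure" +
  assumes sets_eq [simp, measurable_cong]: "sets \<mu> = sets borel"
    and distr_shift: "distr \<mu> borel shift_map = \<mu>"
begin

lemma space_eq [simp]: "space \<mu> = UNIV"
  using sets_eq_imp_space_eq[OF sets_eq] by simp

lemma distr_tr: "distr \<mu> borel (tr k) = \<mu>"
proof -
  have nonneg: "distr \<mu> borel (tr (int n)) = \<mu>" for n
  proof (induction n)
    case 0
    then show ?case by (intro measure_eqI) (auto simp: emeasure_distr)
  next
    case (Suc n)
    have "distr \<mu> borel (tr (int (Suc n))) = distr (distr \<mu> borel (tr (int n))) borel (tr 1)"
      by (subst distr_distr) (auto simp: o_def)
    then show ?case using Suc distr_shift by (simp add: shift_map_eq_tr)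
  qed
  show ?thesis
  proof (cases "k \<ge> 0")
    case True
    then show ?thesis using nonneg[of "nat k"] by simp
  next
    case False
    \<comment> \<open>A negative power is cancelled by writing \<open>\<mu>\<close> as its own image
      under the opposite positive power.\<close>
    have "distr \<mu> borel (tr k) = distr (distr \<mu> borel (tr (int (nat (- k))))) borel (tr k)"
      by (simp only: nonneg)
    also have "\<dots> = distr \<mu> borel (tr (int 0))"
      using False by (subst distr_distr) (auto simp: o_def intro!: distr_cong)
    also have "\<dots> = \<mu>" using nonneg[of 0] by simp
    finally show ?thesis .
  qed
qed

lemma distr_funpow:
  assumes T: "T \<in> borel \<rightarrow>\<^sub>M borel" "distr \<mu> borel T = \<mu>"
  shows "distr \<mu> borel (T ^^ n) = \<mu>"
proof (induction n)
  case 0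
  then show ?case by (intro measure_eqI) (auto simp: emeasure_distr)
next
  case (Suc n)
  have Tn: "T ^^ n \<in> borel \<rightarrow>\<^sub>M borel" using T(1) by (induction n) auto
  have "distr \<mu> borel (T ^^ Suc n) = distr (distr \<mu> borel (T ^^ n)) borel T"
    by (subst distr_distr) (use T(1) Tn in \<open>auto cong: measurable_cong_sets\<close>)
  then show ?case by (simp only: Suc T(2))
qed

lemma measurable_tr_mu [measurable]: "tr k \<in> \<mu> \<rightarrow>\<^sub>M borel"
  by (simp cong: measurable_cong_sets)

lemma nn_integral_tr:
  assumes [measurable]: "f \<in> borel_measurable borel"
  shows "(\<integral>\<^sup>+x. f (tr k x) \<partial>\<mu>) = (\<integral>\<^sup>+x. f x \<partial>\<mu>)"
proof -
  have "(\<integral>\<^sup>+x. f (tr k x) \<partial>\<mu>) = (\<integral>\<^sup>+x. f x \<partial>distr \<mu> borel (tr k))"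
    by (rule nn_integral_distr[symmetric]) auto
  then show ?thesis by (simp only: distr_tr)
qed

lemma emeasure_tr: "B \<in> sets borel \<Longrightarrow> emeasure \<mu> {x. tr k x \<in> B} = emeasure \<mu> B"
  using emeasure_distr[OF measurable_tr_mu, of B k] distr_tr[of k] by (simp add: vimage_def)

lemma AE_tr:
  assumes "AE x in \<mu>. P x"
  shows "AE x in \<mu>. P (tr k x)"
proof -
  have "AE x in distr \<mu> borel (tr k). P x" using assms by (simp only: distr_tr)
  then show ?thesis by (rule AE_distrD[OF measurable_tr_mu])
qed

section \<open>Sets invariant under powers of the shift\<close>

definition inv_set :: "int \<Rightarrow> (int \<Rightarrow> 'p mod_ring) set \<Rightarrow> bool" where
  "inv_set k B \<longleftrightarrow> B \<in> sets borel \<and> (AE x in \<mu>. tr k x \<in> B \<longleftrightarrow> x \<in> B)"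

lemma inv_set_iff: "B \<in> invariant_sets \<mu> (shift_map ^^ n) \<longleftrightarrow> inv_set (int n) B"
  unfolding shift_funpow_eq_tr inv_set_def by (subst invariant_sets_iff_AE) auto

text \<open>Keeping only the points whose whole orbit under \<open>tr k\<close> stays in
  \<open>B\<close> changes a null set and makes invariance hold everywhere; itineraries then become
  periodic without exceptions.\<close>

lemma inv_set_strict:
  assumes "inv_set k B"
  obtains B' where "B' \<in> sets borel" "\<And>x. tr k x \<in> B' \<longleftrightarrow> x \<in> B'" "AE x in \<mu>. x \<in> B' \<longleftrightarrow> x \<in> B"
proof
  have B [measurable]: "B \<in> sets borel" and AE: "AE x in \<mu>. tr k x \<in> B \<longleftrightarrow> x \<in> B"
    using assms by (auto simp: inv_set_def)
  let ?B' = "{x. \<forall>j. tr (j * k) x \<in> B}"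
  have "{x \<in> space borel. \<forall>j. tr (j * k) x \<in> B} \<in> sets borel" by measurable
  then show "?B' \<in> sets borel" by simp
  show "tr k x \<in> ?B' \<longleftrightarrow> x \<in> ?B'" for x
  proof -
    have "(\<forall>j. tr (j * k) (tr k x) \<in> B) \<longleftrightarrow> (\<forall>j. tr ((j + 1) * k) x \<in> B)"
      by (simp add: algebra_simps)
    also have "\<dots> \<longleftrightarrow> (\<forall>j. tr (j * k) x \<in> B)"
      by (metis diff_add_cancel)
    finally show ?thesis by simp
  qed
  have up: "AE x in \<mu>. tr (int n * k) x \<in> B \<longleftrightarrow> x \<in> B" for n
  proof (induction n)
    case (Suc n)
    from AE_tr[OF AE, of "int n * k"] Suc show ?case
      by eventually_elim (simp add: algebra_simps)
  qed simp
  have "AE x in \<mu>. tr (j * k) x \<in> B \<longleftrightarrow> x \<in> B" for j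
  proof (cases "j \<ge> 0")
    case True
    then show ?thesis using up[of "nat j"] by simp
  next
    case False
    have "AE x in \<mu>. tr (- j * k) (tr (j * k) x) \<in> B \<longleftrightarrow> tr (j * k) x \<in> B"
      using AE_tr[OF up[of "nat (- j)"], of "j * k"] False by simp
    then show ?thesis by (simp add: algebra_simps) (metis (mono_tags, lifting) AE_cong)
  qed
  then have "AE x in \<mu>. \<forall>j. tr (j * k) x \<in> B \<longleftrightarrow> x \<in> B" by (simp add: AE_all_countable)
  then show "AE x in \<mu>. x \<in> ?B' \<longleftrightarrow> x \<in> B" by eventually_elim auto
qed

text \<open>The set of configurations whose itinerary through \<open>B\<close> is a given non-\<open>m\<close>-periodic word, up to
  translations by multiples of \<open>q\<close>, is invariant under the \<open>q\<close>-th power of the shift but disjoint from its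
  image under the shift itself.\<close>

lemma inv_set_prime_step:
  fixes q m :: nat
  assumes q: "prime q" "q dvd m" "m > 0"
    and H: "\<And>B. inv_set (int m) B \<Longrightarrow> inv_set 1 B"
    and B: "inv_set (int (q * m)) B"
  shows "inv_set 1 B"
proof -
  let ?N = "int (q * m)"
  obtain B' where B' [measurable]: "B' \<in> sets borel" and strict: "\<And>x. tr ?N x \<in> B' \<longleftrightarrow> x \<in> B'"
    and AE: "AE x in \<mu>. x \<in> B' \<longleftrightarrow> x \<in> B"
    using inv_set_strict[OF B] by blast
  define word where "word x = (\<lambda>i. tr i x \<in> B')" for x
  \<comment> \<open>All truth-valued words of period \<open>q * m\<close>. They are finitely many,
    and every itinerary is one of them.\<close>
  define V where "V = (\<lambda>S i. i mod ?N \<in> S) ` Pow {0..<?N}"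
  have N: "?N > 0" using q by (simp add: prime_gt_0_nat)
  have periodic: "word x (i + ?N * k) = word x i" for x i k
    by (rule periodic_mult) (use strict[of "tr _ x"] in \<open>simp add: word_def algebra_simps\<close>)
  have word_V: "word x \<in> V" for x
  proof -
    have "word x = (\<lambda>i. i mod ?N \<in> {j \<in> {0..<?N}. word x j})"
    proof
      fix i
      have "word x i = word x (i mod ?N + ?N * (i div ?N))" by simp
      also have "\<dots> = word x (i mod ?N)" by (rule periodic)
      finally show "word x i = (i mod ?N \<in> {j \<in> {0..<?N}. word x j})"
        using N by simp
    qed
    then show ?thesis unfolding V_def by (rule image_eqI) auto
  qed
  have V_per: "v (i + ?N) = v i" if "v \<in> V" for v i
    using that by (auto simp: V_def)
  have null: "AE x in \<mu>. word x \<noteq> v" if v: "v \<in> V" and nper: "\<not> (\<forall>i. v (i + int m) = v i)" for v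
  proof -
    define C where "C = {x. \<exists>j. \<forall>i. word x i = v (i + int q * j)}"
    have "{x \<in> space borel. \<exists>j. \<forall>i. (tr i x \<in> B') = v (i + int q * j)} \<in> sets borel" by measurable
    then have C: "C \<in> sets borel" by (simp add: C_def word_def)
    have Cq: "tr (int q * l) x \<in> C \<longleftrightarrow> x \<in> C" for x l
    proof
      assume "tr (int q * l) x \<in> C"
      then obtain j where "\<And>i. word x (i + int q * l) = v (i + int q * j)"
        by (auto simp: C_def word_def)
      from this[of "_ - int q * l"] have "word x i = v (i + int q * (j - l))" for i
        by (simp add: algebra_simps)
      then show "x \<in> C" by (auto simp: C_def)
    next
      assume "x \<in> C"
      then obtain j where "\<And>i. word x i = v (i + int q * j)"
        by (auto simp: C_def)
      then have "word x (i + int q * l) = v (i + int q * (j + l))" for i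
        by (simp add: algebra_simps)
      then show "tr (int q * l) x \<in> C" by (auto simp: C_def word_def)
    qed
    from q(2) obtain l where "m = q * l" by blast
    then have "inv_set (int m) C" using C Cq[of "int l"] by (simp add: inv_set_def)
    then have "AE x in \<mu>. tr 1 x \<in> C \<longleftrightarrow> x \<in> C" using H by (simp add: inv_set_def)
    moreover have "\<not> (x \<in> C \<and> tr 1 x \<in> C)" for x
    proof (rule notI, elim conjE)
      assume "x \<in> C" "tr 1 x \<in> C"
      then obtain j j' where j: "\<And>i. word x i = v (i + int q * j)"
        and j': "\<And>i. word x (i + 1) = v (i + int q * j')"
        by (auto simp: C_def word_def)
      define P where "P = {s. \<forall>i. v (i + s) = v i}"
      have P_mult: "s * k \<in> P" if "s \<in> P" for s k
        using periodic_mult[of v s] that by (simp add: P_def)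
      have P_add: "s + t \<in> P" if "s \<in> P" "t \<in> P" for s t
        using that by (simp add: P_def add.assoc[symmetric])
      \<comment> \<open>If \<open>x\<close> and its shift both lie in \<open>C\<close>, comparing
        the two translates of \<open>v\<close> shows that \<open>?s\<close> is a period of
        \<open>v\<close>. It is coprime to \<open>q\<close>, so its gcd with the period
        \<open>q * m\<close> already divides \<open>m\<close>, which makes \<open>m\<close> a
        period.\<close>
      let ?s = "1 + int q * (j - j')"
      have "v (i + ?s) = v i" for i
        using j[of "i + 1 - int q * j'"] j'[of "i - int q * j'"] by (simp add: algebra_simps)
      then have sP: "?s \<in> P" by (simp add: P_def)
      have NP: "?N \<in> P" using V_per[OF v] by (simp add: P_def)
      obtain a b where "a * ?s + b * int m = gcd ?s (int m)" using bezout_int by blast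
      moreover have "coprime ?s (int q)"
        by (metis coprime_1_left coprime_iff_gcd_eq_1 gcd_add_mult mult.commute add.commute gcd.commute)
      then have "gcd ?s ?N = gcd ?s (int m)"
        by (simp add: gcd_mult_right_left_cancel)
      moreover obtain a' b' where "a' * ?s + b' * ?N = gcd ?s ?N" using bezout_int by blast
      ultimately have "gcd ?s (int m) \<in> P"
        using P_add[OF P_mult[OF sP, of a'] P_mult[OF NP, of b']] by (simp add: mult.commute)
      then have "int m \<in> P" using P_mult by (metis dvdE gcd_dvd2)
      with nper show False by (simp add: P_def)
    qed
    ultimately have "AE x in \<mu>. x \<notin> C" by (auto elim: eventually_mono)
    then show ?thesis
      by eventually_elim (auto simp: C_def dest: spec[of _ 0])
  qed
  have "finite V" by (simp add: V_def)
  then have "AE x in \<mu>. \<forall>v\<in>{v \<in> V. \<not> (\<forall>i. v (i + int m) = v i)}. word x \<noteq> v"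
    using null by (subst AE_ball_countable) (auto simp: countable_finite)
  \<comment> \<open>Almost every itinerary has period \<open>m\<close>, so \<open>B'\<close> is
    itself invariant at exponent \<open>m\<close> and \<open>H\<close> applies to it.\<close>
  then have "AE x in \<mu>. \<forall>i. word x (i + int m) = word x i"
    by eventually_elim (use word_V in blast)
  then have "AE x in \<mu>. tr (int m) x \<in> B' \<longleftrightarrow> x \<in> B'"
    by eventually_elim (simp add: word_def, metis add_0 tr_0)
  then have "inv_set 1 B'" by (intro H) (simp add: inv_set_def)
  then have "AE x in \<mu>. tr 1 x \<in> B' \<longleftrightarrow> x \<in> B'" by (simp add: inv_set_def)
  with AE AE_tr[OF AE, of 1] have "AE x in \<mu>. tr 1 x \<in> B \<longleftrightarrow> x \<in> B"
    by eventually_elim auto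
  then show ?thesis using B by (simp add: inv_set_def)
qed

text \<open>Starting from \<open>q * m\<close> rather than \<open>m\<close> secures the divisibility
  by \<open>q\<close> that each prime step requires.\<close>

lemma inv_set_prime_power:
  fixes q m :: nat
  assumes q: "prime q" "m > 0" and n: "n > 0"
    and H: "\<And>B. inv_set (int (q * m)) B \<Longrightarrow> inv_set 1 B"
    and B: "inv_set (int (q ^ n * m)) B"
  shows "inv_set 1 B"
  using n B
proof (induction n arbitrary: B rule: nat_induct_non_zero)
  case 1
  then show ?case using H by simp
next
  case (Suc n)
  show ?case
  proof (rule inv_set_prime_step[of q "q ^ n * m"])
    show "inv_set (int (q * (q ^ n * m))) B" using Suc.prems by (simp add: algebra_simps)
  qed (use Suc q in \<open>auto simp: prime_gt_0_nat\<close>)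
qed

end

subsection \<open>Entropy of finite-valued observables\<close>

text \<open>This is \<open>ln u \<le> u - 1\<close> at \<open>u = 1 / sqrt t\<close>. It makes the
  entropy of rare events small along with their mass.\<close>

lemma neg_t_ln_t_le_sqrt:
  fixes t :: real
  assumes "0 \<le> t"
  shows "- t * ln t \<le> 2 * sqrt t"
proof (cases "t = 0")
  case False
  then have t: "t > 0" "sqrt t > 0" using assms by auto
  have "ln (1 / sqrt t) \<le> 1 / sqrt t - 1"
    using t by (intro ln_le_minus_one) auto
  then have "- ln t \<le> 2 / sqrt t"
    using t by (simp add: ln_div ln_sqrt)
  then have "t * (- ln t) \<le> t * (2 / sqrt t)"
    using t by (intro mult_left_mono) auto
  also have "\<dots> = 2 * sqrt t"
    using t by (simp add: field_simps)
  finally show ?thesis by simp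
qed simp

lemma neg_t_ln_t_nonneg: "0 \<le> t \<Longrightarrow> t \<le> 1 \<Longrightarrow> 0 \<le> - t * ln (t :: real)"
  by (cases "t = 0") (auto simp: mult_le_0_iff ln_le_zero_iff)

lemma neg_t_ln_t_le: "0 \<le> t \<Longrightarrow> - t * ln t \<le> 1 - (t :: real)"
proof (cases "t = 0")
  case False
  assume "0 \<le> t"
  with False have t: "t > 0" by simp
  then have "ln (1 / t) \<le> 1 / t - 1" by (intro ln_le_minus_one) auto
  then have "t * (- ln t) \<le> t * (1 / t - 1)" using t by (intro mult_left_mono) (auto simp: ln_div)
  moreover have "t * (1 / t - 1) = 1 - t" using t by (simp add: right_diff_distrib)
  ultimately show ?thesis by simp
qed simp

sublocale shift_invariant \<subseteq> information_space \<mu> "exp 1"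
  by unfold_locales (simp add: one_less_exp_iff)

context shift_invariant
begin

text \<open>Shannon entropy with natural logarithms, taken from the information theory library so
  that the chain rule and data processing apply.\<close>

definition ent :: "((int \<Rightarrow> 'p mod_ring) \<Rightarrow> 'c) \<Rightarrow> real" where
  "ent X = entropy (exp 1) (count_space (X ` space \<mu>)) X"

lemma ent_eq:
  assumes X: "simple_function \<mu> X" and S: "finite S" "range X \<subseteq> S"
  shows "ent X = (\<Sum>w\<in>S. - prob {x. X x = w} * ln (prob {x. X x = w}))"
proof -
  have "ent X = - (\<Sum>w\<in>range X. prob {x. X x = w} * log (exp 1) (prob {x. X x = w}))"
    unfolding ent_def
    by (subst entropy_simple_distributed[OF simple_distributedI[OF X measure_nonneg refl]])
      (simp add: vimage_def)
  also have "\<dots> = (\<Sum>w\<in>range X. - prob {x. X x = w} * ln (prob {x. X x = w}))"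
    by (simp add: log_def sum_negf)
  also have "\<dots> = (\<Sum>w\<in>S. - prob {x. X x = w} * ln (prob {x. X x = w}))"
  proof (rule sum.mono_neutral_left[OF S], intro ballI)
    fix w assume "w \<in> S - range X"
    then have "{x. X x = w} = {}" by auto
    then show "- prob {x. X x = w} * ln (prob {x. X x = w}) = 0" by (simp only: measure_empty)
  qed
  finally show ?thesis .
qed

lemma ent_nonneg:
  assumes X: "simple_function \<mu> X"
  shows "0 \<le> ent X"
proof -
  have "finite (range X)" using simple_functionD(1)[OF X] by simp
  note ent_eq[OF X this order_refl]
  then show ?thesis
    by (simp only:) (intro sum_nonneg neg_t_ln_t_nonneg measure_nonneg prob_le_1)
qed

text \<open>\<open>Y\<close> factors through \<open>X\<close> by choosing one representative for
  each value of \<open>X\<close>; data processing does the rest.\<close>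

lemma ent_mono:
  assumes X: "simple_function \<mu> X" and f: "\<And>x y. X x = X y \<Longrightarrow> Y x = Y y"
  shows "ent Y \<le> ent X"
proof -
  define g where "g w = Y (SOME x. X x = w)" for w
  have some: "X (SOME y. X y = X x) = X x" for x by (rule someI[of _ x]) simp
  have "Y x = g (X x)" for x
    unfolding g_def by (rule f) (rule some[symmetric])
  then have "Y = g \<circ> X" by (simp add: fun_eq_iff)
  then show ?thesis using entropy_data_processing[OF X, of g] by (simp add: ent_def)
qed

lemma ent_pair:
  assumes "simple_function \<mu> X" "simple_function \<mu> Y"
  shows "ent (\<lambda>x. (X x, Y x)) \<le> ent X + ent Y"
  using entropy_chain_rule[OF assms] conditional_entropy_less_eq_entropy[OF assms(2,1)]
  by (simp add: ent_def)

lemma simple_functionI: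
  assumes "finite (range X)" "\<And>w. {x. X x = w} \<in> sets borel"
  shows "simple_function \<mu> X"
  using assms by (simp add: simple_function_def vimage_def)

lemma simple_function_sets:
  "simple_function \<mu> X \<Longrightarrow> {x. X x = w} \<in> sets borel"
  using simple_functionD(2)[of \<mu> X "{w}"] by (simp add: vimage_def)

lemma simple_function_comp_invariant:
  assumes "simple_function \<mu> X" "T \<in> borel \<rightarrow>\<^sub>M borel"
  shows "simple_function \<mu> (\<lambda>x. X (T x))"
proof (rule simple_functionI)
  show "finite (range (\<lambda>x. X (T x)))"
    by (rule finite_subset[OF _ simple_functionD(1)[OF assms(1)]]) auto
  fix w
  show "{x. X (T x) = w} \<in> sets borel"
    using measurable_sets[OF assms(2) simple_function_sets[OF assms(1), of w]]
    by (simp add: vimage_def)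
qed

lemma ent_invariant:
  assumes X: "simple_function \<mu> X" and T: "T \<in> borel \<rightarrow>\<^sub>M borel" "distr \<mu> borel T = \<mu>"
  shows "ent (\<lambda>x. X (T x)) = ent X"
proof -
  have fin: "finite (range X)" using simple_functionD(1)[OF X] by simp
  have "prob {x. X (T x) = w} = prob {x. X x = w}" for w
  proof -
    have "prob {x. X x = w} = measure (distr \<mu> borel T) {x. X x = w}" using T by simp
    also have "\<dots> = prob {x. X (T x) = w}"
      by (subst measure_distr) (use T simple_function_sets[OF X] in \<open>auto simp: vimage_def cong: measurable_cong_sets\<close>)
    finally show ?thesis by simp
  qed
  then show ?thesis
    by (subst ent_eq[OF simple_function_comp_invariant[OF X T(1)] fin])
      (auto simp: ent_eq[OF X fin order_refl])
qed

definition went :: "int set \<Rightarrow> real" where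
  "went I = ent (\<lambda>x. restrict x I)"

lemma simple_restrict:
  assumes "finite I" shows "simple_function \<mu> (\<lambda>x. restrict x I)"
proof (rule simple_functionI)
  have "range (\<lambda>x :: int \<Rightarrow> 'p mod_ring. restrict x I) \<subseteq> I \<rightarrow>\<^sub>E UNIV" by auto
  then show "finite (range (\<lambda>x :: int \<Rightarrow> 'p mod_ring. restrict x I))"
    by (rule finite_subset) (simp add: assms)
  fix w :: "int \<Rightarrow> 'p mod_ring"
  have "determined I {x. restrict x I = w}"
    by (auto simp: determined_def restrict_def fun_eq_iff)
  then show "{x. restrict x I = w} \<in> sets borel"
    by (rule determined_measurable[OF assms])
qed

lemma went_eq:
  assumes "finite I"
  shows "went I = (\<Sum>w\<in>I \<rightarrow>\<^sub>E UNIV. - prob (cylinder I w) * ln (prob (cylinder I w)))"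
  unfolding went_def
  by (subst ent_eq[OF simple_restrict[OF assms], of "I \<rightarrow>\<^sub>E UNIV"])
    (auto simp: assms restrict_eq_iff_cylinder intro!: sum.cong)

lemma went_nonneg: "finite I \<Longrightarrow> 0 \<le> went I"
  unfolding went_def by (intro ent_nonneg simple_restrict)

lemma went_mono: "finite J \<Longrightarrow> I \<subseteq> J \<Longrightarrow> went I \<le> went J"
  unfolding went_def
  by (rule ent_mono[OF simple_restrict]) (auto simp: restrict_eq_iff)

lemma went_Un:
  assumes fin: "finite I" "finite J"
  shows "went (I \<union> J) \<le> went I + went J"
proof -
  have "went (I \<union> J) \<le> ent (\<lambda>x. (restrict x I, restrict x J))"
    unfolding went_def
    by (rule ent_mono[OF simple_function_Pair[OF simple_restrict simple_restrict]])
      (use fin in \<open>auto simp: restrict_eq_iff\<close>)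
  also have "\<dots> \<le> went I + went J"
    unfolding went_def by (rule ent_pair[OF simple_restrict simple_restrict]) fact+
  finally show ?thesis .
qed

definition H :: "nat \<Rightarrow> real" where
  "H n = went {0..<int n}"

lemma went_interval: "went {a..<a + int n} = H n"
proof -
  have iff: "restrict (tr a x) {0..<int n} = restrict (tr a y) {0..<int n} \<longleftrightarrow>
      restrict x {a..<a + int n} = restrict y {a..<a + int n}" for x y :: "int \<Rightarrow> 'p mod_ring"
  proof -
    have "(\<lambda>i. i + a) ` {0..<int n} = {a..<a + int n}" by (simp add: image_add_atLeastLessThan' add.commute)
    then show ?thesis unfolding restrict_eq_iff tr_apply by (metis (no_types, lifting) imageE imageI)
  qed
  have "simple_function \<mu> (\<lambda>x. restrict (tr a x) {0..<int n})"
    by (rule simple_function_comp_invariant[OF simple_restrict]) auto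
  then have "went {a..<a + int n} = ent (\<lambda>x. restrict (tr a x) {0..<int n})"
    unfolding went_def by (intro antisym ent_mono simple_restrict) (simp_all add: iff)
  also have "\<dots> = H n"
    unfolding H_def went_def by (rule ent_invariant[OF simple_restrict _ distr_tr]) auto
  finally show ?thesis .
qed

lemma H_nonneg: "0 \<le> H n"
  unfolding H_def by (simp add: went_nonneg)

lemma H_mono: "m \<le> n \<Longrightarrow> H m \<le> H n"
  unfolding H_def by (rule went_mono) auto

lemma H_subadditive: "H (m + n) \<le> H m + H n"
proof -
  have "{0..<int (m + n)} = {0..<int m} \<union> {int m..<int m + int n}" by auto
  then have "H (m + n) \<le> went {0..<int m} + went {int m..<int m + int n}"
    unfolding H_def[of "m + n"] by (simp add: went_Un)
  then show ?thesis unfolding went_interval by (simp add: H_def)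
qed

lemma H_mult: "H (k * m) \<le> real k * H m"
proof (induction k)
  case 0
  have "H 0 = 0"
    unfolding H_def using prob_space by (simp add: went_eq cylinder_def)
  then show ?case by simp
next
  case (Suc k)
  have "H (Suc k * m) \<le> H m + H (k * m)" using H_subadditive[of m "k * m"] by simp
  then show ?case using Suc by (simp add: algebra_simps)
qed

text \<open>A uniform linear lower bound stands in for the limit of \<open>H n / n\<close>. If it
  fails, some block length \<open>m\<close> is cheap per symbol, and cutting \<open>n\<close> places
  into such blocks leaves only a remainder bounded by \<open>H m\<close>.\<close>

lemma H_sublinear:
  assumes no: "\<not> (\<exists>h>0. \<forall>n. real n * h \<le> H n)" and "\<epsilon> > 0"
  shows "\<exists>C. \<forall>n. H n \<le> \<epsilon> * real n + C"
proof -
  from assms obtain m where m: "H m < real m * \<epsilon>" by (auto simp: not_le)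
  then have m0: "m > 0" using H_nonneg[of m] by (cases m) auto
  have "H n \<le> \<epsilon> * real n + H m" for n
  proof -
    have "H n = H ((n div m) * m + n mod m)" by simp
    also have "\<dots> \<le> H ((n div m) * m) + H (n mod m)" by (rule H_subadditive)
    also have "H (n mod m) \<le> H m" using m0 by (intro H_mono) simp
    also have "H ((n div m) * m) \<le> real (n div m) * H m" by (rule H_mult)
    also have "\<dots> \<le> real (n div m) * (real m * \<epsilon>)"
      using m by (intro mult_left_mono) auto
    also have "\<dots> = real (n div m * m) * \<epsilon>" by simp
    also have "\<dots> \<le> real n * \<epsilon>"
      using assms(2) by (intro mult_right_mono of_nat_mono) auto
    finally show ?thesis by (simp add: mult.commute)
  qed
  then show ?thesis by blast
qed

subsection \<open>Positive entropy of the automaton forces positive entropy of the shift\<close>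

definition cell :: "(int \<Rightarrow> 'p mod_ring) set set \<Rightarrow> (int \<Rightarrow> 'p mod_ring) \<Rightarrow> (int \<Rightarrow> 'p mod_ring) set" where
  "cell Q x = (THE A. A \<in> Q \<and> x \<in> A)"

lemma cell_eq:
  assumes "finite_partition \<mu> Q" "A \<in> Q" "x \<in> A"
  shows "cell Q x = A"
  unfolding cell_def
proof (rule the_equality)
  fix B assume "B \<in> Q \<and> x \<in> B"
  then show "B = A" using assms unfolding finite_partition_def disjoint_def by blast
qed (use assms in simp)

lemma cell_in:
  assumes "finite_partition \<mu> Q"
  shows "cell Q x \<in> Q" "x \<in> cell Q x"
proof -
  have "x \<in> \<Union> Q" using assms by (simp add: finite_partition_def)
  then obtain A where A: "A \<in> Q" "x \<in> A" by (rule UnionE)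
  have "cell Q x = A" by (rule cell_eq[OF assms A])
  with A show "cell Q x \<in> Q" "x \<in> cell Q x" by simp_all
qed

lemma cell_eq_iff: "finite_partition \<mu> Q \<Longrightarrow> A \<in> Q \<Longrightarrow> cell Q x = A \<longleftrightarrow> x \<in> A"
  using cell_eq[of Q A x] cell_in(2)[of Q x] by blast

lemma simple_cell:
  assumes Q: "finite_partition \<mu> Q"
  shows "simple_function \<mu> (cell Q)"
proof (rule simple_functionI)
  show "finite (range (cell Q))"
    by (rule finite_subset[of _ Q]) (use Q cell_in(1)[OF Q] in \<open>auto simp: finite_partition_def\<close>)
  fix w
  show "{x. cell Q x = w} \<in> sets borel"
  proof (cases "w \<in> Q")
    case True
    then have "w \<in> sets borel" using Q by (auto simp: finite_partition_def)
    moreover have "{x. cell Q x = w} = w" by (simp add: cell_eq_iff[OF Q True])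
    ultimately show ?thesis by simp
  next
    case False
    then have "{x. cell Q x = w} = {}" using cell_in(1)[OF Q] by auto
    then show ?thesis by simp
  qed
qed

lemma partition_entropy_eq:
  assumes Q: "finite_partition \<mu> Q"
  shows "partition_entropy \<mu> Q = ent (cell Q)"
proof -
  have "range (cell Q) \<subseteq> Q" using cell_in[OF Q] by auto
  then have "ent (cell Q) = (\<Sum>A\<in>Q. - prob {x. cell Q x = A} * ln (prob {x. cell Q x = A}))"
    using Q by (intro ent_eq simple_cell) (auto simp: finite_partition_def)
  also have "\<dots> = (\<Sum>A\<in>Q. - prob A * ln (prob A))"
    by (intro sum.cong refl) (simp add: cell_eq_iff[OF Q])
  finally show ?thesis by (simp add: partition_entropy_def sum_negf)
qed

lemma refinement_partition:
  assumes P: "finite_partition \<mu> P" and T: "T \<in> borel \<rightarrow>\<^sub>M borel"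
  shows "finite_partition \<mu> (refinement \<mu> T P n)"
proof (induction n)
  case 0
  then show ?case by (auto simp: finite_partition_def disjoint_def)
next
  case (Suc n)
  let ?Q = "refinement \<mu> T P n"
  have Tn: "T ^^ n \<in> borel \<rightarrow>\<^sub>M borel" using T by (induction n) auto
  have eq: "refinement \<mu> T P (Suc n) = (\<lambda>(A, B). A \<inter> (T ^^ n) -` B) ` (?Q \<times> P)"
    by auto
  show ?case
    unfolding finite_partition_def
  proof (intro conjI)
    show "finite (refinement \<mu> T P (Suc n))"
      unfolding eq using Suc P by (auto simp: finite_partition_def)
    show "refinement \<mu> T P (Suc n) \<subseteq> sets \<mu>"
      using Suc P measurable_sets[OF Tn] unfolding eq by (auto simp: finite_partition_def)
    show "disjoint (refinement \<mu> T P (Suc n))"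
      unfolding eq disjoint_def
    proof clarify
      fix A B A' B'
      assume *: "A \<in> ?Q" "B \<in> P" "A' \<in> ?Q" "B' \<in> P"
        "A \<inter> (T ^^ n) -` B \<noteq> A' \<inter> (T ^^ n) -` B'"
      show "A \<inter> (T ^^ n) -` B \<inter> (A' \<inter> (T ^^ n) -` B') = {}"
      proof (cases "A = A'")
        case True
        then have "B \<noteq> B'" using * by auto
        then have "B \<inter> B' = {}" using P * by (auto simp: finite_partition_def disjoint_def)
        then show ?thesis by auto
      next
        case False
        then have "A \<inter> A' = {}" using Suc * by (auto simp: finite_partition_def disjoint_def)
        then show ?thesis by auto
      qed
    qed
    have "x \<in> \<Union> (refinement \<mu> T P (Suc n))" for x
    proof
      show "x \<in> cell ?Q x \<inter> (T ^^ n) -` cell P ((T ^^ n) x)"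
        using cell_in[OF Suc] cell_in[OF P] by blast
      show "cell ?Q x \<inter> (T ^^ n) -` cell P ((T ^^ n) x) \<in> refinement \<mu> T P (Suc n)"
        unfolding eq
        by (rule image_eqI[of _ _ "(cell ?Q x, cell P ((T ^^ n) x))"])
          (use cell_in[OF Suc] cell_in[OF P] in simp_all)
    qed
    then show "\<Union> (refinement \<mu> T P (Suc n)) = space \<mu>" by auto
  qed
qed

lemma refinement_determined:
  assumes "\<And>i B. i < n \<Longrightarrow> B \<in> P \<Longrightarrow> (T ^^ i) x \<in> B \<longleftrightarrow> (T ^^ i) y \<in> B"
    and "A \<in> refinement \<mu> T P n"
  shows "x \<in> A \<longleftrightarrow> y \<in> A"
  using assms
proof (induction n arbitrary: A)
  case 0
  from 0(2) show ?case by simp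
next
  case (Suc n)
  from Suc.prems(2) obtain A' B where A: "A = A' \<inter> (T ^^ n) -` B" "A' \<in> refinement \<mu> T P n" "B \<in> P"
    by auto
  have "x \<in> A' \<longleftrightarrow> y \<in> A'"
    using A(2) by (rule Suc.IH[rotated]) (rule Suc.prems(1)[OF less_SucI])
  moreover have "(T ^^ n) x \<in> B \<longleftrightarrow> (T ^^ n) y \<in> B"
    using A(3) by (rule Suc.prems(1)[OF lessI])
  ultimately show ?case using A(1) by simp
qed

text \<open>The refinement is decoded from \<open>Y\<close> and one correction per time step. By
  invariance each correction is distributed like \<open>e\<close>, so it costs
  \<open>ent e\<close>.\<close>

lemma partition_entropy_refinement_le:
  assumes P: "finite_partition \<mu> P" and T: "T \<in> borel \<rightarrow>\<^sub>M borel" "distr \<mu> borel T = \<mu>"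
    and Y: "simple_function \<mu> Y" and e: "simple_function \<mu> e"
    and det: "\<And>x y i B. Y x = Y y \<Longrightarrow> i < n \<Longrightarrow> e ((T ^^ i) x) = e ((T ^^ i) y) \<Longrightarrow> B \<in> P \<Longrightarrow>
        (T ^^ i) x \<in> B \<longleftrightarrow> (T ^^ i) y \<in> B"
  shows "partition_entropy \<mu> (refinement \<mu> T P n) \<le> ent Y + real n * ent e"
proof -
  let ?Z = "\<lambda>k x. (Y x, map (\<lambda>i. e ((T ^^ i) x)) [0..<k])"
  have Tn: "T ^^ k \<in> borel \<rightarrow>\<^sub>M borel" for k using T(1) by (induction k) auto
  have "simple_function \<mu> (?Z k) \<and> ent (?Z k) \<le> ent Y + real k * ent e" for k
  proof (induction k)
    case 0
    have "ent (?Z 0) \<le> ent Y" by (rule ent_mono[OF Y]) simp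
    moreover have "simple_function \<mu> (?Z 0)"
      using simple_function_compose[OF Y, of "\<lambda>y. (y, [])"] by (simp add: o_def)
    ultimately show ?case by simp
  next
    case (Suc k)
    let ?W = "\<lambda>x. (?Z k x, e ((T ^^ k) x))"
    have eT: "simple_function \<mu> (\<lambda>x. e ((T ^^ k) x))"
      by (rule simple_function_comp_invariant[OF e Tn])
    have W: "simple_function \<mu> ?W" by (rule simple_function_Pair) (use Suc eT in auto)
    have "?Z (Suc k) = (\<lambda>((y, l), a). (y, l @ [a])) \<circ> ?W" by auto
    then have "simple_function \<mu> (?Z (Suc k))"
      using simple_function_compose[OF W] by simp
    moreover have "ent (?Z (Suc k)) \<le> ent ?W" by (rule ent_mono[OF W]) auto
    moreover have "ent ?W \<le> ent (?Z k) + ent (\<lambda>x. e ((T ^^ k) x))"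
      by (rule ent_pair) (use Suc eT in auto)
    moreover have "ent (\<lambda>x. e ((T ^^ k) x)) = ent e"
      by (rule ent_invariant[OF e Tn distr_funpow[OF T]])
    ultimately show ?case using Suc by (simp add: algebra_simps)
  qed
  then have Z: "simple_function \<mu> (?Z n)" "ent (?Z n) \<le> ent Y + real n * ent e" by auto
  note R = refinement_partition[OF P T(1), of n]
  have "ent (cell (refinement \<mu> T P n)) \<le> ent (?Z n)"
  proof (rule ent_mono[OF Z(1)])
    fix x y assume "?Z n x = ?Z n y"
    then have Y: "Y x = Y y" and e: "\<And>i. i < n \<Longrightarrow> e ((T ^^ i) x) = e ((T ^^ i) y)" by auto
    have "x \<in> A \<longleftrightarrow> y \<in> A" if "A \<in> refinement \<mu> T P n" for A
      using that by (rule refinement_determined[rotated]) (rule det[OF Y _ e])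
    then have "(\<lambda>A. A \<in> refinement \<mu> T P n \<and> x \<in> A) = (\<lambda>A. A \<in> refinement \<mu> T P n \<and> y \<in> A)"
      by blast
    then show "cell (refinement \<mu> T P n) x = cell (refinement \<mu> T P n) y"
      by (simp only: cell_def)
  qed
  with Z(2) show ?thesis by (simp add: partition_entropy_eq[OF R])
qed

text \<open>The variable \<open>e\<close> repairs the guess made from a window: it is
  \<open>None\<close> where all approximating sets are right and names the true cell elsewhere. As
  it is \<open>None\<close> with probability close to 1, its entropy is small.\<close>

lemma partition_approx:
  assumes P: "finite_partition \<mu> P" and "\<eta> > 0"
  shows "\<exists>k (e :: _ \<Rightarrow> (int \<Rightarrow> 'p mod_ring) set option). simple_function \<mu> e \<and> ent e \<le> \<eta> \<and>
    (\<forall>x y B. (\<forall>i\<in>window k. x i = y i) \<longrightarrow> e x = e y \<longrightarrow> B \<in> P \<longrightarrow> (x \<in> B \<longleftrightarrow> y \<in> B))"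
proof -
  have fP: "finite P" and PM: "\<And>A. A \<in> P \<Longrightarrow> A \<in> sets borel"
    using P by (auto simp: finite_partition_def)
  define K where "K = real (card P)"
  \<comment> \<open>The wrong guesses will have mass at most \<open>s\<^sup>2\<close>. Then each of
    the \<open>K\<close> named cells contributes at most \<open>2 * sqrt (s\<^sup>2) = 2 * s\<close>
    and the value \<open>None\<close> at most \<open>s\<close>, which explains
    \<open>2 * K + 1\<close>.\<close>
  define s where "s = min 1 (\<eta> / (2 * K + 1))"
  have K: "K \<ge> 0" by (simp add: K_def)
  have s: "0 < s" "s \<le> 1"
    using assms(2) K by (auto simp: s_def)
  have "s \<le> \<eta> / (2 * K + 1)" by (simp add: s_def)
  then have s': "(2 * K + 1) * s \<le> \<eta>" using K by (simp add: pos_le_divide_eq mult.commute)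
  define \<delta> where "\<delta> = s\<^sup>2"
  have \<delta>: "0 < \<delta>" "\<delta> \<le> s" using s by (auto simp: \<delta>_def power2_eq_square mult_left_le)
  have fm: "finite_measure \<mu>" by unfold_locales
  have "\<exists>n B. determined (window n) B \<and> prob (sym_diff A B) < \<delta> / (K + 1)" if "A \<in> P" for A
    using \<delta> K PM[OF that] by (intro window_approx[OF fm]) auto
  then obtain n B where B: "\<And>A. A \<in> P \<Longrightarrow> determined (window (n A)) (B A)"
    "\<And>A. A \<in> P \<Longrightarrow> prob (sym_diff A (B A)) < \<delta> / (K + 1)"
    by metis
  define k where "k = Max (insert 0 (n ` P))"
  have det: "determined (window k) (B A)" if "A \<in> P" for A
    by (rule determined_mono[OF B(1)[OF that] window_mono]) (use fP that in \<open>auto simp: k_def\<close>)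
  have BM: "B A \<in> sets borel" if "A \<in> P" for A
    using det[OF that] by (rule determined_measurable[rotated]) simp
  define E where "E = (\<Union>A\<in>P. sym_diff A (B A))"
  have E: "E \<in> sets borel"
    unfolding E_def using fP PM BM by (intro sets.finite_UN) auto
  have prob_E: "prob E \<le> \<delta>"
  proof -
    have "prob E \<le> (\<Sum>A\<in>P. prob (sym_diff A (B A)))"
      unfolding E_def using fP PM BM by (intro measure_UNION_le) auto
    also have "\<dots> \<le> (\<Sum>A\<in>P. \<delta> / (K + 1))" by (intro sum_mono less_imp_le B(2))
    also have "\<dots> = K * \<delta> / (K + 1)" by (simp add: K_def)
    also have "\<dots> \<le> \<delta>" using K \<delta> by (simp add: field_simps)
    finally show ?thesis .
  qed
  define e where "e x = (if x \<in> E then Some (cell P x) else None)" for x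
  let ?S = "insert None (Some ` P)"
  have range: "range e \<subseteq> ?S" using cell_in(1)[OF P] by (auto simp: e_def)
  have None: "{x. e x = None} = - E" by (auto simp: e_def)
  have Some: "{x. e x = Some A} = E \<inter> A" if "A \<in> P" for A
    using cell_eq_iff[OF P that] by (auto simp: e_def)
  have e: "simple_function \<mu> e"
  proof (rule simple_functionI)
    show "finite (range e)" using fP by (intro finite_subset[OF range]) simp
    fix w
    show "{x. e x = w} \<in> sets borel"
    proof (cases w)
      case None': None
      then show ?thesis using E None by auto
    next
      case Some': (Some A)
      show ?thesis
      proof (cases "A \<in> P")
        case True
        then show ?thesis using Some Some' E PM by auto
      next
        case False
        have "e x \<in> ?S" for x using range by blast
        then have "e x \<noteq> w" for x using False Some' by (metis imageE insertE option.distinct(1) option.inject)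
        then have "{x. e x = w} = {}" by simp
        then show ?thesis by simp
      qed
    qed
  qed
  have "ent e = (\<Sum>w\<in>?S. - prob {x. e x = w} * ln (prob {x. e x = w}))"
    using fP range by (intro ent_eq[OF e]) auto
  also have "\<dots> = - prob {x. e x = None} * ln (prob {x. e x = None}) +
      (\<Sum>A\<in>P. - prob {x. e x = Some A} * ln (prob {x. e x = Some A}))"
    using fP by (subst sum.insert) (auto simp: sum.reindex)
  also have "- prob {x. e x = None} * ln (prob {x. e x = None}) \<le> 1 - prob {x. e x = None}"
    by (intro neg_t_ln_t_le) simp
  also have "1 - prob {x. e x = None} = prob E"
    using prob_compl[of E] E by (simp add: None Compl_eq_Diff_UNIV)
  also have "\<dots> \<le> s" using prob_E \<delta> by simp
  also have "(\<Sum>A\<in>P. - prob {x. e x = Some A} * ln (prob {x. e x = Some A})) \<le> (\<Sum>A\<in>P. 2 * s)"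
  proof (rule sum_mono)
    fix A assume A: "A \<in> P"
    have "- prob {x. e x = Some A} * ln (prob {x. e x = Some A}) \<le> 2 * sqrt (prob {x. e x = Some A})"
      by (rule neg_t_ln_t_le_sqrt) simp
    also have "prob {x. e x = Some A} \<le> prob E"
      unfolding Some[OF A] using E by (intro finite_measure_mono) auto
    also have "prob E \<le> s\<^sup>2" using prob_E by (simp add: \<delta>_def)
    also have "2 * sqrt (s\<^sup>2) = 2 * s" using s by simp
    finally show "- prob {x. e x = Some A} * ln (prob {x. e x = Some A}) \<le> 2 * s" by simp
  qed
  also have "s + (\<Sum>A\<in>P. 2 * s) = (2 * K + 1) * s" by (simp add: K_def algebra_simps)
  also have "\<dots> \<le> \<eta>" by (rule s')
  finally have "ent e \<le> \<eta>" by simp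
  moreover have "x \<in> A \<longleftrightarrow> y \<in> A"
    if xy: "\<forall>i\<in>window k. x i = y i" and exy: "e x = e y" and A: "A \<in> P" for x y A
  proof (cases "x \<in> E")
    case True
    then have "y \<in> E" "cell P x = cell P y" using exy by (auto simp: e_def split: if_splits)
    then show ?thesis using cell_eq_iff[OF P A] by metis
  next
    case False
    then have "y \<notin> E" using exy by (auto simp: e_def split: if_splits)
    moreover have "x \<in> B A \<longleftrightarrow> y \<in> B A"
      using det[OF A] xy unfolding determined_def by metis
    ultimately show ?thesis using False A by (auto simp: E_def)
  qed
  ultimately show ?thesis using e by blast
qed

lemma went_window: "went (window n) = H (2 * n + 1)"
proof -
  have "window n = {- int n..<- int n + int (2 * n + 1)}" by (auto simp: window_def)
  then show ?thesis using went_interval[of "- int n" "2 * n + 1"] by simp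
qed

lemma local_funpow:
  fixes T :: "(int \<Rightarrow> 'a) \<Rightarrow> int \<Rightarrow> 'a"
  assumes loc: "\<And>x y m. (\<And>i. \<bar>i - m\<bar> \<le> int R \<Longrightarrow> x i = y i) \<Longrightarrow> T x m = T y m"
    and "\<And>i. \<bar>i\<bar> \<le> int (k + j * R) \<Longrightarrow> x i = y i" "\<bar>i\<bar> \<le> int k"
  shows "(T ^^ j) x i = (T ^^ j) y i"
  using assms(2,3)
proof (induction j arbitrary: k i)
  case (Suc j)
  have "(T ^^ j) x l = (T ^^ j) y l" if "\<bar>l - i\<bar> \<le> int R" for l
  proof (rule Suc.IH[of "k + R"])
    show "\<bar>l\<bar> \<le> int (k + R)" using that Suc.prems(2) by simp
  qed (use Suc.prems(1) in \<open>simp add: algebra_simps\<close>)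
  then have "T ((T ^^ j) x) i = T ((T ^^ j) y) i" by (rule loc)
  then show ?case by simp
next
  case 0
  then show ?case using 0(1)[of i] by simp
qed

text \<open>The \<open>n\<close>-th refinement of a window partition depends on a window of length linear in \<open>n\<close>.\<close>

lemma entropy_rate_pos:
  assumes T: "T \<in> borel \<rightarrow>\<^sub>M borel" "distr \<mu> borel T = \<mu>"
    and loc: "\<And>x y m. (\<And>i. \<bar>i - m\<bar> \<le> int R \<Longrightarrow> x i = y i) \<Longrightarrow> T x m = T y m"
    and pos: "ks_entropy \<mu> T > 0"
  shows "\<exists>h>0. \<forall>n. real n * h \<le> H n"
proof (rule ccontr)
  assume no: "\<not> ?thesis"
  have "entropy_wrt \<mu> T P = 0" if P: "finite_partition \<mu> P" for P
  proof -
    let ?a = "\<lambda>n. partition_entropy \<mu> (refinement \<mu> T P n) / real n"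
    have nonneg: "0 \<le> ?a n" for n
      using ent_nonneg[OF simple_cell[OF refinement_partition[OF P T(1)]]]
      by (simp add: partition_entropy_eq[OF refinement_partition[OF P T(1)]])
    have "?a \<longlonglongrightarrow> 0"
    proof (rule LIMSEQ_I)
      fix \<delta> :: real assume \<delta>: "\<delta> > 0"
      \<comment> \<open>Per time step the window grows by \<open>2 * R\<close> places, costing at
        most \<open>\<delta> / 2\<close>, and the correction costs \<open>\<delta> / 4\<close>; the
        total slope \<open>3 * \<delta> / 4\<close> leaves room to absorb the constant
        \<open>D\<close>.\<close>
      define \<epsilon> where "\<epsilon> = \<delta> / (4 * (real R + 1))"
      have \<epsilon>: "\<epsilon> > 0" "\<epsilon> * 2 * real R \<le> \<delta> / 2" using \<delta> by (auto simp: \<epsilon>_def field_simps)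
      obtain C where C: "\<And>n. H n \<le> \<epsilon> * real n + C"
        using H_sublinear[OF no \<epsilon>(1)] by blast
      obtain k and e :: "_ \<Rightarrow> (int \<Rightarrow> 'p mod_ring) set option"
        where e: "simple_function \<mu> e" "ent e \<le> \<delta> / 4"
        and det: "\<forall>x y B. (\<forall>i\<in>window k. x i = y i) \<longrightarrow> e x = e y \<longrightarrow> B \<in> P \<longrightarrow> (x \<in> B \<longleftrightarrow> y \<in> B)"
        using partition_approx[OF P, of "\<delta> / 4", OF divide_pos_pos[OF \<delta>]] zero_less_numeral by blast
      define D where "D = \<epsilon> * real (2 * k + 1) + C"
      have bound: "partition_entropy \<mu> (refinement \<mu> T P n) \<le> 3 * \<delta> / 4 * real n + D" for n
      proof -
        have "partition_entropy \<mu> (refinement \<mu> T P n)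
            \<le> ent (\<lambda>x. restrict x (window (k + n * R))) + real n * ent e"
        proof (rule partition_entropy_refinement_le[OF P T _ e(1)])
          fix x y :: "int \<Rightarrow> 'p mod_ring" and i B
          assume *: "restrict x (window (k + n * R)) = restrict y (window (k + n * R))" "i < n"
            "e ((T ^^ i) x) = e ((T ^^ i) y)" "B \<in> P"
          have "(T ^^ i) x j = (T ^^ i) y j" if "j \<in> window k" for j
          proof (rule local_funpow[OF loc])
            show "\<bar>j\<bar> \<le> int k" using that by (auto simp: window_def)
            fix l assume "\<bar>l\<bar> \<le> int (k + i * R)"
            moreover have "i * R \<le> n * R" using *(2) by simp
            ultimately have "l \<in> window (k + n * R)"
              unfolding window_def by (smt (verit, ccfv_threshold) atLeastAtMost_iff int_ops(5) of_nat_mono)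
            then show "x l = y l" using *(1) by (simp add: restrict_eq_iff)
          qed
          then show "(T ^^ i) x \<in> B \<longleftrightarrow> (T ^^ i) y \<in> B"
            using det *(3,4) by blast
        qed (simp add: simple_restrict)
        also have "ent (\<lambda>x. restrict x (window (k + n * R))) = H (2 * (k + n * R) + 1)"
          using went_window by (simp add: went_def)
        also have "\<dots> \<le> \<epsilon> * real (2 * (k + n * R) + 1) + C" by (rule C)
        also have "\<dots> = \<epsilon> * 2 * real R * real n + D" by (simp add: D_def algebra_simps)
        also have "\<dots> \<le> \<delta> / 2 * real n + D" using \<epsilon>(2) by (intro add_mono mult_right_mono) auto
        also have "real n * ent e \<le> real n * (\<delta> / 4)" using e(2) by (intro mult_left_mono) auto
        finally show ?thesis by (simp add: algebra_simps)
      qed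
      obtain N where N: "real N > 4 * \<bar>D\<bar> / \<delta>" using reals_Archimedean2 by blast
      show "\<exists>N. \<forall>n\<ge>N. norm (?a n - 0) < \<delta>"
      proof (intro exI[of _ "Suc N"] allI impI)
        fix n assume n: "Suc N \<le> n"
        then have n0: "real n > 0" and nN: "real n > 4 * \<bar>D\<bar> / \<delta>" using N by linarith+
        then have "\<bar>D\<bar> < \<delta> / 4 * real n" using \<delta> by (simp add: field_simps)
        then have "partition_entropy \<mu> (refinement \<mu> T P n) < \<delta> * real n"
          using bound[of n] by (simp add: algebra_simps)
        then have "?a n < \<delta>" using n0 by (simp add: field_simps)
        then show "norm (?a n - 0) < \<delta>" using nonneg[of n] by simp
      qed
    qed
    then show ?thesis unfolding entropy_wrt_def by (rule limI)
  qed
  then have "ks_entropy \<mu> T \<le> 0"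
    unfolding ks_entropy_def by (intro SUP_least) simp
  with pos show False by simp
qed

text \<open>If all increments beyond \<open>N0\<close> were smaller, \<open>H\<close> would grow
  with slope \<open>h'\<close> along \<open>N0 + j * e\<close>. Since \<open>h' < h\<close>, this
  eventually contradicts the linear lower bound, whatever the starting value \<open>H N0\<close>
  is.\<close>

lemma entropy_increment:
  assumes h: "\<And>n. real n * h \<le> H n" and h': "h' < h" and e: "e > 0"
  shows "\<exists>N\<ge>N0. real e * h' \<le> H (N + e) - H N"
proof (rule ccontr)
  assume "\<not> ?thesis"
  then have no: "H (N + e) \<le> H N + real e * h'" if "N \<ge> N0" for N
    using that by force
  have "H (N0 + j * e) \<le> H N0 + real (j * e) * h'" for j
  proof (induction j)
    case (Suc j)
    have "H (N0 + Suc j * e) = H ((N0 + j * e) + e)" by (simp add: algebra_simps)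
    also have "\<dots> \<le> H (N0 + j * e) + real e * h'" by (rule no) simp
    finally show ?case using Suc by (simp add: algebra_simps)
  qed simp
  then have *: "real (N0 + j * e) * h \<le> H N0 + real (j * e) * h'" for j
    using h[of "N0 + j * e"] by (rule order_trans[rotated])
  obtain j where j: "real j > (H N0 - real N0 * h) / (real e * (h - h'))"
    using reals_Archimedean2 by blast
  have "real e * (h - h') > 0" using e h' by simp
  with j have "H N0 - real N0 * h < real j * (real e * (h - h'))" by (simp add: pos_divide_less_eq)
  with *[of j] show False by (simp add: algebra_simps)
qed

end

subsection \<open>Symmetrization over the kernel\<close>

definition ad :: "(int \<Rightarrow> 'a::plus) \<Rightarrow> (int \<Rightarrow> 'a) \<Rightarrow> int \<Rightarrow> 'a" where
  "ad d x = (\<lambda>i. x i + d i)"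

lemma measurable_ad [measurable]:
  "ad d \<in> borel \<rightarrow>\<^sub>M (borel :: (int \<Rightarrow> 'a::finite mod_ring) measure)"
  unfolding ad_def[abs_def] by measurable

lemma act_ad: "act c (ad d x) m = act c x m + act c d m"
  unfolding ad_def by (rule act_plus)

lemma measurable_act [measurable]:
  "(\<lambda>x. act c x m) \<in> borel \<rightarrow>\<^sub>M count_space (UNIV :: 'p::nontriv mod_ring set)"
proof -
  have "(\<lambda>x. act c x m) -` {a} \<in> sets (borel :: (int \<Rightarrow> 'p mod_ring) measure)" for a
  proof (rule determined_measurable[of "{m..m + int (degree c)}"])
    show "determined {m..m + int (degree c)} ((\<lambda>x. act c x m) -` {a})"
      unfolding determined_def
    proof (intro allI impI)
      fix x y assume eq: "\<forall>i\<in>{m..m + int (degree c)}. x i = y i" and x: "x \<in> (\<lambda>x. act c x m) -` {a}"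
      have "act c x m = act c y m" by (rule act_cong) (rule eq[rule_format], simp)
      with x show "y \<in> (\<lambda>x. act c x m) -` {a}" by simp
    qed
  qed simp
  then show ?thesis
    unfolding measurable_count_space_eq2[OF finite] by simp
qed

lemma measurable_act_fun [measurable]:
  "act c \<in> borel \<rightarrow>\<^sub>M (borel :: (int \<Rightarrow> 'p::nontriv mod_ring) measure)"
  by (rule measurable_configurationI) (rule measurable_act)

text \<open>Set up for one polynomial and one common period \<open>N\<close> of its kernel, to be
  instantiated with every positive power of the polynomial of the automaton. The hypothesis on
  invariant sets enters through \<open>inv_N\<close>.\<close>

locale kernel_fibres = shift_invariant \<mu>
  for \<mu> :: "(int \<Rightarrow> 'p::prime_card mod_ring) measure" +
  fixes c :: "'p mod_ring poly" and N :: int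
  assumes c0: "coeff c 0 \<noteq> 0"
    and distr_act: "distr \<mu> borel (act c) = \<mu>"
    and period: "d \<in> ker c \<Longrightarrow> tr N d = d"
    and inv_N: "inv_set N B \<Longrightarrow> inv_set 1 B"
begin

abbreviation "D \<equiv> ker c"

lemma finite_D [simp]: "finite D"
  by (rule card_ker(2)[OF c0])

text \<open>The unnormalized sum of the kernel translates of \<open>\<mu>\<close>, of total mass
  \<open>card D\<close>. It dominates \<open>\<mu>\<close> and is invariant under the kernel, so a
  density against it encodes the conditional measures on the fibres.\<close>

definition nu :: "(int \<Rightarrow> 'p mod_ring) measure" where
  "nu = distr (count_space D \<Otimes>\<^sub>M \<mu>) borel (\<lambda>(d, x). ad d x)"

lemma sets_nu [simp, measurable_cong]: "sets nu = sets borel"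
  by (simp add: nu_def)

lemma space_nu [simp]: "space nu = UNIV"
  by (simp add: nu_def)

lemma measurable_ad_pair: "(\<lambda>(d, x). ad d x) \<in> count_space D \<Otimes>\<^sub>M \<mu> \<rightarrow>\<^sub>M borel"
  by (rule measurable_pair_measure_countable1)
    (auto simp: countable_finite cong: measurable_cong_sets)

lemma nn_integral_nu:
  assumes [measurable]: "f \<in> borel_measurable borel"
  shows "(\<integral>\<^sup>+x. f x \<partial>nu) = (\<Sum>d\<in>D. \<integral>\<^sup>+x. f (ad d x) \<partial>\<mu>)"
proof -
  have "(\<integral>\<^sup>+x. f x \<partial>nu) = (\<integral>\<^sup>+z. f (case z of (d, x) \<Rightarrow> ad d x) \<partial>(count_space D \<Otimes>\<^sub>M \<mu>))"
    unfolding nu_def by (rule nn_integral_distr[OF measurable_ad_pair]) measurable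
  also have "\<dots> = (\<integral>\<^sup>+d. \<integral>\<^sup>+x. f (ad d x) \<partial>\<mu> \<partial>count_space D)"
    by (subst nn_integral_fst[symmetric]) (use measurable_compose[OF measurable_ad_pair, of f] in auto)
  also have "\<dots> = (\<Sum>d\<in>D. \<integral>\<^sup>+x. f (ad d x) \<partial>\<mu>)"
    by (rule nn_integral_count_space_finite) simp
  finally show ?thesis .
qed

lemma measurable_ad_mu [measurable]: "ad d \<in> \<mu> \<rightarrow>\<^sub>M borel" "ad d \<in> nu \<rightarrow>\<^sub>M borel"
  by (simp_all cong: measurable_cong_sets)

lemma emeasure_nu:
  assumes A [measurable]: "A \<in> sets borel"
  shows "emeasure nu A = (\<Sum>d\<in>D. emeasure \<mu> {x. ad d x \<in> A})"
proof -
  have "emeasure nu A = (\<integral>\<^sup>+x. indicator A x \<partial>nu)" by simp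
  also have "\<dots> = (\<Sum>d\<in>D. \<integral>\<^sup>+x. indicator A (ad d x) \<partial>\<mu>)"
    by (rule nn_integral_nu) measurable
  also have "\<dots> = (\<Sum>d\<in>D. emeasure \<mu> {x. ad d x \<in> A})"
  proof (rule sum.cong[OF refl])
    fix d
    have "{x \<in> space \<mu>. ad d x \<in> A} \<in> sets \<mu>" by measurable
    then have "(\<integral>\<^sup>+x. indicator {x. ad d x \<in> A} x \<partial>\<mu>) = emeasure \<mu> {x. ad d x \<in> A}"
      by (intro nn_integral_indicator) simp
    then show "(\<integral>\<^sup>+x. indicator A (ad d x) \<partial>\<mu>) = emeasure \<mu> {x. ad d x \<in> A}"
      by (simp add: indicator_def)
  qed
  finally show ?thesis .
qed

lemma finite_measure_nu: "finite_measure nu"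
  by (rule finite_measureI) (simp add: emeasure_nu emeasure_eq_measure ennreal_mult_eq_top_iff)

lemma distr_nu_ad:
  assumes d: "d \<in> D"
  shows "distr nu borel (ad d) = nu"
proof (rule measure_eqI)
  fix A assume "A \<in> sets (distr nu borel (ad d))"
  then have A [measurable]: "A \<in> sets borel" by simp
  have A': "{x. ad d x \<in> A} \<in> sets borel"
    using measurable_sets[OF measurable_ad A] by (simp add: vimage_def)
  have "emeasure (distr nu borel (ad d)) A = emeasure nu {x. ad d x \<in> A}"
    by (subst emeasure_distr) (auto simp: vimage_def)
  also have "\<dots> = (\<Sum>e\<in>D. emeasure \<mu> {x. ad (\<lambda>i. e i + d i) x \<in> A})"
    unfolding emeasure_nu[OF A'] by (simp add: ad_def add.assoc)
  also have "\<dots> = (\<Sum>e\<in>D. emeasure \<mu> {x. ad e x \<in> A})"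
    by (rule sum.reindex_bij_witness[of _ "\<lambda>e i. e i - d i" "\<lambda>e i. e i + d i"])
      (use d in \<open>auto intro: ker_add ker_diff\<close>)
  also have "\<dots> = emeasure nu A" by (simp add: emeasure_nu)
  finally show "emeasure (distr nu borel (ad d)) A = emeasure nu A" .
qed simp

lemma nn_integral_nu_ad:
  assumes "d \<in> D" and [measurable]: "f \<in> borel_measurable borel"
  shows "(\<integral>\<^sup>+x. f (ad d x) \<partial>nu) = (\<integral>\<^sup>+x. f x \<partial>nu)"
proof -
  have "(\<integral>\<^sup>+x. f (ad d x) \<partial>nu) = (\<integral>\<^sup>+x. f x \<partial>distr nu borel (ad d))"
    by (rule nn_integral_distr[symmetric]) auto
  then show ?thesis by (simp only: distr_nu_ad[OF assms(1)])
qed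

lemma AE_nu_ad:
  assumes "d \<in> D" "AE x in nu. P x"
  shows "AE x in nu. P (ad d x)"
proof -
  have "AE x in distr nu borel (ad d). P x" using assms by (simp only: distr_nu_ad)
  then show ?thesis by (rule AE_distrD[rotated]) measurable
qed

lemma tr_ad: "tr k (ad d x) = ad (tr k d) (tr k x)"
  by (simp add: ad_def tr_def)

lemma nn_integral_nu_tr:
  assumes [measurable]: "f \<in> borel_measurable borel"
  shows "(\<integral>\<^sup>+x. f (tr N x) \<partial>nu) = (\<integral>\<^sup>+x. f x \<partial>nu)"
proof -
  have "(\<integral>\<^sup>+x. f (tr N x) \<partial>nu) = (\<Sum>d\<in>D. \<integral>\<^sup>+x. f (tr N (ad d x)) \<partial>\<mu>)"
    by (rule nn_integral_nu) measurable
  also have "\<dots> = (\<Sum>d\<in>D. \<integral>\<^sup>+x. f (ad d (tr N x)) \<partial>\<mu>)"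
    by (intro sum.cong refl) (simp add: tr_ad period)
  also have "\<dots> = (\<Sum>d\<in>D. \<integral>\<^sup>+x. f (ad d x) \<partial>\<mu>)"
    by (intro sum.cong refl nn_integral_tr) measurable
  also have "\<dots> = (\<integral>\<^sup>+x. f x \<partial>nu)" by (rule nn_integral_nu[symmetric]) measurable
  finally show ?thesis .
qed

lemma ad_0 [simp]: "ad (\<lambda>_. 0) x = x" for x :: "int \<Rightarrow> 'p mod_ring"
  by (simp add: ad_def)

lemma mu_le_nu: "A \<in> sets borel \<Longrightarrow> emeasure \<mu> A \<le> emeasure nu A"
  using ker_0[of c] by (simp add: emeasure_nu sum.remove[of D "\<lambda>_. 0"])

lemma ac_nu_mu: "absolutely_continuous nu \<mu>"
  unfolding absolutely_continuous_def
proof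
  fix A assume "A \<in> null_sets nu"
  then have A: "A \<in> sets borel" "emeasure nu A = 0" by auto
  then show "A \<in> null_sets \<mu>" using mu_le_nu[OF A(1)] by auto
qed

lemma AE_mu_nu: "AE x in nu. P x \<Longrightarrow> AE x in \<mu>. P x"
  by (rule absolutely_continuous_AE[OF _ ac_nu_mu]) simp

definition ndeg :: "(int \<Rightarrow> 'p mod_ring) \<Rightarrow> int \<Rightarrow> 'p mod_ring" where
  "ndeg d = (\<lambda>i. - d i)"

lemma ndeg_D: "d \<in> D \<Longrightarrow> ndeg d \<in> D"
  unfolding ndeg_def by (rule ker_uminus)

lemma ad_ndeg [simp]: "ad d (ad (ndeg d) x) = x" "ad (ndeg d) (ad d x) = x"
  by (simp_all add: ad_def ndeg_def)

lemma ndeg_ndeg [simp]: "ndeg (ndeg d) = d"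
  by (simp add: ndeg_def)

lemma sum_ndeg: "(\<Sum>d\<in>D. f (ndeg d)) = (\<Sum>d\<in>D. f d)"
  by (rule sum.reindex_bij_witness[of _ ndeg ndeg]) (simp_all add: ndeg_D)

text \<open>\<open>rho (ad d x)\<close> is the conditional probability of \<open>ad d x\<close> in its fibre, given \<open>act c x\<close>.\<close>

definition rho :: "(int \<Rightarrow> 'p mod_ring) \<Rightarrow> real" where
  "rho x = min 1 (enn2real (RN_deriv nu \<mu> x))"

lemma rho_measurable [measurable]: "rho \<in> borel_measurable borel"
proof -
  have "RN_deriv nu \<mu> \<in> borel_measurable borel"
    using borel_measurable_RN_deriv[of nu \<mu>] by (simp cong: measurable_cong_sets)
  then show ?thesis unfolding rho_def[abs_def] by measurable
qed

lemma rho_nonneg [simp]: "0 \<le> rho x" and rho_le_1: "rho x \<le> 1"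
  by (simp_all add: rho_def)

text \<open>Moving the density by all kernel elements and summing rebuilds \<open>nu\<close> from
  the translates of \<open>\<mu>\<close>. The fibre sum is therefore a density of \<open>nu\<close>
  against itself, and densities are unique.\<close>

lemma density_rho_aux:
  fixes r assumes [measurable]: "r \<in> borel_measurable borel" and r: "density nu r = \<mu>"
  shows "AE x in nu. (\<Sum>d\<in>D. r (ad d x)) = 1"
proof -
  interpret nu: finite_measure nu by (rule finite_measure_nu)
  have "density nu (\<lambda>x. \<Sum>d\<in>D. r (ad d x)) = density nu (\<lambda>_. 1)"
  proof (rule measure_eqI)
    fix A assume "A \<in> sets (density nu (\<lambda>x. \<Sum>d\<in>D. r (ad d x)))"
    then have A [measurable]: "A \<in> sets borel" by simp
    have "emeasure (density nu (\<lambda>x. \<Sum>d\<in>D. r (ad d x))) A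
        = (\<integral>\<^sup>+x. (\<Sum>d\<in>D. r (ad d x) * indicator A x) \<partial>nu)"
      by (subst emeasure_density) (auto simp: sum_distrib_right)
    also have "\<dots> = (\<Sum>d\<in>D. \<integral>\<^sup>+x. r (ad d x) * indicator A x \<partial>nu)"
      by (rule nn_integral_sum) measurable
    also have "\<dots> = (\<Sum>d\<in>D. \<integral>\<^sup>+x. r x * indicator A (ad (ndeg d) x) \<partial>nu)"
    proof (rule sum.cong[OF refl])
      fix d assume "d \<in> D"
      then show "(\<integral>\<^sup>+x. r (ad d x) * indicator A x \<partial>nu) = (\<integral>\<^sup>+x. r x * indicator A (ad (ndeg d) x) \<partial>nu)"
        using nn_integral_nu_ad[of d "\<lambda>x. r x * indicator A (ad (ndeg d) x)"] by simp
    qed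
    also have "\<dots> = (\<Sum>d\<in>D. \<integral>\<^sup>+x. indicator A (ad (ndeg d) x) \<partial>density nu r)"
      by (subst nn_integral_density) auto
    also have "\<dots> = (\<Sum>d\<in>D. \<integral>\<^sup>+x. indicator A (ad d x) \<partial>\<mu>)"
      unfolding r by (rule sum_ndeg)
    also have "\<dots> = (\<integral>\<^sup>+x. indicator A x \<partial>nu)" by (rule nn_integral_nu[symmetric]) measurable
    also have "\<dots> = emeasure (density nu (\<lambda>_. 1)) A" by (simp add: emeasure_density)
    finally show "emeasure (density nu (\<lambda>x. \<Sum>d\<in>D. r (ad d x))) A = emeasure (density nu (\<lambda>_. 1)) A" .
  qed simp
  then show ?thesis by (subst (asm) nu.density_unique_iff) auto
qed

text \<open>Fibre sums equal to 1 bound each single derivative by 1. So the truncation in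
  \<open>rho\<close>, which provides a bounded real function everywhere, changes a null set
  only.\<close>

lemma RN_eq_rho: "AE x in nu. RN_deriv nu \<mu> x = ennreal (rho x)"
proof -
  interpret nu: finite_measure nu by (rule finite_measure_nu)
  have dens: "density nu (RN_deriv nu \<mu>) = \<mu>"
    by (rule nu.density_RN_deriv[OF ac_nu_mu]) simp
  have "RN_deriv nu \<mu> \<in> borel_measurable borel"
    using borel_measurable_RN_deriv[of nu \<mu>] by (simp cong: measurable_cong_sets)
  from density_rho_aux[OF this dens] show ?thesis
  proof eventually_elim
    case (elim x)
    have "RN_deriv nu \<mu> (ad (\<lambda>_. 0) x) \<le> (\<Sum>d\<in>D. RN_deriv nu \<mu> (ad d x))"
      by (rule member_le_sum) (auto simp: ker_0)
    then have le: "RN_deriv nu \<mu> x \<le> 1" using elim by simp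
    then have "enn2real (RN_deriv nu \<mu> x) \<le> 1" using enn2real_mono[OF le] by simp
    moreover have "RN_deriv nu \<mu> x = ennreal (enn2real (RN_deriv nu \<mu> x))"
      using le_less_trans[OF le, of \<infinity>] by simp
    ultimately show ?case by (simp add: rho_def)
  qed
qed

lemma density_rho: "density nu (\<lambda>x. ennreal (rho x)) = \<mu>"
proof -
  interpret nu: finite_measure nu by (rule finite_measure_nu)
  have "density nu (\<lambda>x. ennreal (rho x)) = density nu (RN_deriv nu \<mu>)"
    using RN_eq_rho by (intro density_cong) auto
  also have "\<dots> = \<mu>" by (rule nu.density_RN_deriv[OF ac_nu_mu]) simp
  finally show ?thesis .
qed

lemma nn_integral_mu:
  assumes [measurable]: "f \<in> borel_measurable borel"
  shows "(\<integral>\<^sup>+x. f x \<partial>\<mu>) = (\<integral>\<^sup>+x. ennreal (rho x) * f x \<partial>nu)"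
proof -
  have "(\<integral>\<^sup>+x. f x \<partial>density nu (\<lambda>x. ennreal (rho x))) = (\<integral>\<^sup>+x. ennreal (rho x) * f x \<partial>nu)"
    by (rule nn_integral_density) auto
  then show ?thesis by (simp only: density_rho)
qed

lemma sum_rho: "AE x in nu. (\<Sum>d\<in>D. rho (ad d x)) = 1"
proof -
  have "(\<lambda>x. ennreal (rho x)) \<in> borel_measurable borel" by measurable
  from density_rho_aux[OF this density_rho] show ?thesis
  proof eventually_elim
    case (elim x)
    then have "ennreal (\<Sum>d\<in>D. rho (ad d x)) = ennreal 1" by (simp add: sum_ennreal)
    then show ?case by (subst (asm) ennreal_inj) (auto intro: sum_nonneg)
  qed
qed

text \<open>\<open>tr N\<close> fixes all kernel elements, hence commutes with their translations
  and preserves \<open>nu\<close> as well as \<open>\<mu>\<close>; uniqueness of the density gives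
  the rest.\<close>

lemma rho_tr: "AE x in nu. rho (tr N x) = rho x"
proof -
  interpret nu: finite_measure nu by (rule finite_measure_nu)
  have "density nu (\<lambda>x. ennreal (rho (tr N x))) = density nu (\<lambda>x. ennreal (rho x))"
  proof (rule measure_eqI)
    fix A assume "A \<in> sets (density nu (\<lambda>x. ennreal (rho (tr N x))))"
    then have A [measurable]: "A \<in> sets borel" by simp
    have "emeasure (density nu (\<lambda>x. ennreal (rho (tr N x)))) A
        = (\<integral>\<^sup>+x. ennreal (rho (tr N x)) * indicator A (tr (- N) (tr N x)) \<partial>nu)"
      by (simp add: emeasure_density)
    also have "\<dots> = (\<integral>\<^sup>+x. ennreal (rho x) * indicator A (tr (- N) x) \<partial>nu)"
      by (rule nn_integral_nu_tr) measurable
    also have "\<dots> = (\<integral>\<^sup>+x. indicator A (tr (- N) x) \<partial>\<mu>)"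
      by (rule nn_integral_mu[symmetric]) measurable
    also have "\<dots> = (\<integral>\<^sup>+x. indicator A x \<partial>\<mu>)"
      by (rule nn_integral_tr) measurable
    also have "\<dots> = emeasure (density nu (\<lambda>x. ennreal (rho x))) A" by (simp add: density_rho)
    finally show "emeasure (density nu (\<lambda>x. ennreal (rho (tr N x)))) A
      = emeasure (density nu (\<lambda>x. ennreal (rho x))) A" .
  qed simp
  then have "AE x in nu. ennreal (rho (tr N x)) = ennreal (rho x)"
    by (subst (asm) nu.density_unique_iff) auto
  then show ?thesis by eventually_elim simp
qed

text \<open>Both sides equal the \<open>nu\<close>-integral of
  \<open>rho x * rho (ad (ndeg d) x) * f x\<close>. The extra weight turns the exact invariance of
  \<open>nu\<close> under the kernel into a statement about \<open>\<mu>\<close>.\<close>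

lemma transfer:
  assumes d: "d \<in> D" and [measurable]: "f \<in> borel_measurable borel"
  shows "(\<integral>\<^sup>+x. ennreal (rho (ad d x)) * f (ad d x) \<partial>\<mu>) = (\<integral>\<^sup>+x. ennreal (rho (ad (ndeg d) x)) * f x \<partial>\<mu>)"
proof -
  have "(\<integral>\<^sup>+x. ennreal (rho (ad d x)) * f (ad d x) \<partial>\<mu>)
      = (\<integral>\<^sup>+x. ennreal (rho (ad (ndeg d) (ad d x))) * (ennreal (rho (ad d x)) * f (ad d x)) \<partial>nu)"
    by (subst nn_integral_mu) auto
  also have "\<dots> = (\<integral>\<^sup>+x. ennreal (rho (ad (ndeg d) x)) * (ennreal (rho x) * f x) \<partial>nu)"
    by (rule nn_integral_nu_ad[OF d]) measurable
  also have "\<dots> = (\<integral>\<^sup>+x. ennreal (rho x) * (ennreal (rho (ad (ndeg d) x)) * f x) \<partial>nu)"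
    by (simp add: ac_simps)
  also have "\<dots> = (\<integral>\<^sup>+x. ennreal (rho (ad (ndeg d) x)) * f x \<partial>\<mu>)"
    by (rule nn_integral_mu[symmetric]) measurable
  finally show ?thesis .
qed

end

section \<open>Equidistribution of functionals on invariant sets\<close>

lemma tr_invariant_all:
  assumes "\<And>x. tr 1 x \<in> B \<longleftrightarrow> x \<in> B"
  shows "tr k x \<in> B \<longleftrightarrow> x \<in> B"
  using periodic_mult[of "\<lambda>i. tr i x \<in> B" 1 0 k] assms[of "tr _ x"] by (simp add: add.commute)

context shift_invariant
begin

text \<open>Only equality of masses is recorded, so that no normalization by the mass of
  \<open>B\<close> enters.\<close>

definition equidistributed :: "(int \<Rightarrow> 'p mod_ring) set \<Rightarrow> 'p mod_ring poly \<Rightarrow> bool" where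
  "equidistributed B g \<longleftrightarrow>
    (\<forall>j a a'. emeasure \<mu> {x \<in> B. act g x j = a} = emeasure \<mu> {x \<in> B. act g x j = a'})"

lemma emeasure_AE_eq:
  assumes "AE x in \<mu>. x \<in> A \<longleftrightarrow> x \<in> B" "A \<in> sets borel" "B \<in> sets borel"
  shows "emeasure \<mu> A = emeasure \<mu> B"
  by (rule emeasure_eq_AE[OF assms(1)]) (simp_all add: assms(2,3))

lemma sets_act_eq: "B \<in> sets borel \<Longrightarrow> {x \<in> B. act g x j = a} \<in> sets (borel :: (int \<Rightarrow> 'p mod_ring) measure)"
proof -
  assume B: "B \<in> sets borel"
  have "{x \<in> space borel. act g x j = a} \<in> sets (borel :: (int \<Rightarrow> 'p mod_ring) measure)"
    using measurable_sets[OF measurable_act[of g j], of "{a}"] by (simp add: vimage_def)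
  with B have "B \<inter> {x \<in> space borel. act g x j = a} \<in> sets borel" by (rule sets.Int)
  moreover have "B \<inter> {x \<in> space borel. act g x j = a} = {x \<in> B. act g x j = a}" by auto
  ultimately show ?thesis by simp
qed

lemma equidistributed_AE_eq:
  assumes "equidistributed B' g" "AE x in \<mu>. x \<in> B' \<longleftrightarrow> x \<in> B" "B \<in> sets borel" "B' \<in> sets borel"
  shows "equidistributed B g"
proof -
  have "emeasure \<mu> {x \<in> B'. act g x j = a} = emeasure \<mu> {x \<in> B. act g x j = a}" for j a
  proof (rule emeasure_AE_eq)
    show "AE x in \<mu>. x \<in> {x \<in> B'. act g x j = a} \<longleftrightarrow> x \<in> {x \<in> B. act g x j = a}"
      using assms(2) by eventually_elim auto
  qed (use assms in \<open>auto intro: sets_act_eq\<close>)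
  with assms(1) show ?thesis unfolding equidistributed_def by metis
qed

text \<open>Making the cover disjoint uses set operations only and so preserves invariance; the
  masses of the pieces then add up. Since the pieces are smaller than the \<open>E i\<close>,
  \<open>eqd\<close> ranges over all invariant subsets.\<close>

lemma equidistributed_UN:
  fixes E :: "nat \<Rightarrow> (int \<Rightarrow> 'p mod_ring) set"
  assumes E: "\<And>i. inv_set 1 (E i)" and B: "inv_set 1 B" "B \<subseteq> (\<Union>i. E i)"
    and eqd: "\<And>i B'. inv_set 1 B' \<Longrightarrow> B' \<subseteq> E i \<Longrightarrow> equidistributed B' g"
  shows "equidistributed B g"
  unfolding equidistributed_def
proof (intro allI)
  fix j a a'
  have Em: "E i \<in> sets borel" for i using E by (simp add: inv_set_def)
  have Bm: "B \<in> sets borel" using B by (simp add: inv_set_def)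
  define Bi where "Bi i = B \<inter> disjointed E i" for i
  have "range (disjointed E) \<subseteq> sets borel"
    by (rule sets.range_disjointed_sets) (use Em in auto)
  then have dm: "disjointed E i \<in> sets borel" for i by auto
  have inv: "inv_set 1 (Bi i)" for i
  proof -
    have "AE x in \<mu>. \<forall>i. tr 1 x \<in> E i \<longleftrightarrow> x \<in> E i"
      using E by (simp add: AE_all_countable inv_set_def)
    moreover have "AE x in \<mu>. tr 1 x \<in> B \<longleftrightarrow> x \<in> B" using B by (simp add: inv_set_def)
    ultimately have "AE x in \<mu>. tr 1 x \<in> Bi i \<longleftrightarrow> x \<in> Bi i"
      by eventually_elim (auto simp: Bi_def disjointed_def)
    then show ?thesis using Bm dm by (simp add: inv_set_def Bi_def)
  qed
  have sub: "Bi i \<subseteq> E i" for i by (auto simp: Bi_def disjointed_def)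
  have sum: "emeasure \<mu> {x \<in> B. act g x j = b} = (\<Sum>i. emeasure \<mu> {x \<in> Bi i. act g x j = b})" for b
  proof -
    have "(\<Sum>i. emeasure \<mu> {x \<in> Bi i. act g x j = b}) = emeasure \<mu> (\<Union>i. {x \<in> Bi i. act g x j = b})"
    proof (rule suminf_emeasure)
      show "range (\<lambda>i. {x \<in> Bi i. act g x j = b}) \<subseteq> sets \<mu>"
        using inv by (auto simp: inv_set_def intro: sets_act_eq)
      show "disjoint_family (\<lambda>i. {x \<in> Bi i. act g x j = b})"
        by (rule disjoint_family_subset[OF disjoint_family_disjointed[of E]]) (auto simp: Bi_def)
    qed
    also have "(\<Union>i. {x \<in> Bi i. act g x j = b}) = {x \<in> B. act g x j = b}"
      using B(2) UN_disjointed_eq[of E] by (auto simp: Bi_def)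
    finally show ?thesis by simp
  qed
  show "emeasure \<mu> {x \<in> B. act g x j = a} = emeasure \<mu> {x \<in> B. act g x j = a'}"
    unfolding sum using eqd[OF inv sub] unfolding equidistributed_def
    by (intro arg_cong[where f=suminf] ext) blast
qed

end

context kernel_fibres
begin

text \<open>Superlevel sets at rational levels are invariant under \<open>tr N\<close>, hence under
  the shift, and countably many of them separate distinct values.\<close>

lemma inv_fun:
  fixes f :: "(int \<Rightarrow> 'p mod_ring) \<Rightarrow> real"
  assumes [measurable]: "f \<in> borel_measurable borel" and "AE x in \<mu>. f (tr N x) = f x"
  shows "AE x in \<mu>. f (tr 1 x) = f x"
proof -
  have "AE x in \<mu>. f (tr 1 x) > q \<longleftrightarrow> f x > q" for q
  proof -
    have "{x \<in> space borel. f x > q} \<in> sets borel" by measurable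
    then have "inv_set N {x. f x > q}"
      unfolding inv_set_def using assms(2) by auto
    from inv_N[OF this] show ?thesis by (simp add: inv_set_def)
  qed
  then have "AE x in \<mu>. \<forall>q\<in>\<rat>. f (tr 1 x) > q \<longleftrightarrow> f x > q"
    by (subst AE_ball_countable) (auto simp: countable_rat)
  then show ?thesis
  proof eventually_elim
    case (elim x)
    show ?case
    proof (rule linorder_cases[of "f (tr 1 x)" "f x"])
      assume "f (tr 1 x) < f x"
      then obtain q where "q \<in> \<rat>" "f (tr 1 x) < q" "q < f x" using Rats_dense_in_real by blast
      with elim show ?thesis by fastforce
    next
      assume "f (tr 1 x) > f x"
      then obtain q where "q \<in> \<rat>" "f x < q" "q < f (tr 1 x)" using Rats_dense_in_real by blast
      with elim show ?thesis by fastforce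
    qed
  qed
qed

lemma rho_ad_tr:
  assumes "d \<in> D"
  shows "AE x in \<mu>. rho (ad d (tr N x)) = rho (ad d x)"
proof -
  have "AE x in nu. rho (tr N (ad d x)) = rho (ad d x)"
    by (rule AE_nu_ad[OF assms rho_tr])
  then show ?thesis by (intro AE_mu_nu) (simp add: tr_ad period[OF assms])
qed

lemma inv_set_rho: "d \<in> D \<Longrightarrow> inv_set 1 {x. rho (ad d x) > 0}"
proof (rule inv_N)
  assume d: "d \<in> D"
  have "{x \<in> space borel. rho (ad d x) > 0} \<in> sets borel" by measurable
  then show "inv_set N {x. rho (ad d x) > 0}"
    unfolding inv_set_def using rho_ad_tr[OF d] by auto
qed

text \<open>The translate of \<open>B\<close> by \<open>d\<close> carries a density that is again shift invariant, since a power of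
  the shift fixes \<open>d\<close>; but \<open>d\<close> itself is not fixed by the shift.\<close>

lemma translate_distribution:
  assumes d: "d \<in> D" and B [measurable]: "B \<in> sets borel"
    and inv: "\<And>x. tr 1 x \<in> B \<longleftrightarrow> x \<in> B" and pos: "AE x in \<mu>. x \<in> B \<longrightarrow> rho (ad d x) > 0"
  shows "emeasure \<mu> {x \<in> B. act g x j = a} =
         emeasure \<mu> {x \<in> B. act g x j = a - (act g d (j + 1) - act g d j)}"
proof -
  \<comment> \<open>The density, relative to \<open>\<mu>\<close>, of the image under translation by
    \<open>d\<close> of \<open>\<mu>\<close> restricted to \<open>B\<close>. Dividing by
    \<open>rho x\<close> cancels the weight in \<open>transfer\<close>, which \<open>pos\<close>
    permits.\<close>
  define V where "V x = rho (ad (ndeg d) x) * indicator B (ad (ndeg d) x) / rho x" for x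
  have [measurable]: "V \<in> borel_measurable borel" unfolding V_def[abs_def] by measurable
  let ?I = "\<lambda>l b x. indicator {x. act g x l = b} x :: ennreal"
  have I [measurable]: "?I l b \<in> borel_measurable borel" for l b
  proof -
    have "{x. act g x l = b} \<in> sets borel" using sets_act_eq[of UNIV g l b] by simp
    then show ?thesis by (rule borel_measurable_indicator)
  qed
  have alpha: "emeasure \<mu> {x \<in> B. act g x l = b} = (\<integral>\<^sup>+x. ennreal (V x) * ?I l (b + act g d l) x \<partial>\<mu>)" for l b
  proof -
    let ?f = "\<lambda>y. ennreal (indicator B (ad (ndeg d) y) / rho y) * ?I l (b + act g d l) y"
    have [measurable]: "?f \<in> borel_measurable borel" by measurable
    have "emeasure \<mu> {x \<in> B. act g x l = b} = (\<integral>\<^sup>+x. indicator {x \<in> B. act g x l = b} x \<partial>\<mu>)"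
      by (rule nn_integral_indicator[symmetric]) (simp add: sets_act_eq)
    also have "\<dots> = (\<integral>\<^sup>+x. ennreal (rho (ad d x)) * ?f (ad d x) \<partial>\<mu>)"
    proof (rule nn_integral_cong_AE)
      show "AE x in \<mu>. indicator {x \<in> B. act g x l = b} x = ennreal (rho (ad d x)) * ?f (ad d x)"
        using pos
      proof eventually_elim
        case (elim x)
        show ?case
        proof (cases "x \<in> B")
          case True
          then have "rho (ad d x) > 0" using elim by simp
          then have "ennreal (rho (ad d x)) * ennreal (1 / rho (ad d x)) = 1"
            by (subst ennreal_mult[symmetric]) auto
          with True show ?thesis
            by (simp add: act_ad indicator_def)
        qed simp
      qed
    qed
    also have "\<dots> = (\<integral>\<^sup>+x. ennreal (rho (ad (ndeg d) x)) * ?f x \<partial>\<mu>)"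
      by (rule transfer[OF d]) measurable
    also have "\<dots> = (\<integral>\<^sup>+x. ennreal (V x) * ?I l (b + act g d l) x \<partial>\<mu>)"
    proof (rule nn_integral_cong)
      fix x
      have "ennreal (V x) = ennreal (rho (ad (ndeg d) x)) * ennreal (indicator B (ad (ndeg d) x) / rho x)"
        by (subst ennreal_mult[symmetric]) (auto simp: V_def)
      then show "ennreal (rho (ad (ndeg d) x)) * ?f x = ennreal (V x) * ?I l (b + act g d l) x"
        by (simp add: mult.assoc)
    qed
    finally show ?thesis .
  qed
  have "AE x in \<mu>. V (tr N x) = V x"
    using rho_ad_tr[OF ndeg_D[OF d]] rho_ad_tr[OF ker_0, unfolded ad_0]
  proof eventually_elim
    case (elim x)
    have "ad (ndeg d) (tr N x) = tr N (ad (ndeg d) x)"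
      by (simp add: tr_ad period[OF ndeg_D[OF d]])
    then have "indicator B (ad (ndeg d) (tr N x)) = (indicator B (ad (ndeg d) x) :: real)"
      using tr_invariant_all[OF inv] by (simp add: indicator_def)
    then show ?case using elim by (simp add: V_def)
  qed
  then have V1: "AE x in \<mu>. V (tr 1 x) = V x" by (rule inv_fun[rotated]) measurable
  have gamma: "(\<integral>\<^sup>+x. ennreal (V x) * ?I j b x \<partial>\<mu>) = (\<integral>\<^sup>+x. ennreal (V x) * ?I (j + 1) b x \<partial>\<mu>)" for b
  proof -
    have "(\<integral>\<^sup>+x. ennreal (V x) * ?I j b x \<partial>\<mu>) = (\<integral>\<^sup>+x. ennreal (V (tr 1 x)) * ?I j b (tr 1 x) \<partial>\<mu>)"
      by (rule nn_integral_tr[symmetric]) measurable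
    also have "\<dots> = (\<integral>\<^sup>+x. ennreal (V x) * ?I (j + 1) b x \<partial>\<mu>)"
      by (rule nn_integral_cong_AE) (use V1 in eventually_elim, simp add: act_tr indicator_def)
    finally show ?thesis .
  qed
  \<comment> \<open>Going over to the translate at place \<open>j\<close> adds
    \<open>act g d j\<close>; coming back at place \<open>j + 1\<close> subtracts
    \<open>act g d (j + 1)\<close>. Invariance of \<open>B\<close> and \<open>\<mu>\<close> then
    returns to place \<open>j\<close>.\<close>
  have "emeasure \<mu> {x \<in> B. act g x j = a} = (\<integral>\<^sup>+x. ennreal (V x) * ?I (j + 1) (a + act g d j) x \<partial>\<mu>)"
    by (simp only: alpha gamma)
  also have "\<dots> = emeasure \<mu> {x \<in> B. act g x (j + 1) = a + act g d j - act g d (j + 1)}"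
    unfolding alpha by simp
  also have "\<dots> = emeasure \<mu> {x. tr 1 x \<in> {x \<in> B. act g x j = a + act g d j - act g d (j + 1)}}"
    using inv by (simp add: act_tr)
  also have "\<dots> = emeasure \<mu> {x \<in> B. act g x j = a + act g d j - act g d (j + 1)}"
    by (rule emeasure_tr) (simp add: sets_act_eq)
  finally show ?thesis by (simp add: algebra_simps)
qed

text \<open>One nonzero increment \<open>s\<close> suffices, because its multiples exhaust the prime
  field. Strict invariance carries the conclusion from \<open>j0\<close> to every place.\<close>

lemma equidistributed_fibre:
  assumes d: "d \<in> D" and B: "inv_set 1 B" and pos: "B \<subseteq> {x. rho (ad d x) > 0}"
    and nonconst: "act g d (j0 + 1) \<noteq> act g d j0"
  shows "equidistributed B g"
proof -
  obtain B' where B' [measurable]: "B' \<in> sets borel" and inv: "\<And>x. tr 1 x \<in> B' \<longleftrightarrow> x \<in> B'"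
    and AE: "AE x in \<mu>. x \<in> B' \<longleftrightarrow> x \<in> B"
    using inv_set_strict[OF B] by blast
  have pos': "AE x in \<mu>. x \<in> B' \<longrightarrow> rho (ad d x) > 0"
    using AE by eventually_elim (use pos in auto)
  define s where "s = act g d (j0 + 1) - act g d j0"
  have s: "s \<noteq> 0" using nonconst by (simp add: s_def)
  have step: "emeasure \<mu> {x \<in> B'. act g x j0 = a} = emeasure \<mu> {x \<in> B'. act g x j0 = a - of_nat n * s}" for a n
  proof (induction n)
    case (Suc n)
    have "emeasure \<mu> {x \<in> B'. act g x j0 = a - of_nat n * s} =
        emeasure \<mu> {x \<in> B'. act g x j0 = a - of_nat n * s - s}"
      using translate_distribution[OF d B' inv pos', of g j0 "a - of_nat n * s"] by (simp only: s_def)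
    also have "a - of_nat n * s - s = a - of_nat (Suc n) * s" by (simp add: algebra_simps)
    finally show ?case by (rule trans[OF Suc])
  qed simp
  have at_j0: "emeasure \<mu> {x \<in> B'. act g x j0 = a} = emeasure \<mu> {x \<in> B'. act g x j0 = a'}" for a a'
  proof -
    obtain n where "(a - a') / s = of_nat n" using surj_of_nat_mod_ring[of "(a - a') / s"] by blast
    then have "a - a' = of_nat n * s" using s by (simp add: divide_eq_eq)
    then have "a' = a - of_nat n * s" by (metis diff_diff_eq2 diff_add_cancel add_diff_cancel_left')
    then show ?thesis using step[of a n] by (simp only:)
  qed
  have at_j: "emeasure \<mu> {x \<in> B'. act g x j = a} = emeasure \<mu> {x \<in> B'. act g x j0 = a}" for j a
  proof -
    have "emeasure \<mu> {x \<in> B'. act g x j = a} = emeasure \<mu> {x. tr (j - j0) x \<in> {x \<in> B'. act g x j0 = a}}"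
      using tr_invariant_all[OF inv] by (simp add: act_tr)
    also have "\<dots> = emeasure \<mu> {x \<in> B'. act g x j0 = a}"
      by (rule emeasure_tr) (simp add: sets_act_eq)
    finally show ?thesis .
  qed
  have "equidistributed B' g"
    unfolding equidistributed_def
  proof (intro allI)
    fix j a a'
    show "emeasure \<mu> {x \<in> B'. act g x j = a} = emeasure \<mu> {x \<in> B'. act g x j = a'}"
      by (rule trans[OF at_j trans[OF at_j0 at_j[symmetric]]])
  qed
  moreover have "B \<in> sets borel" using B by (simp add: inv_set_def)
  ultimately show ?thesis by (rule equidistributed_AE_eq[OF _ AE _ B'])
qed

end

subsection \<open>Conditional entropy of the fibres\<close>

definition eta :: "real \<Rightarrow> real" where
  "eta t = - t * ln t"

lemma eta_nonneg: "0 \<le> t \<Longrightarrow> t \<le> 1 \<Longrightarrow> 0 \<le> eta t"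
  unfolding eta_def by (rule neg_t_ln_t_nonneg)

lemma eta_le_1: "0 \<le> t \<Longrightarrow> eta t \<le> 1"
  unfolding eta_def using neg_t_ln_t_le[of t] by linarith

lemma eta_measurable [measurable]: "eta \<in> borel_measurable borel"
  unfolding eta_def[abs_def] by measurable

lemma continuous_on_eta: "continuous_on {0..1} eta"
proof (rule continuous_on_eq_continuous_within[THEN iffD2], rule ballI)
  fix t :: real assume t: "t \<in> {0..1}"
  show "continuous (at t within {0..1}) eta"
  proof (cases "t = 0")
    case False
    then show ?thesis using t unfolding eta_def by (intro continuous_intros) auto
  next
    case True
    have "(eta \<longlongrightarrow> 0) (at 0 within {0..1})"
    proof (rule tendsto_sandwich[of "\<lambda>_. 0" _ _ "\<lambda>t. 2 * sqrt t"])
      show "\<forall>\<^sub>F t in at 0 within {0..1}. 0 \<le> eta t"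
        unfolding eventually_at_filter using eta_nonneg by (intro always_eventually) auto
      show "\<forall>\<^sub>F t in at 0 within {0..1}. eta t \<le> 2 * sqrt t"
        unfolding eventually_at_filter eta_def
        using neg_t_ln_t_le_sqrt by (intro always_eventually) auto
      have "((\<lambda>t. 2 * sqrt t) \<longlongrightarrow> 2 * sqrt 0) (at 0 within {0..1})"
        by (intro tendsto_intros)
      then show "((\<lambda>t. 2 * sqrt t) \<longlongrightarrow> 0) (at 0 within {0..1})" by simp
    qed simp
    then show ?thesis using True by (simp add: continuous_within eta_def)
  qed
qed

text \<open>Close pairs are covered by uniform continuity, distant ones by the bound 1 on
  \<open>eta\<close> with \<open>K = 1 / \<delta>\<close>. The affine form can be integrated, so
  arguments close in mean give close entropies although \<open>eta\<close> has infinite slope at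
  0.\<close>

lemma eta_modulus:
  assumes "\<epsilon> > 0"
  shows "\<exists>K>0. \<forall>s\<in>{0..1}. \<forall>t\<in>{0..1}. \<bar>eta s - eta t\<bar> \<le> \<epsilon> + K * \<bar>s - t\<bar>"
proof -
  have "uniformly_continuous_on {0..1} eta"
    by (rule compact_uniformly_continuous[OF continuous_on_eta]) simp
  then obtain \<delta> where \<delta>: "\<delta> > 0"
    "\<And>s t. s \<in> {0..1} \<Longrightarrow> t \<in> {0..1} \<Longrightarrow> dist t s < \<delta> \<Longrightarrow> dist (eta t) (eta s) < \<epsilon>"
    using assms unfolding uniformly_continuous_on_def by metis
  show ?thesis
  proof (intro exI[of _ "1 / \<delta>"] conjI ballI)
    fix s t :: real assume st: "s \<in> {0..1}" "t \<in> {0..1}"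
    show "\<bar>eta s - eta t\<bar> \<le> \<epsilon> + 1 / \<delta> * \<bar>s - t\<bar>"
    proof (cases "\<bar>s - t\<bar> < \<delta>")
      case True
      then have "\<bar>eta s - eta t\<bar> < \<epsilon>" using \<delta>(2)[OF st(2,1)] by (simp add: dist_real_def)
      moreover have "0 \<le> 1 / \<delta> * \<bar>s - t\<bar>" using \<delta>(1) by simp
      ultimately show ?thesis by linarith
    next
      case False
      then have "1 \<le> 1 / \<delta> * \<bar>s - t\<bar>" using \<delta>(1) by (simp add: field_simps)
      moreover have "0 \<le> eta s" "eta s \<le> 1" "0 \<le> eta t" "eta t \<le> 1"
        using st eta_nonneg eta_le_1 by auto
      ultimately show ?thesis using assms by linarith
    qed
  qed (use \<delta> in simp)
qed

lemma integral_determined: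
  fixes \<phi> :: "(int \<Rightarrow> 'a::finite mod_ring) \<Rightarrow> real"
  assumes M: "finite_measure M" "sets M = sets borel" and I: "finite I"
    and det: "\<And>x y. (\<forall>i\<in>I. x i = y i) \<Longrightarrow> \<phi> x = \<phi> y" and \<psi>: "integrable M \<psi>"
  shows "integrable M (\<lambda>x. \<phi> x * \<psi> x)"
    and "(\<integral>x. \<phi> x * \<psi> x \<partial>M) = (\<Sum>w\<in>I \<rightarrow>\<^sub>E UNIV. \<phi> w * (\<integral>x. indicator (cylinder I w) x * \<psi> x \<partial>M))"
proof -
  have eq: "\<phi> x * \<psi> x = (\<Sum>w\<in>I \<rightarrow>\<^sub>E UNIV. \<phi> w * (indicator (cylinder I w) x * \<psi> x))" for x
  proof -
    have "(\<Sum>w\<in>I \<rightarrow>\<^sub>E UNIV. \<phi> w * (indicator (cylinder I w) x * \<psi> x))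
        = (\<Sum>w\<in>{restrict x I}. \<phi> w * (indicator (cylinder I w) x * \<psi> x))"
    proof (rule sum.mono_neutral_right)
      show "\<forall>w\<in>(I \<rightarrow>\<^sub>E UNIV) - {restrict x I}. \<phi> w * (indicator (cylinder I w) x * \<psi> x) = 0"
      proof
        fix w assume w: "w \<in> (I \<rightarrow>\<^sub>E UNIV) - {restrict x I}"
        have "x \<notin> cylinder I w"
        proof
          assume "x \<in> cylinder I w"
          then have "restrict x I = restrict w I" unfolding restrict_eq_iff by (simp add: cylinder_def)
          also have "restrict w I = w" by (rule PiE_restrict[OF DiffD1[OF w]])
          finally show False using w by simp
        qed
        then show "\<phi> w * (indicator (cylinder I w) x * \<psi> x) = 0" by simp
      qed
    qed (use I in auto)
    also have "\<dots> = \<phi> x * \<psi> x"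
    proof -
      have "\<phi> (restrict x I) = \<phi> x" by (rule det) simp
      then show ?thesis by (simp add: cylinder_def)
    qed
    finally show ?thesis by simp
  qed
  have int: "integrable M (\<lambda>x. indicator (cylinder I w) x * \<psi> x)" for w
  proof -
    have "cylinder I w \<in> sets M" using cylinder_measurable[OF I, of w] M by simp
    from integrable_mult_indicator[OF this \<psi>] show ?thesis by simp
  qed
  show "integrable M (\<lambda>x. \<phi> x * \<psi> x)"
    unfolding eq by (intro Bochner_Integration.integrable_sum integrable_mult_right int)
  show "(\<integral>x. \<phi> x * \<psi> x \<partial>M) = (\<Sum>w\<in>I \<rightarrow>\<^sub>E UNIV. \<phi> w * (\<integral>x. indicator (cylinder I w) x * \<psi> x \<partial>M))"
    unfolding eq by (subst Bochner_Integration.integral_sum) (auto intro: int)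
qed

lemma window_approx_integrable:
  fixes f :: "(int \<Rightarrow> 'a::finite mod_ring) \<Rightarrow> real"
  assumes M: "finite_measure M" "sets M = sets borel" and "integrable M f" "\<epsilon> > 0"
  shows "\<exists>m g. (\<forall>x y. (\<forall>i\<in>window m. x i = y i) \<longrightarrow> g x = g y) \<and> integrable M g \<and>
    (\<integral>x. \<bar>f x - g x\<bar> \<partial>M) < \<epsilon>"
  using assms(3,4)
proof (induction arbitrary: \<epsilon> rule: integrable_induct)
  case (base A c)
  interpret finite_measure M by fact
  have A: "A \<in> sets borel" using base M by simp
  obtain n B where B: "determined (window n) B" "measure M (sym_diff A B) < \<epsilon> / (\<bar>c\<bar> + 1)"
    using window_approx[OF M A, of "\<epsilon> / (\<bar>c\<bar> + 1)"] base.prems by auto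
  have BM: "B \<in> sets M" using determined_measurable[OF finite_window B(1)] M by simp
  let ?g = "\<lambda>x. indicator B x *\<^sub>R c"
  have "?g x = ?g y" if "\<forall>i\<in>window n. x i = y i" for x y
  proof -
    have "\<forall>i\<in>window n. y i = x i" using that by simp
    with B(1) that have "x \<in> B \<longleftrightarrow> y \<in> B" unfolding determined_def by blast
    then show ?thesis by (simp add: indicator_def)
  qed
  moreover have "integrable M ?g" using BM by (simp add: emeasure_eq_measure)
  moreover have "(\<integral>x. \<bar>indicator A x *\<^sub>R c - ?g x\<bar> \<partial>M) < \<epsilon>"
  proof -
    have "(\<integral>x. \<bar>indicator A x *\<^sub>R c - ?g x\<bar> \<partial>M) = (\<integral>x. \<bar>c\<bar> * indicator (sym_diff A B) x \<partial>M)"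
      by (intro Bochner_Integration.integral_cong) (auto simp: indicator_def)
    also have "\<dots> = \<bar>c\<bar> * measure M (sym_diff A B)"
      using BM base(1) by simp
    also have "\<dots> \<le> (\<bar>c\<bar> + 1) * measure M (sym_diff A B)" by (intro mult_right_mono) auto
    also have "\<dots> < \<epsilon>" using B(2) by (simp add: pos_less_divide_eq mult.commute)
    finally show ?thesis .
  qed
  ultimately show ?case by (intro exI[of _ n] exI[of _ ?g] conjI allI impI)
next
  case (add f f')
  obtain m g m' g' where g: "\<forall>x y. (\<forall>i\<in>window m. x i = y i) \<longrightarrow> g x = g y" "integrable M g"
      "(\<integral>x. \<bar>f x - g x\<bar> \<partial>M) < \<epsilon> / 2"
    and g': "\<forall>x y. (\<forall>i\<in>window m'. x i = y i) \<longrightarrow> g' x = g' y" "integrable M g'"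
      "(\<integral>x. \<bar>f' x - g' x\<bar> \<partial>M) < \<epsilon> / 2"
    using add.IH[of "\<epsilon> / 2"] add.prems by auto
  have "window m \<subseteq> window (max m m')" "window m' \<subseteq> window (max m m')" by (auto simp: window_def)
  then have "g x + g' x = g y + g' y" if "\<forall>i\<in>window (max m m'). x i = y i" for x y
    using g(1)[rule_format, of x y] g'(1)[rule_format, of x y] that by fastforce
  moreover have "(\<integral>x. \<bar>(f x + f' x) - (g x + g' x)\<bar> \<partial>M) \<le> (\<integral>x. \<bar>f x - g x\<bar> + \<bar>f' x - g' x\<bar> \<partial>M)"
    using add.hyps g(2) g'(2) by (intro integral_mono) auto
  then have "(\<integral>x. \<bar>(f x + f' x) - (g x + g' x)\<bar> \<partial>M) < \<epsilon>"
    using add.hyps g(2,3) g'(2,3) by simp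
  ultimately show ?case using g(2) g'(2) by (intro exI[of _ "max m m'"] exI[of _ "\<lambda>x. g x + g' x"]) simp
next
  case (lim f s)
  have "(\<lambda>i. \<integral>x. \<bar>f x - s i x\<bar> \<partial>M) \<longlonglongrightarrow> (\<integral>x. 0 \<partial>M)"
  proof (rule integral_dominated_convergence[where w="\<lambda>x. 3 * \<bar>f x\<bar>"])
    show "AE x in M. (\<lambda>i. \<bar>f x - s i x\<bar>) \<longlonglongrightarrow> 0"
    proof (rule AE_I2)
      fix x assume "x \<in> space M"
      then have "(\<lambda>i. \<bar>f x - s i x\<bar>) \<longlonglongrightarrow> \<bar>f x - f x\<bar>" by (intro tendsto_intros lim.hyps(2))
      then show "(\<lambda>i. \<bar>f x - s i x\<bar>) \<longlonglongrightarrow> 0" by simp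
    qed
    show "AE x in M. norm \<bar>f x - s i x\<bar> \<le> 3 * \<bar>f x\<bar>" for i
    proof (rule AE_I2)
      fix x assume "x \<in> space M"
      from lim.hyps(3)[OF this, of i] show "norm \<bar>f x - s i x\<bar> \<le> 3 * \<bar>f x\<bar>" by simp
    qed
  qed (use lim.hyps in auto)
  then have "\<forall>\<^sub>F i in sequentially. (\<integral>x. \<bar>f x - s i x\<bar> \<partial>M) < \<epsilon> / 2"
    using lim.prems by (intro order_tendstoD) auto
  then obtain i where i: "(\<integral>x. \<bar>f x - s i x\<bar> \<partial>M) < \<epsilon> / 2"
    using eventually_happens'[OF sequentially_bot] by blast
  obtain m g where g: "\<forall>x y. (\<forall>i\<in>window m. x i = y i) \<longrightarrow> g x = g y" "integrable M g"
      "(\<integral>x. \<bar>s i x - g x\<bar> \<partial>M) < \<epsilon> / 2"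
    using lim.IH[of "\<epsilon> / 2" i] lim.prems by auto
  have "(\<integral>x. \<bar>f x - g x\<bar> \<partial>M) \<le> (\<integral>x. \<bar>f x - s i x\<bar> + \<bar>s i x - g x\<bar> \<partial>M)"
    using lim.hyps(1,4) g(2) by (intro integral_mono) auto
  also have "\<dots> < \<epsilon>" using lim.hyps(1,4) g(2,3) i by simp
  finally show ?case using g(1,2) by blast
qed

context kernel_fibres
begin

sublocale nu: finite_measure nu
  by (rule finite_measure_nu)

lemma integrable_nu_bounded:
  fixes f :: "_ \<Rightarrow> real"
  assumes "f \<in> borel_measurable borel" "\<And>x. \<bar>f x\<bar> \<le> C"
  shows "integrable nu f"
  by (rule nu.integrable_const_bound[of _ C]) (use assms in \<open>auto cong: measurable_cong_sets\<close>)

lemma integral_rho: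
  assumes A: "A \<in> sets borel"
  shows "(\<integral>x. indicator A x * rho x \<partial>nu) = prob A"
proof -
  have "ennreal (prob A) = (\<integral>\<^sup>+x. indicator A x \<partial>\<mu>)"
    using A by (simp add: emeasure_eq_measure)
  also have "\<dots> = (\<integral>\<^sup>+x. ennreal (rho x) * indicator A x \<partial>nu)"
    using A by (intro nn_integral_mu) simp
  also have "\<dots> = (\<integral>\<^sup>+x. ennreal (indicator A x * rho x) \<partial>nu)"
    by (intro nn_integral_cong) (auto simp: indicator_def)
  also have "\<dots> = ennreal (\<integral>x. indicator A x * rho x \<partial>nu)"
  proof (rule nn_integral_eq_integral)
    show "integrable nu (\<lambda>x. indicator A x * rho x)"
      by (rule integrable_nu_bounded[of _ 1])
        (use A rho_le_1 in \<open>auto simp: indicator_def\<close>)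
  qed simp
  finally show ?thesis by (subst (asm) ennreal_inj) auto
qed

section \<open>Finite windows and the entropy of the fibres\<close>

text \<open>The conditional mean of \<open>rho\<close> under \<open>nu\<close> given the window
  \<open>I\<close>; it is 0 on cylinders that are null for \<open>nu\<close>.\<close>

definition rwin :: "int set \<Rightarrow> (int \<Rightarrow> 'p mod_ring) \<Rightarrow> real" where
  "rwin I x = prob (cylinder I x) / measure nu (cylinder I x)"

lemma prob_le_nu: "A \<in> sets borel \<Longrightarrow> prob A \<le> measure nu A"
  using mu_le_nu[of A] by (simp add: emeasure_eq_measure nu.emeasure_eq_measure)

lemma rwin_bounds: "finite I \<Longrightarrow> 0 \<le> rwin I x" "finite I \<Longrightarrow> rwin I x \<le> 1"
  using prob_le_nu[OF cylinder_measurable[of I x]]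
  by (auto simp: rwin_def divide_le_eq_1 zero_less_measure_iff measure_nonneg)

lemma rwin_cong: "\<forall>i\<in>I. x i = y i \<Longrightarrow> rwin I x = rwin I y"
proof -
  assume "\<forall>i\<in>I. x i = y i"
  then have "cylinder I x = cylinder I y" by (auto simp: cylinder_def)
  then show ?thesis by (simp add: rwin_def)
qed

text \<open>Averaging over cylinders does not increase the mean distance to a function of the
  window. So \<open>rwin I\<close> is as close as \<open>rho\<close> to a local approximation
  \<open>g\<close>, and \<open>eta_modulus\<close> passes this on to the entropies, in place of
  martingale convergence.\<close>

lemma rwin_entropy_limit:
  assumes "\<epsilon> > 0"
  shows "\<exists>m. \<forall>I. finite I \<longrightarrow> window m \<subseteq> I \<longrightarrow>
    (\<Sum>w\<in>I \<rightarrow>\<^sub>E UNIV. measure nu (cylinder I w) * eta (rwin I w)) \<le> (\<integral>x. eta (rho x) \<partial>nu) + \<epsilon>"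
proof -
  let ?n = "measure nu UNIV"
  \<comment> \<open>The term \<open>\<epsilon>' * ?n\<close> uses at most half of
    \<open>\<epsilon>\<close>. The distances of \<open>rwin I\<close> and \<open>rho\<close> to
    \<open>g\<close>, each below \<open>\<epsilon> / (4 * K)\<close>, use the other half after
    multiplication by \<open>K\<close>.\<close>
  define \<epsilon>' where "\<epsilon>' = \<epsilon> / 2 / (?n + 1)"
  have n: "?n + 1 > 0" by (simp add: add_nonneg_pos)
  have \<epsilon>': "\<epsilon>' > 0" using assms n by (simp add: \<epsilon>'_def)
  obtain K where K: "K > 0"
    "\<And>s t. s \<in> {0..1} \<Longrightarrow> t \<in> {0..1} \<Longrightarrow> \<bar>eta s - eta t\<bar> \<le> \<epsilon>' + K * \<bar>s - t\<bar>"
    using eta_modulus[OF \<epsilon>'] by blast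
  have rho_int: "integrable nu rho"
    by (rule integrable_nu_bounded[of _ 1]) (use rho_le_1 in auto)
  obtain m g where g: "\<And>x y. (\<forall>i\<in>window m. x i = y i) \<Longrightarrow> g x = g y" and
    g_int: "integrable nu g" and gi: "(\<integral>x. \<bar>rho x - g x\<bar> \<partial>nu) < \<epsilon> / (4 * K)"
    using window_approx_integrable[OF finite_measure_nu sets_nu rho_int, of "\<epsilon> / (4 * K)"] assms K(1) by auto
  show ?thesis
  proof (intro exI[of _ m] allI impI)
    fix I assume I: "finite I" "window m \<subseteq> I"
    let ?A = "\<integral>x. \<bar>rwin I x - g x\<bar> \<partial>nu" and ?B = "\<integral>x. \<bar>rho x - g x\<bar> \<partial>nu"
    note det = integral_determined[OF finite_measure_nu sets_nu I(1)]
    have one: "integrable nu (\<lambda>_. 1 :: real)" by simp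
    have gI: "g x = g y" if "\<forall>i\<in>I. x i = y i" for x y using g I(2) that by blast
    note cyl = cylinder_measurable[OF I(1)]
    have rg_int: "integrable nu (\<lambda>x. \<bar>rho x - g x\<bar>)" using rho_int g_int by simp
    have sg: "\<bar>rwin I x - g x\<bar> = \<bar>rwin I y - g y\<bar>" if "\<forall>i\<in>I. x i = y i" for x y
      using gI[OF that] rwin_cong[OF that] by simp
    have sg_int: "integrable nu (\<lambda>x. \<bar>rwin I x - g x\<bar>)"
      using det(1)[of "\<lambda>x. \<bar>rwin I x - g x\<bar>" "\<lambda>_. 1", OF sg one] by simp
    have "?A = (\<integral>x. \<bar>rwin I x - g x\<bar> * 1 \<partial>nu)" by simp
    also have "\<dots> = (\<Sum>w\<in>I \<rightarrow>\<^sub>E UNIV. \<bar>rwin I w - g w\<bar> * (\<integral>x. indicator (cylinder I w) x * 1 \<partial>nu))"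
      by (rule det(2)[OF sg one])
    also have "\<dots> \<le> (\<Sum>w\<in>I \<rightarrow>\<^sub>E UNIV. \<integral>x. indicator (cylinder I w) x * \<bar>rho x - g x\<bar> \<partial>nu)"
    proof (rule sum_mono)
      fix w :: "int \<Rightarrow> 'p mod_ring"
      let ?C = "cylinder I w"
      have "\<bar>rwin I w - g w\<bar> * (\<integral>x. indicator ?C x * 1 \<partial>nu) = \<bar>rwin I w - g w\<bar> * measure nu ?C"
        using cyl by simp
      also have "\<dots> = \<bar>rwin I w * measure nu ?C - g w * measure nu ?C\<bar>"
        by (simp add: abs_mult flip: left_diff_distrib)
      \<comment> \<open>This includes cylinders that are null for \<open>nu\<close>, since they are
        null for \<open>\<mu>\<close> too.\<close>
      also have "rwin I w * measure nu ?C = prob ?C"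
        using prob_le_nu[OF cyl, of w] by (auto simp: rwin_def intro!: antisym)
      also have "prob ?C - g w * measure nu ?C = (\<integral>x. indicator ?C x * (rho x - g x) \<partial>nu)"
      proof -
        have [measurable]: "?C \<in> sets borel" by (rule cyl)
        have i1: "integrable nu (\<lambda>x. indicator ?C x * rho x)"
        proof (rule integrable_nu_bounded[of _ 1])
          show "\<bar>indicator ?C x * rho x\<bar> \<le> 1" for x
            using rho_le_1[of x] by (simp add: indicator_def)
        qed measurable
        have i2: "integrable nu (\<lambda>x. indicator ?C x * g w)"
        proof (rule integrable_nu_bounded[of _ "\<bar>g w\<bar>"])
          show "\<bar>indicator ?C x * g w\<bar> \<le> \<bar>g w\<bar>" for x by (simp add: indicator_def)
        qed measurable
        have "(\<integral>x. indicator ?C x * (rho x - g x) \<partial>nu) = (\<integral>x. indicator ?C x * rho x - indicator ?C x * g w \<partial>nu)"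
        proof (intro Bochner_Integration.integral_cong refl)
          fix x
          have "g x = g w" if "x \<in> ?C" using that by (intro gI) (simp add: cylinder_def)
          then show "indicator ?C x * (rho x - g x) = indicator ?C x * rho x - indicator ?C x * g w"
            by (cases "x \<in> ?C") simp_all
        qed
        also have "\<dots> = (\<integral>x. indicator ?C x * rho x \<partial>nu) - (\<integral>x. indicator ?C x * g w \<partial>nu)"
          by (rule Bochner_Integration.integral_diff[OF i1 i2])
        also have "(\<integral>x. indicator ?C x * g w \<partial>nu) = g w * measure nu ?C"
          using cyl by simp
        also have "(\<integral>x. indicator ?C x * rho x \<partial>nu) = prob ?C"
          by (rule integral_rho[OF cyl])
        finally show ?thesis by simp
      qed
      also have "\<bar>\<integral>x. indicator ?C x * (rho x - g x) \<partial>nu\<bar> \<le> (\<integral>x. \<bar>indicator ?C x * (rho x - g x)\<bar> \<partial>nu)"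
        by (rule integral_abs_bound)
      also have "\<dots> = (\<integral>x. indicator ?C x * \<bar>rho x - g x\<bar> \<partial>nu)"
        by (simp add: abs_mult)
      finally show "\<bar>rwin I w - g w\<bar> * (\<integral>x. indicator ?C x * 1 \<partial>nu)
          \<le> (\<integral>x. indicator ?C x * \<bar>rho x - g x\<bar> \<partial>nu)" .
    qed
    also have "\<dots> = ?B"
      using det(2)[of "\<lambda>_. 1" "\<lambda>x. \<bar>rho x - g x\<bar>", OF refl rg_int] by simp
    finally have sg_le: "?A \<le> ?B" .
    have seta: "eta (rwin I x) = eta (rwin I y)" if "\<forall>i\<in>I. x i = y i" for x y
      using rwin_cong[OF that] by simp
    have eta_rho_int: "integrable nu (\<lambda>x. eta (rho x))"
    proof (rule integrable_nu_bounded[of _ 1])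
      show "\<bar>eta (rho x)\<bar> \<le> 1" for x
        using eta_nonneg[OF rho_nonneg rho_le_1] eta_le_1[OF rho_nonneg] by simp
    qed measurable
    have "(\<Sum>w\<in>I \<rightarrow>\<^sub>E UNIV. measure nu (cylinder I w) * eta (rwin I w)) = (\<integral>x. eta (rwin I x) * 1 \<partial>nu)"
      using det(2)[of "\<lambda>x. eta (rwin I x)" "\<lambda>_. 1", OF seta one] cyl by (simp add: mult.commute)
    also have "\<dots> \<le> (\<integral>x. eta (rho x) + (\<epsilon>' + K * (\<bar>rwin I x - g x\<bar> + \<bar>rho x - g x\<bar>)) \<partial>nu)"
    proof (rule integral_mono)
      show "integrable nu (\<lambda>x. eta (rwin I x) * 1)"
        by (rule det(1)[OF seta one])
      show "integrable nu (\<lambda>x. eta (rho x) + (\<epsilon>' + K * (\<bar>rwin I x - g x\<bar> + \<bar>rho x - g x\<bar>)))"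
        using eta_rho_int sg_int rg_int by simp
      fix x
      have "eta (rwin I x) - eta (rho x) \<le> \<epsilon>' + K * \<bar>rwin I x - rho x\<bar>"
        using K(2)[of "rwin I x" "rho x"] rwin_bounds[OF I(1), of x] rho_le_1[of x] by simp
      also have "\<dots> \<le> \<epsilon>' + K * (\<bar>rwin I x - g x\<bar> + \<bar>rho x - g x\<bar>)"
        using K(1) by (intro add_left_mono mult_left_mono) auto
      finally show "eta (rwin I x) * 1 \<le> eta (rho x) + (\<epsilon>' + K * (\<bar>rwin I x - g x\<bar> + \<bar>rho x - g x\<bar>))"
        by simp
    qed
    also have "\<dots> = (\<integral>x. eta (rho x) \<partial>nu) + (\<epsilon>' * ?n + K * (?A + ?B))"
      using eta_rho_int sg_int rg_int by (simp add: mult.commute)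
    also have "\<dots> \<le> (\<integral>x. eta (rho x) \<partial>nu) + \<epsilon>"
    proof -
      have "K * (?A + ?B) \<le> K * (\<epsilon> / (4 * K) + \<epsilon> / (4 * K))"
        using sg_le gi K(1) by (intro mult_left_mono add_mono) auto
      also have "\<dots> = \<epsilon> / 2" using K(1) by simp
      finally have "K * (?A + ?B) \<le> \<epsilon> / 2" .
      moreover have "\<epsilon>' * ?n \<le> \<epsilon>' * (?n + 1)" using \<epsilon>' by simp
      moreover have "\<epsilon>' * (?n + 1) = \<epsilon> / 2"
        unfolding \<epsilon>'_def using n by (subst times_divide_eq_left) (rule nonzero_mult_div_cancel_right, linarith)
      ultimately show ?thesis by simp
    qed
    finally show "(\<Sum>w\<in>I \<rightarrow>\<^sub>E UNIV. measure nu (cylinder I w) * eta (rwin I w)) \<le> (\<integral>x. eta (rho x) \<partial>nu) + \<epsilon>" .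
  qed
qed

text \<open>The kernel translates of the cylinder are disjoint, as \<open>degree c\<close> places
  tell kernel elements apart, and together they fill the preimage of the image cylinder;
  \<open>act c\<close> preserves \<open>\<mu>\<close>.\<close>

lemma nu_cylinder:
  assumes "a \<le> b"
  shows "measure nu (cylinder {a..<b + int (degree c)} w) = prob (cylinder {a..<b} (act c w))"
proof -
  let ?I = "{a..<b + int (degree c)}" and ?J = "{a..<b}"
  have C: "cylinder ?I w \<in> sets borel" by (rule cylinder_measurable) simp
  have dis: "disjoint_family_on (\<lambda>d. {x. ad d x \<in> cylinder ?I w}) D"
    unfolding disjoint_family_on_def
  proof (intro ballI impI)
    fix d d' assume d: "d \<in> D" "d' \<in> D" "d \<noteq> d'"
    show "{x. ad d x \<in> cylinder ?I w} \<inter> {x. ad d' x \<in> cylinder ?I w} = {}"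
    proof (rule ccontr)
      assume "\<not> ?thesis"
      then obtain x where x: "\<forall>i\<in>?I. x i + d i = w i" "\<forall>i\<in>?I. x i + d' i = w i"
        by (auto simp: cylinder_def ad_def)
      have "d = d'"
      proof (rule ker_eqI[OF c0 d(1,2), of a])
        fix i assume "a \<le> i" "i < a + int (degree c)"
        then have "i \<in> ?I" using assms by simp
        from bspec[OF x(1) this] bspec[OF x(2) this] show "d i = d' i" by (metis add_left_cancel)
      qed
      with d(3) show False by simp
    qed
  qed
  have un: "(\<Union>d\<in>D. {x. ad d x \<in> cylinder ?I w}) = {x. act c x \<in> cylinder ?J (act c w)}"
  proof (rule Set.set_eqI)
    fix x
    have "x \<in> (\<Union>d\<in>D. {x. ad d x \<in> cylinder ?I w}) \<longleftrightarrow> (\<exists>d\<in>D. \<forall>i\<in>?I. x i + d i = w i)"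
      by (auto simp: cylinder_def ad_def)
    also have "\<dots> \<longleftrightarrow> (\<exists>d\<in>D. \<forall>i\<in>?I. w i = x i + d i)"
      by (intro bex_cong ball_cong refl eq_commute)
    also have "\<dots> \<longleftrightarrow> (\<forall>i\<in>?J. act c w i = act c x i)"
      by (rule act_eq_on_iff[OF c0 assms, symmetric])
    also have "\<dots> \<longleftrightarrow> x \<in> {x. act c x \<in> cylinder ?J (act c w)}"
      by (auto simp: cylinder_def)
    finally show "x \<in> (\<Union>d\<in>D. {x. ad d x \<in> cylinder ?I w}) \<longleftrightarrow> x \<in> {x. act c x \<in> cylinder ?J (act c w)}" .
  qed
  have "emeasure nu (cylinder ?I w) = (\<Sum>d\<in>D. emeasure \<mu> {x. ad d x \<in> cylinder ?I w})"
    by (rule emeasure_nu[OF C])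
  also have "\<dots> = emeasure \<mu> (\<Union>d\<in>D. {x. ad d x \<in> cylinder ?I w})"
  proof (rule sum_emeasure[OF _ dis])
    have "ad d -` cylinder ?I w \<in> sets borel" for d
      using measurable_sets[OF measurable_ad C] by simp
    then show "(\<lambda>d. {x. ad d x \<in> cylinder ?I w}) ` D \<subseteq> sets \<mu>"
      by (auto simp: vimage_def)
  qed simp
  also have "\<dots> = emeasure (distr \<mu> borel (act c)) (cylinder ?J (act c w))"
    unfolding un by (subst emeasure_distr) (auto simp: vimage_def intro: cylinder_measurable)
  also have "\<dots> = emeasure \<mu> (cylinder ?J (act c w))" by (simp only: distr_act)
  finally show ?thesis by (simp add: measure_def)
qed

text \<open>By \<open>nu_cylinder\<close>, \<open>rwin\<close> is the conditional probability of a
  word given its image, so the sum is the conditional entropy of a window given its image window.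
  The latter has entropy \<open>H n\<close> because \<open>act c\<close> preserves
  \<open>\<mu>\<close>. The free left end \<open>a\<close> lets the window cover any given
  one.\<close>

lemma entropy_difference:
  "H (n + degree c) - H n =
    (\<Sum>w\<in>{a..<a + int (n + degree c)} \<rightarrow>\<^sub>E UNIV.
      measure nu (cylinder {a..<a + int (n + degree c)} w) * eta (rwin {a..<a + int (n + degree c)} w))"
proof -
  let ?I = "{a..<a + int (n + degree c)}" and ?J = "{a..<a + int n}"
  let ?C = "cylinder ?I" and ?E = "cylinder ?J"
  let ?G = "\<lambda>w. restrict (act c w) ?J"
  have I: "?I = {a..<(a + int n) + int (degree c)}" by (simp add: add.assoc)
  have nu: "measure nu (?C w) = prob (?E (?G w))" for w
  proof -
    have "?E (act c w) = ?E (?G w)" by (auto simp: cylinder_def)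
    then show ?thesis using nu_cylinder[of a "a + int n" w] unfolding I by simp
  qed
  have term_eq: "measure nu (?C w) * eta (rwin ?I w) =
      - prob (?C w) * ln (prob (?C w)) + prob (?C w) * ln (prob (?E (?G w)))" for w
  proof (cases "prob (?C w) = 0")
    case True
    then show ?thesis by (simp add: rwin_def eta_def)
  next
    case False
    then have p: "prob (?C w) > 0" by (simp add: zero_less_measure_iff)
    then have n: "measure nu (?C w) > 0"
      using prob_le_nu[OF cylinder_measurable[of ?I w]] by simp
    have "measure nu (?C w) * eta (rwin ?I w) = - prob (?C w) * ln (prob (?C w) / measure nu (?C w))"
      using n by (simp add: rwin_def eta_def)
    also have "ln (prob (?C w) / measure nu (?C w)) = ln (prob (?C w)) - ln (measure nu (?C w))"
      using p n by (simp add: ln_div)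
    finally show ?thesis unfolding nu[symmetric] by (simp add: algebra_simps)
  qed
  have fibre: "(\<Sum>w\<in>{w \<in> ?I \<rightarrow>\<^sub>E UNIV. ?G w = v}. prob (?C w)) = prob (?E v)" if v: "v \<in> ?J \<rightarrow>\<^sub>E UNIV" for v
  proof -
    let ?W = "{w \<in> ?I \<rightarrow>\<^sub>E UNIV. ?G w = v}"
    have "?G (restrict x ?I) = ?G x" for x
      by (rule restrict_ext, rule act_cong) auto
    then have "{x. ?G (restrict x ?I) = v} = {x. act c x \<in> ?E v}"
      using restrict_eq_iff_cylinder[OF v] by auto
    then have "(\<Sum>w\<in>?W. prob (?C w)) = prob {x. act c x \<in> ?E v}"
      using measure_words[OF finite_measure_axioms sets_eq, of ?I "\<lambda>w. ?G w = v"] by (simp only: finite_atLeastLessThan_int)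
    also have "\<dots> = measure (distr \<mu> borel (act c)) (?E v)"
      by (subst measure_distr) (auto simp: vimage_def intro: cylinder_measurable)
    also have "\<dots> = prob (?E v)" by (simp only: distr_act)
    finally show ?thesis .
  qed
  have "(\<Sum>w\<in>?I \<rightarrow>\<^sub>E UNIV. prob (?C w) * ln (prob (?E (?G w))))
      = (\<Sum>v\<in>?J \<rightarrow>\<^sub>E UNIV. \<Sum>w\<in>{w \<in> ?I \<rightarrow>\<^sub>E UNIV. ?G w = v}. prob (?C w) * ln (prob (?E (?G w))))"
    by (rule sum.group[symmetric]) auto
  also have "\<dots> = (\<Sum>v\<in>?J \<rightarrow>\<^sub>E UNIV. prob (?E v) * ln (prob (?E v)))"
  proof (rule sum.cong[OF refl])
    fix v :: "int \<Rightarrow> 'p mod_ring" assume v: "v \<in> ?J \<rightarrow>\<^sub>E UNIV"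
    let ?W = "{w \<in> ?I \<rightarrow>\<^sub>E UNIV. ?G w = v}"
    have "(\<Sum>w\<in>?W. prob (?C w) * ln (prob (?E (?G w)))) = (\<Sum>w\<in>?W. prob (?C w) * ln (prob (?E v)))"
      by (intro sum.cong refl) simp
    also have "\<dots> = (\<Sum>w\<in>?W. prob (?C w)) * ln (prob (?E v))"
      by (rule sum_distrib_right[symmetric])
    also have "\<dots> = prob (?E v) * ln (prob (?E v))" by (simp only: fibre[OF v])
    finally show "(\<Sum>w\<in>?W. prob (?C w) * ln (prob (?E (?G w)))) = prob (?E v) * ln (prob (?E v))" .
  qed
  also have "\<dots> = - went ?J"
    by (simp add: went_eq sum_negf)
  also have "went ?J = H n" by (rule went_interval)
  finally have 1: "(\<Sum>w\<in>?I \<rightarrow>\<^sub>E UNIV. prob (?C w) * ln (prob (?E (?G w)))) = - H n" .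
  have 2: "(\<Sum>w\<in>?I \<rightarrow>\<^sub>E UNIV. - prob (?C w) * ln (prob (?C w))) = H (n + degree c)"
    by (subst went_eq[symmetric]) (simp_all only: went_interval finite_atLeastLessThan_int)
  show ?thesis
    unfolding term_eq sum.distrib 1 2 by simp
qed

definition fibre_support :: "(int \<Rightarrow> 'p mod_ring) \<Rightarrow> (int \<Rightarrow> 'p mod_ring) set" where
  "fibre_support x = {d \<in> D. rho (ad d x) > 0}"

lemma sets_fibre_support: "{x. L < card (fibre_support x)} \<in> sets borel"
proof -
  have eq: "real (card (fibre_support x)) = (\<Sum>d\<in>D. if rho (ad d x) > 0 then 1 else 0)" for x
    by (simp add: fibre_support_def sum.If_cases Int_def)
  have "{x \<in> space borel. real L < (\<Sum>d\<in>D. if rho (ad d x) > 0 then 1 else 0)} \<in> sets borel"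
    by measurable
  then show ?thesis by (simp flip: eq)
qed

text \<open>Gibbs' inequality against the uniform distribution on the support, from
  \<open>ln u \<le> u - 1\<close> at \<open>u = 1 / (?t * M)\<close>.\<close>

lemma sum_eta_le:
  assumes "(\<Sum>d\<in>D. rho (ad d x)) = 1"
  shows "fibre_support x \<noteq> {}" "(\<Sum>d\<in>D. eta (rho (ad d x))) \<le> ln (real (card (fibre_support x)))"
proof -
  let ?S = "fibre_support x"
  have fin: "finite ?S" by (simp add: fibre_support_def)
  have zero: "rho (ad d x) = 0" if "d \<in> D - ?S" for d
    using that rho_nonneg[of "ad d x"] by (auto simp: fibre_support_def)
  have sum1: "(\<Sum>d\<in>?S. rho (ad d x)) = 1"
    unfolding assms[symmetric] by (rule sum.mono_neutral_left) (use zero in \<open>auto simp: fibre_support_def\<close>)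
  then show ne: "?S \<noteq> {}" by auto
  define M where "M = real (card ?S)"
  have M: "M > 0" using ne fin by (simp add: M_def card_gt_0_iff)
  have "(\<Sum>d\<in>D. eta (rho (ad d x))) = (\<Sum>d\<in>?S. eta (rho (ad d x)))"
    by (rule sum.mono_neutral_right) (use zero in \<open>auto simp: fibre_support_def eta_def\<close>)
  also have "\<dots> \<le> (\<Sum>d\<in>?S. rho (ad d x) * ln M + (1 / M - rho (ad d x)))"
  proof (rule sum_mono)
    fix d assume "d \<in> ?S"
    then have t: "rho (ad d x) > 0" by (simp add: fibre_support_def)
    let ?t = "rho (ad d x)"
    have "ln (1 / (?t * M)) \<le> 1 / (?t * M) - 1" using t M by (intro ln_le_minus_one) simp
    then have "?t * ln (1 / (?t * M)) \<le> ?t * (1 / (?t * M) - 1)" using t by (intro mult_left_mono) auto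
    moreover have "ln (1 / (?t * M)) = - ln ?t - ln M" using t M by (simp add: ln_div ln_mult)
    moreover have "?t * (1 / (?t * M) - 1) = 1 / M - ?t" using t M by (simp add: right_diff_distrib)
    ultimately have "?t * (- ln ?t - ln M) \<le> 1 / M - ?t" by simp
    then show "eta ?t \<le> ?t * ln M + (1 / M - ?t)" by (simp add: eta_def algebra_simps)
  qed
  also have "\<dots> = (\<Sum>d\<in>?S. rho (ad d x)) * ln M + (M * (1 / M) - (\<Sum>d\<in>?S. rho (ad d x)))"
    by (simp add: sum.distrib sum_subtractf sum_distrib_right M_def)
  also have "\<dots> = ln M" using M by (simp add: sum1)
  finally show "(\<Sum>d\<in>D. eta (rho (ad d x))) \<le> ln (real (card ?S))" by (simp add: M_def)
qed

text \<open>Off the exceptional set a fibre has entropy at most \<open>ln L\<close>; on it the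
  logarithm of the kernel size is a bound.\<close>

lemma integral_eta_rho_le:
  assumes L: "L \<ge> 1"
  shows "(\<integral>x. eta (rho x) \<partial>nu) \<le>
    ln (real L) + real (degree c) * ln (real CARD('p)) * prob {x. L < card (fibre_support x)}"
proof -
  let ?G = "{x. L < card (fibre_support x)}"
  let ?b = "real (degree c) * ln (real CARD('p))"
  have p: "real CARD('p) \<ge> 1" by (simp add: Suc_leI)
  have b: "?b \<ge> 0" using p by simp
  have lnL: "ln (real L) \<ge> 0" using L by simp
  have G: "?G \<in> sets borel" by (rule sets_fibre_support)
  have eta_rho_int: "integrable nu (\<lambda>x. eta (rho x))"
  proof (rule integrable_nu_bounded[of _ 1])
    show "\<bar>eta (rho x)\<bar> \<le> 1" for x
      using eta_nonneg[OF rho_nonneg rho_le_1] eta_le_1[OF rho_nonneg] by simp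
  qed measurable
  have "ennreal (\<integral>x. eta (rho x) \<partial>nu) = (\<integral>\<^sup>+x. ennreal (eta (rho x)) \<partial>nu)"
    by (rule nn_integral_eq_integral[symmetric, OF eta_rho_int])
      (simp add: eta_nonneg rho_le_1)
  also have "\<dots> = (\<Sum>d\<in>D. \<integral>\<^sup>+x. ennreal (eta (rho (ad d x))) \<partial>\<mu>)"
    by (rule nn_integral_nu) measurable
  also have "\<dots> = (\<integral>\<^sup>+x. (\<Sum>d\<in>D. ennreal (eta (rho (ad d x)))) \<partial>\<mu>)"
    by (rule nn_integral_sum[symmetric]) measurable
  also have "\<dots> \<le> (\<integral>\<^sup>+x. ennreal (ln (real L) + ?b * indicator ?G x) \<partial>\<mu>)"
  proof (rule nn_integral_mono_AE)
    show "AE x in \<mu>. (\<Sum>d\<in>D. ennreal (eta (rho (ad d x)))) \<le> ennreal (ln (real L) + ?b * indicator ?G x)"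
      using AE_mu_nu[OF sum_rho]
    proof eventually_elim
      case (elim x)
      note S = sum_eta_le[OF elim]
      have "finite (fibre_support x)" by (simp add: fibre_support_def)
      with S(1) have card1: "card (fibre_support x) \<ge> 1" by (simp add: Suc_leI card_gt_0_iff)
      have "card (fibre_support x) \<le> card D"
        by (rule card_mono) (auto simp: fibre_support_def)
      then have cardD: "real (card (fibre_support x)) \<le> real CARD('p) ^ degree c"
        by (simp add: card_ker(1)[OF c0] flip: of_nat_power)
      have "ln (real (card (fibre_support x))) \<le> ln (real L) + ?b * indicator ?G x"
      proof (cases "x \<in> ?G")
        case True
        have "ln (real (card (fibre_support x))) \<le> ln (real CARD('p) ^ degree c)"
          using cardD card1 by (intro ln_mono) auto
        also have "\<dots> = ?b" by (simp add: ln_realpow)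
        finally show ?thesis using True lnL by simp
      next
        case False
        then have "ln (real (card (fibre_support x))) \<le> ln (real L)"
          using card1 by (intro ln_mono) auto
        then show ?thesis using False by simp
      qed
      with S(2) have "(\<Sum>d\<in>D. eta (rho (ad d x))) \<le> ln (real L) + ?b * indicator ?G x" by linarith
      then show ?case
        by (subst sum_ennreal) (auto intro: eta_nonneg rho_le_1 ennreal_leI)
    qed
  qed
  also have "\<dots> = ennreal (\<integral>x. ln (real L) + ?b * indicator ?G x \<partial>\<mu>)"
  proof (rule nn_integral_eq_integral)
    show "integrable \<mu> (\<lambda>x. ln (real L) + ?b * indicator ?G x)"
      using G by (intro Bochner_Integration.integrable_add integrable_mult_right integrable_const)
        (auto simp: emeasure_eq_measure)
  qed (use lnL b in \<open>auto simp: indicator_def\<close>)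
  also have "(\<integral>x. ln (real L) + ?b * indicator ?G x \<partial>\<mu>) = ln (real L) + ?b * prob ?G"
  proof -
    have "prob UNIV = 1" using prob_space by simp
    then show ?thesis
      using G by (subst Bochner_Integration.integral_add) (auto simp: emeasure_eq_measure)
  qed
  finally show ?thesis
    by (subst (asm) ennreal_le_iff) (use lnL b in auto)
qed

text \<open>The mean fibre entropy must account for the growth of the block entropy over
  \<open>degree c\<close> places. Lowering \<open>h\<close> to \<open>h / 2\<close> provides an
  increment at large \<open>N\<close>, and the summand 1 is the accuracy asked of
  \<open>rwin_entropy_limit\<close>.\<close>

lemma fibre_support_large:
  assumes h: "\<And>n. real n * h \<le> H n" and "h > 0" and e: "degree c > 0" and L: "L \<ge> 1"
  shows "real (degree c) * (h / 2) \<le>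
    ln (real L) + real (degree c) * ln (real CARD('p)) * prob {x. L < card (fibre_support x)} + 1"
proof -
  obtain m where m: "\<And>I. finite I \<Longrightarrow> window m \<subseteq> I \<Longrightarrow>
    (\<Sum>w\<in>I \<rightarrow>\<^sub>E UNIV. measure nu (cylinder I w) * eta (rwin I w)) \<le> (\<integral>x. eta (rho x) \<partial>nu) + 1"
    using rwin_entropy_limit[of 1] by auto
  obtain N where N: "N \<ge> 2 * m + 1" "real (degree c) * (h / 2) \<le> H (N + degree c) - H N"
    using entropy_increment[OF h, of "h / 2" "degree c" "2 * m + 1"] assms by auto
  have "window m \<subseteq> {- int m..<- int m + int (N + degree c)}"
    using N(1) by (auto simp: window_def)
  then have "H (N + degree c) - H N \<le> (\<integral>x. eta (rho x) \<partial>nu) + 1"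
    unfolding entropy_difference[of N "- int m"] by (intro m) simp
  with N(2) integral_eta_rho_le[OF L] show ?thesis by linarith
qed

end

subsection \<open>Equidistribution of linear functionals characterizes the Bernoulli measure\<close>

text \<open>Averaging over all linear functionals \<open>G\<close> the mass of \<open>{v. G v = G w}\<close>: a vector \<open>v \<noteq> w\<close> is hit
  by a proportion \<open>1/p\<close> of them.\<close>

lemma uniform_of_functionals:
  fixes q :: "('i \<Rightarrow> 'a::{finite,field}) \<Rightarrow> real"
  defines "PE \<equiv> \<lambda>I. (I :: 'i set) \<rightarrow>\<^sub>E (UNIV :: 'a set)"
  defines "L \<equiv> \<lambda>I (G :: 'i \<Rightarrow> 'a) v. \<Sum>i\<in>I. G i * v i"
  assumes I: "finite I" and Q: "Q = (\<Sum>v\<in>PE I. q v)"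
    and hyp: "\<And>G a. G \<in> PE I \<Longrightarrow> \<exists>i\<in>I. G i \<noteq> 0 \<Longrightarrow>
      (\<Sum>v\<in>{v \<in> PE I. L I G v = a}. q v) = Q / real CARD('a)"
    and w: "w \<in> PE I"
  shows "q w = Q / real CARD('a) ^ card I"
proof -
  let ?p = "real CARD('a)" and ?m = "card I"
  have fin: "finite (PE I)" unfolding PE_def using I by simp
  have card: "card (PE I) = CARD('a) ^ ?m" using I by (simp add: PE_def card_PiE)
  have "1 < CARD('a)"
  proof -
    have "card {0, 1 :: 'a} \<le> CARD('a)" by (rule card_mono) auto
    then show ?thesis by simp
  qed
  then have p: "?p > 1" by simp
  define z where "z = (\<lambda>i\<in>I. 0 :: 'a)"
  have z: "z \<in> PE I" by (simp add: z_def PE_def)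
  have nz: "\<exists>i\<in>I. G i \<noteq> 0" if "G \<in> PE I - {z}" for G
  proof (rule ccontr)
    assume "\<not> ?thesis"
    then have "G = z" using that by (auto simp: z_def PE_def PiE_def extensional_def fun_eq_iff)
    with that show False by simp
  qed
  have Lz: "L I z v = 0" for v by (simp add: L_def z_def)
  \<comment> \<open>Summed functional by functional, the zero functional \<open>z\<close>
    contributes all of \<open>Q\<close> and each other one \<open>Q / ?p\<close>.\<close>
  define T where "T = (\<Sum>G\<in>PE I. \<Sum>v\<in>{v \<in> PE I. L I G v = L I G w}. q v)"
  have "T = (\<Sum>v\<in>{v \<in> PE I. L I z v = L I z w}. q v) + (\<Sum>G\<in>PE I - {z}. \<Sum>v\<in>{v \<in> PE I. L I G v = L I G w}. q v)"
    unfolding T_def by (rule sum.remove[OF fin z])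
  also have "(\<Sum>v\<in>{v \<in> PE I. L I z v = L I z w}. q v) = Q"
    by (simp add: Lz Q)
  also have "(\<Sum>G\<in>PE I - {z}. \<Sum>v\<in>{v \<in> PE I. L I G v = L I G w}. q v) = (\<Sum>G\<in>PE I - {z}. Q / ?p)"
    by (intro sum.cong refl hyp nz) auto
  also have "\<dots> = (?p ^ ?m - 1) * (Q / ?p)"
  proof -
    have "real (card (PE I - {z})) = ?p ^ ?m - 1"
      using fin z card p by (simp add: card_Diff_singleton of_nat_diff Suc_leI)
    then show ?thesis by simp
  qed
  finally have T1: "T = Q + (?p ^ ?m - 1) * (Q / ?p)" .
  have count: "real (card {G \<in> PE I. L I G v = L I G w}) = ?p ^ ?m / ?p" if v: "v \<in> PE I" "v \<noteq> w" for v
  proof -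
    have "\<exists>k\<in>I. v k \<noteq> w k"
    proof (rule ccontr)
      assume "\<not> ?thesis"
      then have "v = w" using v(1) w unfolding PE_def by (intro PiE_ext[of v I _ w]) auto
      with v(2) show False by simp
    qed
    then obtain k where k: "k \<in> I" "v k \<noteq> w k" by blast
    \<comment> \<open>Changing \<open>G\<close> at the single place \<open>k\<close> moves
      \<open>L I G u\<close> through all values, so its level sets have equal size.\<close>
    define u where "u i = v i - w i" for i
    have uk: "u k \<noteq> 0" using k by (simp add: u_def)
    have Lu: "L I G v - L I G w = L I G u" for G
      by (simp add: L_def u_def right_diff_distrib sum_subtractf)
    let ?A = "\<lambda>a. {G \<in> PE I. L I G u = a}"
    have upd: "L I (G(k := G k + t)) u = L I G u + t * u k" for G t
    proof -
      have "L I (G(k := G k + t)) u = (G k + t) * u k + (\<Sum>i\<in>I - {k}. G i * u i)"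
        unfolding L_def by (subst sum.remove[OF I k(1)]) simp
      moreover have "L I G u = G k * u k + (\<Sum>i\<in>I - {k}. G i * u i)"
        unfolding L_def by (rule sum.remove[OF I k(1)])
      ultimately show ?thesis by (simp add: algebra_simps)
    qed
    have PEupd: "G(k := t) \<in> PE I" if "G \<in> PE I" for G t
      using that k(1) by (auto simp: PE_def PiE_def extensional_def)
    have same: "card (?A a) = card (?A 0)" for a
    proof (rule bij_betw_same_card, rule bij_betw_byWitness[where f' = "\<lambda>G. G(k := G k + a / u k)"])
      show "\<forall>G\<in>?A a. (G(k := G k + - a / u k))(k := (G(k := G k + - a / u k)) k + a / u k) = G"
        by simp
      show "\<forall>G\<in>?A 0. (G(k := G k + a / u k))(k := (G(k := G k + a / u k)) k + - a / u k) = G"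
        by simp
      show "(\<lambda>G. G(k := G k + - a / u k)) ` ?A a \<subseteq> ?A 0"
      proof
        fix G' assume "G' \<in> (\<lambda>G. G(k := G k + - a / u k)) ` ?A a"
        then obtain G where G: "G \<in> PE I" "L I G u = a" "G' = G(k := G k + - a / u k)" by blast
        show "G' \<in> ?A 0" unfolding G(3) using PEupd[OF G(1)] upd[of G "- a / u k"] G(2) uk by simp
      qed
      show "(\<lambda>G. G(k := G k + a / u k)) ` ?A 0 \<subseteq> ?A a"
      proof
        fix G' assume "G' \<in> (\<lambda>G. G(k := G k + a / u k)) ` ?A 0"
        then obtain G where G: "G \<in> PE I" "L I G u = 0" "G' = G(k := G k + a / u k)" by blast
        show "G' \<in> ?A a" unfolding G(3) using PEupd[OF G(1)] upd[of G "a / u k"] G(2) uk by simp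
      qed
    qed
    have "CARD('a) ^ ?m = (\<Sum>a\<in>(UNIV :: 'a set). card (?A a))"
      using sum.group[OF fin, of UNIV "\<lambda>G. L I G u" "\<lambda>_. 1 :: nat"] by (simp add: card)
    also have "\<dots> = (\<Sum>a\<in>(UNIV :: 'a set). card (?A 0))" by (rule sum.cong[OF refl same])
    finally have "CARD('a) ^ ?m = CARD('a) * card (?A 0)" by simp
    then have "?p ^ ?m = ?p * real (card (?A 0))" by (metis of_nat_mult of_nat_power)
    moreover have "{G \<in> PE I. L I G v = L I G w} = ?A 0"
      by (simp flip: Lu)
    ultimately show ?thesis using p by simp
  qed
  have "T = (\<Sum>v\<in>PE I. \<Sum>G\<in>{G \<in> PE I. L I G v = L I G w}. q v)"
    unfolding T_def by (rule sum.swap_restrict[OF fin fin])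
  also have "\<dots> = (\<Sum>v\<in>PE I. real (card {G \<in> PE I. L I G v = L I G w}) * q v)" by simp
  also have "\<dots> = ?p ^ ?m * q w + (\<Sum>v\<in>PE I - {w}. real (card {G \<in> PE I. L I G v = L I G w}) * q v)"
    by (subst sum.remove[OF fin w]) (simp add: card)
  also have "(\<Sum>v\<in>PE I - {w}. real (card {G \<in> PE I. L I G v = L I G w}) * q v)
      = (\<Sum>v\<in>PE I - {w}. ?p ^ ?m / ?p * q v)"
    by (intro sum.cong refl) (use count in auto)
  also have "\<dots> = ?p ^ ?m / ?p * (Q - q w)"
  proof -
    have "Q = q w + (\<Sum>v\<in>PE I - {w}. q v)" unfolding Q by (rule sum.remove[OF fin w])
    then have "Q - q w = (\<Sum>v\<in>PE I - {w}. q v)" by simp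
    then show ?thesis by (simp only: sum_distrib_left)
  qed
  finally have T2: "T = ?p ^ ?m * q w + ?p ^ ?m / ?p * (Q - q w)" .
  have "(?p ^ ?m * q w) * (?p - 1) = Q * (?p - 1)"
  proof -
    have "?p * T = ?p * Q + (?p ^ ?m - 1) * Q" unfolding T1 using p by (simp add: distrib_left)
    moreover have "?p * T = ?p * (?p ^ ?m * q w) + ?p ^ ?m * (Q - q w)"
      unfolding T2 using p by (simp add: distrib_left)
    ultimately show ?thesis by (simp add: algebra_simps)
  qed
  then have "?p ^ ?m * q w = Q" using p by simp
  then show ?thesis using p by (simp add: field_simps)
qed

text \<open>Read at the left end \<open>- n\<close>, a polynomial of degree at most
  \<open>2 * n\<close> in the shift sees exactly the window, so linear functionals of a window and
  polynomials correspond.\<close>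

lemma functional_act:
  fixes G :: "int \<Rightarrow> 'a::comm_ring_1"
  assumes "\<exists>i\<in>window n. G i \<noteq> 0"
  shows "\<exists>g. g \<noteq> 0 \<and> (\<forall>x. act g x (- int n) = (\<Sum>i\<in>window n. G i * x i))"
proof -
  define g where "g = (\<Sum>k\<le>2 * n. monom (G (int k - int n)) k)"
  have coeff: "coeff g k = (if k \<le> 2 * n then G (int k - int n) else 0)" for k
    by (simp add: g_def coeff_sum)
  have deg: "degree g \<le> 2 * n" by (rule degree_le) (simp add: coeff)
  obtain i where i: "i \<in> window n" "G i \<noteq> 0" using assms by blast
  then have "coeff g (nat (i + int n)) \<noteq> 0" by (auto simp: coeff window_def)
  then have "g \<noteq> 0" by auto
  moreover have "act g x (- int n) = (\<Sum>i\<in>window n. G i * x i)" for x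
    unfolding act_eq[OF deg]
    by (rule sum.reindex_bij_witness[of _ "\<lambda>i. nat (i + int n)" "\<lambda>k. int k - int n"])
      (auto simp: coeff window_def)
  ultimately show ?thesis by blast
qed

text \<open>The total mass is left arbitrary: the measure in question will be \<open>\<mu>\<close>
  restricted to a set not yet known to be conull, or its image under \<open>F\<close>.\<close>

lemma equidistributed_eq_bernoulli:
  fixes \<kappa> :: "(int \<Rightarrow> 'p::prime_card mod_ring) measure"
  assumes fm: "finite_measure \<kappa>" and sets: "sets \<kappa> = sets borel"
    and eqd: "\<And>g j a a'. g \<noteq> 0 \<Longrightarrow> emeasure \<kappa> {x. act g x j = a} = emeasure \<kappa> {x. act g x j = a'}"
    and B: "B \<in> sets borel"
  shows "emeasure \<kappa> B = emeasure \<kappa> UNIV * emeasure uniform_bernoulli B"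
proof -
  interpret finite_measure \<kappa> by fact
  let ?p = "real CARD('p)"
  have space [simp]: "space \<kappa> = UNIV" using sets_eq_imp_space_eq[OF sets] by simp
  have cyl: "measure \<kappa> (cylinder (window n) w) = measure \<kappa> UNIV / ?p ^ card (window n)" for n and w :: "int \<Rightarrow> 'p mod_ring"
  proof -
    let ?I = "window n"
    let ?PE = "?I \<rightarrow>\<^sub>E (UNIV :: 'p mod_ring set)"
    let ?q = "\<lambda>v. measure \<kappa> (cylinder ?I v)"
    note sum = measure_words[OF fm sets finite_window[of n], symmetric]
    have "?q (restrict w ?I) = measure \<kappa> UNIV / real CARD('p mod_ring) ^ card ?I"
    proof (rule uniform_of_functionals)
      show "measure \<kappa> UNIV = (\<Sum>v\<in>?PE. ?q v)" using sum[of "\<lambda>_. True"] by simp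
      fix G :: "int \<Rightarrow> 'p mod_ring" and a
      assume "\<exists>i\<in>?I. G i \<noteq> 0"
      then obtain g where g: "g \<noteq> 0" "\<forall>x. act g x (- int n) = (\<Sum>i\<in>?I. G i * x i)"
        using functional_act by blast
      let ?A = "\<lambda>b. {x. act g x (- int n) = b}"
      have A: "?A b \<in> sets \<kappa>" for b
        using measurable_sets[OF measurable_act[of g "- int n"], of "{b}"] by (simp add: vimage_def sets)
      have same: "measure \<kappa> (?A b) = measure \<kappa> (?A a)" for b
        unfolding measure_def by (rule arg_cong[OF eqd[OF g(1)]])
      have "measure \<kappa> UNIV = measure \<kappa> (\<Union>b\<in>UNIV. ?A b)" by (rule arg_cong[where f="measure \<kappa>"]) auto
      also have "\<dots> = (\<Sum>b\<in>UNIV. measure \<kappa> (?A b))"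
        by (rule measure_finite_Union) (use A in \<open>auto simp: disjoint_family_on_def\<close>)
      also have "\<dots> = (\<Sum>b\<in>(UNIV :: 'p mod_ring set). measure \<kappa> (?A a))" by (rule sum.cong[OF refl same])
      also have "\<dots> = ?p * measure \<kappa> (?A a)" by simp
      finally have "measure \<kappa> (?A a) = measure \<kappa> UNIV / real CARD('p mod_ring)" by simp
      moreover have "(\<Sum>v\<in>{v \<in> ?PE. (\<Sum>i\<in>?I. G i * v i) = a}. ?q v) = measure \<kappa> (?A a)"
        unfolding sum by (simp add: g(2))
      ultimately show "(\<Sum>v\<in>{v \<in> ?PE. (\<Sum>i\<in>?I. G i * v i) = a}. ?q v) = measure \<kappa> UNIV / real CARD('p mod_ring)"
        by simp
    qed auto
    moreover have "cylinder ?I (restrict w ?I) = cylinder ?I w" by (auto simp: cylinder_def)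
    ultimately show ?thesis by simp
  qed
  have eq: "\<kappa> = scale_measure (emeasure \<kappa> UNIV) uniform_bernoulli"
  proof (rule measure_eqI_cylinders[OF fm sets])
    show "sets (scale_measure (emeasure \<kappa> UNIV) uniform_bernoulli) = sets (borel :: (int \<Rightarrow> 'p mod_ring) measure)"
      by (simp add: sets_uniform_bernoulli)
    fix n and w :: "int \<Rightarrow> 'p mod_ring"
    have "emeasure uniform_bernoulli (cylinder (window n) w) = ennreal (1 / ?p ^ card (window n))"
      using uniform_bernoulli_cylinder[OF finite_window[of n], of w]
      by (simp add: cylinder_def ennreal_power power_one_over)
    then show "emeasure \<kappa> (cylinder (window n) w) = emeasure (scale_measure (emeasure \<kappa> UNIV) uniform_bernoulli) (cylinder (window n) w)"
      by (simp add: emeasure_eq_measure cyl ennreal_mult[symmetric])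
  qed
  have "emeasure \<kappa> B = emeasure (scale_measure (emeasure \<kappa> UNIV) uniform_bernoulli) B"
    by (rule arg_cong[OF eq, where f="\<lambda>M. emeasure M B"])
  also have "\<dots> = emeasure \<kappa> UNIV * emeasure uniform_bernoulli B" by (rule emeasure_scale_measure)
  finally show ?thesis .
qed

subsection \<open>Rigidity\<close>

context shift_invariant
begin

text \<open>The bound \<open>\<delta>\<close> is the same for all \<open>L\<close>, which keeps the
  decreasing intersection \<open>G\<close> of the sets \<open>A L\<close> from being null.\<close>

lemma uniform_if_large_fibres:
  fixes c :: "'p mod_ring poly"
  assumes c0: "coeff c 0 \<noteq> 0" and F: "\<And>x m. F x m = act c x (m + a)"
    and F_inv: "F \<in> borel \<rightarrow>\<^sub>M borel" "distr \<mu> borel F = \<mu>"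
    and ergodic: "jointly_ergodic \<mu> F shift_map"
    and kf: "\<And>n. n > 0 \<Longrightarrow> kernel_fibres \<mu> (c ^ n) (N n)"
    and \<delta>: "\<delta> > 0" and large: "\<And>L. L \<ge> 1 \<Longrightarrow>
      \<exists>n>0. \<delta> \<le> prob {x. L < card (kernel_fibres.fibre_support \<mu> (c ^ n) x)}"
  shows "\<mu> = uniform_bernoulli"
proof -
  define S where "S n = kernel_fibres.fibre_support \<mu> (c ^ n)" for n
  define \<rho> where "\<rho> n = kernel_fibres.rho \<mu> (c ^ n)" for n
  have S: "S n x = {d \<in> ker (c ^ n). \<rho> n (ad d x) > 0}" if "n > 0" for n x
    using kernel_fibres.fibre_support_def[OF kf[OF that]] by (simp add: S_def \<rho>_def)
  define A where "A L = {x. \<exists>n>0. L < card (S n x)}" for L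
  define G where "G = (\<Inter>L. A L)"
  have A_sets: "A L \<in> sets borel" for L
  proof -
    have "A L = (\<Union>n\<in>{0<..}. {x. L < card (S n x)})" by (auto simp: A_def)
    also have "\<dots> \<in> sets borel"
      using kernel_fibres.sets_fibre_support[OF kf] by (intro sets.countable_UN') (auto simp: S_def)
    finally show ?thesis .
  qed
  have G_sets: "G \<in> sets borel" unfolding G_def using A_sets by auto
  have A_inv: "inv_set 1 (A L)" for L
  proof -
    have "AE x in \<mu>. \<forall>n. \<forall>d\<in>ker (c ^ n). n > 0 \<longrightarrow> (\<rho> n (ad d (tr 1 x)) > 0 \<longleftrightarrow> \<rho> n (ad d x) > 0)"
      unfolding AE_all_countable
    proof
      fix n
      show "AE x in \<mu>. \<forall>d\<in>ker (c ^ n). n > 0 \<longrightarrow> (\<rho> n (ad d (tr 1 x)) > 0 \<longleftrightarrow> \<rho> n (ad d x) > 0)"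
      proof (cases "n > 0")
        case True
        interpret kernel_fibres \<mu> "c ^ n" "N n" by (rule kf[OF True])
        have "AE x in \<mu>. \<rho> n (ad d (tr 1 x)) > 0 \<longleftrightarrow> \<rho> n (ad d x) > 0" if "d \<in> ker (c ^ n)" for d
          using inv_set_rho[OF that] by (simp add: inv_set_def \<rho>_def)
        then have "AE x in \<mu>. \<forall>d\<in>ker (c ^ n). \<rho> n (ad d (tr 1 x)) > 0 \<longleftrightarrow> \<rho> n (ad d x) > 0"
          by (subst AE_ball_countable) (auto simp: countable_finite)
        then show ?thesis by eventually_elim simp
      qed simp
    qed
    then have "AE x in \<mu>. tr 1 x \<in> A L \<longleftrightarrow> x \<in> A L"
    proof eventually_elim
      case (elim x)
      have "S n (tr 1 x) = S n x" if "n > 0" for n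
        unfolding S[OF that] using elim that by blast
      then show ?case by (auto simp: A_def)
    qed
    then show ?thesis using A_sets by (simp add: inv_set_def)
  qed
  have G_inv: "inv_set 1 G"
  proof -
    have "AE x in \<mu>. \<forall>L. tr 1 x \<in> A L \<longleftrightarrow> x \<in> A L"
      using A_inv by (simp add: AE_all_countable inv_set_def)
    then have "AE x in \<mu>. tr 1 x \<in> G \<longleftrightarrow> x \<in> G" by eventually_elim (simp add: G_def)
    then show ?thesis using G_sets by (simp add: inv_set_def)
  qed
  have G_pos: "prob G > 0"
  proof -
    have "(\<lambda>L. prob (A (Suc L))) \<longlonglongrightarrow> prob (\<Inter>L. A (Suc L))"
    proof (rule finite_Lim_measure_decseq)
      show "range (\<lambda>L. A (Suc L)) \<subseteq> events" using A_sets by auto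
      show "decseq (\<lambda>L. A (Suc L))"
        by (rule decseq_SucI) (unfold A_def, blast intro: Suc_lessD)
    qed
    moreover have "(\<Inter>L. A (Suc L)) = G"
      unfolding G_def A_def by (auto intro: Suc_lessD)
    moreover have "\<delta> \<le> prob (A (Suc L))" for L
    proof -
      obtain n where n: "n > 0" "\<delta> \<le> prob {x. Suc L < card (S n x)}"
        using large[of "Suc L"] by (auto simp: S_def)
      note n(2)
      also have "prob {x. Suc L < card (S n x)} \<le> prob (A (Suc L))"
      proof (rule finite_measure_mono)
        show "{x. Suc L < card (S n x)} \<subseteq> A (Suc L)" unfolding A_def using n(1) by blast
      qed (simp add: A_sets)
      finally show ?thesis .
    qed
    ultimately have "\<delta> \<le> prob G" by (intro LIMSEQ_le_const) auto
    with \<delta> show ?thesis by simp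
  qed
  have G_eqd: "equidistributed G g" if g: "g \<noteq> 0" for g
  proof -
    \<comment> \<open>Pairs for which translation by \<open>d\<close> moves the functional
      \<open>g\<close>. They are countably many, so the sets \<open>E (n, d)\<close> can be
      enumerated for \<open>equidistributed_UN\<close>.\<close>
    define X where "X = {(n, d). n > 0 \<and> d \<in> ker (c ^ n) \<and> (\<exists>j. act g d (j + 1) \<noteq> act g d j)}"
    define E where "E = (\<lambda>(n, d). {x. \<rho> n (ad d x) > 0})"
    have "X \<subseteq> (SIGMA n:{0<..}. ker (c ^ n))" by (auto simp: X_def)
    moreover have "countable (SIGMA n:{0<..}. ker (c ^ n))"
    proof (rule countable_SIGMA)
      fix n :: nat assume "n \<in> {0<..}"
      then show "countable (ker (c ^ n))"
        using kernel_fibres.finite_D[OF kf] by (simp add: countable_finite)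
    qed simp
    ultimately have "countable X" by (rule countable_subset)
    \<comment> \<open>The empty set is adjoined so that an enumeration exists even when
      \<open>X\<close> is empty.\<close>
    then have cnt: "countable (insert {} (E ` X))" by simp
    define En where "En = from_nat_into (insert {} (E ` X))"
    have range_En: "range En = insert {} (E ` X)"
      unfolding En_def by (rule range_from_nat_into[OF _ cnt]) simp
    have En_cases: "En i = {} \<or> (\<exists>n d. (n, d) \<in> X \<and> En i = {x. \<rho> n (ad d x) > 0})" for i
    proof -
      have "En i \<in> insert {} (E ` X)" using range_En by blast
      then show ?thesis by (auto simp: E_def)
    qed
    show ?thesis
    proof (rule equidistributed_UN[of En, OF _ G_inv])
      fix i
      show "inv_set 1 (En i)"
        using En_cases[of i]
      proof (elim disjE exE conjE)
        fix n d assume nd: "(n, d) \<in> X" "En i = {x. \<rho> n (ad d x) > 0}"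
        then have "n > 0" "d \<in> ker (c ^ n)" by (auto simp: X_def)
        then show ?thesis
          unfolding nd(2) \<rho>_def by (intro kernel_fibres.inv_set_rho[OF kf])
      qed (simp add: inv_set_def)
      fix B' assume B': "inv_set 1 B'" "B' \<subseteq> En i"
      show "equidistributed B' g"
        using En_cases[of i]
      proof (elim disjE exE conjE)
        assume "En i = {}"
        then show ?thesis using B'(2) by (simp add: equidistributed_def)
      next
        fix n d assume nd: "(n, d) \<in> X" "En i = {x. \<rho> n (ad d x) > 0}"
        then obtain j where j: "n > 0" "d \<in> ker (c ^ n)" "act g d (j + 1) \<noteq> act g d j"
          by (auto simp: X_def)
        show ?thesis
          by (rule kernel_fibres.equidistributed_fibre[OF kf[OF j(1)] j(2) B'(1) _ j(3)])
            (use B'(2) nd(2) in \<open>simp add: \<rho>_def\<close>)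
      qed
    next
      show "G \<subseteq> (\<Union>i. En i)"
      proof
        fix x assume "x \<in> G"
        \<comment> \<open>\<open>act ?g d\<close> is the difference of \<open>act g d\<close> at
          neighbouring places, so the kernel of \<open>?g\<close> consists of the \<open>d\<close>
          with constant \<open>act g d\<close>. Its size is bounded independently of
          \<open>n\<close>, so a fibre support exceeding the bound contains some other
          \<open>d\<close>.\<close>
        let ?g = "[:- 1, 1:] * g"
        have g': "?g \<noteq> 0" using g by (simp only: mult_eq_0_iff pCons_eq_0_iff) simp
        obtain n where n: "n > 0" "CARD('p mod_ring) ^ degree ?g < card (S n x)"
          using \<open>x \<in> G\<close> unfolding G_def A_def by blast
        have "\<not> S n x \<subseteq> ker ?g"
          using card_ker_le[OF g'] n(2) card_mono[of "ker ?g" "S n x"] by linarith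
        then obtain d where d: "d \<in> S n x" "d \<notin> ker ?g" by blast
        then obtain j where "act ?g d j \<noteq> 0" by (auto simp: ker_def)
        then have "act g d (j + 1) \<noteq> act g d j"
          by (simp only: act_mult) (simp add: act_pCons)
        then have "(n, d) \<in> X" using d(1) S[OF n(1)] n(1) by (auto simp: X_def)
        moreover have "x \<in> E (n, d)" using d(1) S[OF n(1)] by (simp add: E_def)
        ultimately have "x \<in> \<Union> (range En)" unfolding range_En by blast
        then show "x \<in> (\<Union>i. En i)" by simp
      qed
    qed
  qed
  define \<kappa> where "\<kappa> = density \<mu> (indicator G)"
  have \<kappa>: "emeasure \<kappa> B = emeasure \<mu> (G \<inter> B)" if "B \<in> sets borel" for B
    unfolding \<kappa>_def using that G_sets
    by (subst emeasure_density) (auto simp: indicator_inter_arith[symmetric])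
  have \<kappa>_sets: "sets \<kappa> = sets borel" by (simp add: \<kappa>_def)
  have \<kappa>_space: "space \<kappa> = UNIV" by (simp add: \<kappa>_def)
  have \<kappa>_fm: "finite_measure \<kappa>"
    by (rule finite_measureI) (simp add: \<kappa>_space \<kappa> emeasure_eq_measure)
  have \<kappa>_act: "emeasure \<kappa> {x. act g x j = b} = emeasure \<kappa> {x. act g x j = b'}" if "g \<noteq> 0" for g j b b'
  proof -
    have eq: "emeasure \<kappa> {x. act g x j = b} = emeasure \<mu> {x \<in> G. act g x j = b}" for b
      using \<kappa>[of "{x. act g x j = b}"] sets_act_eq[of UNIV g j b] by (simp add: Int_def)
    have "emeasure \<mu> {x \<in> G. act g x j = b} = emeasure \<mu> {x \<in> G. act g x j = b'}"
      using G_eqd[OF that] unfolding equidistributed_def by blast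
    then show ?thesis by (simp only: eq)
  qed
  have \<kappa>_eq: "emeasure \<kappa> B = emeasure \<kappa> UNIV * emeasure uniform_bernoulli B" if "B \<in> sets borel" for B
    by (rule equidistributed_eq_bernoulli[OF \<kappa>_fm \<kappa>_sets \<kappa>_act that])
  have F_meas: "F \<in> \<kappa> \<rightarrow>\<^sub>M borel"
    using F_inv(1) \<kappa>_sets by (simp cong: measurable_cong_sets)
  \<comment> \<open>A functional \<open>g\<close> composed with the automaton is the functional
    \<open>g * c\<close>, again nonzero. Hence \<open>\<kappa>'\<close> and \<open>\<kappa>\<close>
    are the same multiple of the Bernoulli measure, and they give \<open>G\<close> the same
    mass.\<close>
  define \<kappa>' where "\<kappa>' = distr \<kappa> borel F"
  have \<kappa>': "emeasure \<kappa>' B = emeasure \<kappa> {x. F x \<in> B}" if "B \<in> sets borel" for B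
    unfolding \<kappa>'_def using that by (subst emeasure_distr[OF F_meas]) (auto simp: vimage_def \<kappa>_space)
  have \<kappa>'_fm: "finite_measure \<kappa>'"
    unfolding \<kappa>'_def by (rule finite_measure.finite_measure_distr[OF \<kappa>_fm F_meas])
  have \<kappa>'_act: "emeasure \<kappa>' {x. act g x j = b} = emeasure \<kappa>' {x. act g x j = b'}" if "g \<noteq> 0" for g j b b'
  proof -
    have Fx: "F x = tr a (act c x)" for x by (simp add: fun_eq_iff F tr_apply)
    have eq: "emeasure \<kappa>' {x. act g x j = b} = emeasure \<kappa> {x. act (g * c) x (j + a) = b}" for b
      using \<kappa>'[of "{x. act g x j = b}"] sets_act_eq[of UNIV g j b]
      by (simp add: Fx act_tr act_mult)
    have "g * c \<noteq> 0" using that c0 by auto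
    then show ?thesis by (rule trans[OF eq trans[OF \<kappa>_act eq[symmetric]]])
  qed
  have 1: "emeasure \<kappa>' G = emeasure \<kappa>' UNIV * emeasure uniform_bernoulli G"
    by (rule equidistributed_eq_bernoulli[OF \<kappa>'_fm _ \<kappa>'_act G_sets]) (simp add: \<kappa>'_def)
  have "emeasure \<kappa>' UNIV = emeasure \<kappa> UNIV" using \<kappa>'[of UNIV] by simp
  with 1 \<kappa>_eq[OF G_sets] have "emeasure \<kappa>' G = emeasure \<kappa> G" by (simp only:)
  then have "emeasure \<kappa> {x. F x \<in> G} = emeasure \<kappa> G" using \<kappa>'[OF G_sets] by (simp only:)
  moreover have FG_sets: "{x. F x \<in> G} \<in> sets borel"
    using measurable_sets[OF F_inv(1) G_sets] by (simp add: vimage_def)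
  \<comment> \<open>So \<open>G\<close> lies in its preimage under \<open>F\<close> up to a null
    set. As \<open>F\<close> preserves \<open>\<mu>\<close>, the two have equal mass and agree
    almost everywhere.\<close>
  ultimately have "emeasure \<mu> (G \<inter> {x. F x \<in> G}) = emeasure \<mu> G"
    using G_sets by (simp add: \<kappa>)
  then have int: "prob (G \<inter> {x. F x \<in> G}) = prob G" by (simp add: measure_def)
  have "emeasure \<mu> {x. F x \<in> G} = emeasure (distr \<mu> borel F) G"
    using F_inv(1) G_sets by (subst emeasure_distr) (auto simp: vimage_def cong: measurable_cong_sets)
  then have FG: "prob {x. F x \<in> G} = prob G" by (simp add: F_inv(2) measure_def)
  have "AE x in \<mu>. F x \<in> G \<longleftrightarrow> x \<in> G"
  proof -
    have "prob (G - {x. F x \<in> G}) = 0"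
      using finite_measure_Diff'[of G "{x. F x \<in> G}"] G_sets FG_sets int by simp
    moreover have "prob ({x. F x \<in> G} - G) = 0"
      using finite_measure_Diff'[of "{x. F x \<in> G}" G] G_sets FG_sets int FG by (simp add: Int_commute)
    ultimately have N: "G - {x. F x \<in> G} \<in> null_sets \<mu>" "{x. F x \<in> G} - G \<in> null_sets \<mu>"
      by (simp_all add: null_sets_def emeasure_eq_measure sets.Diff G_sets FG_sets)
    from AE_not_in[OF N(1)] AE_not_in[OF N(2)] show ?thesis
      by eventually_elim auto
  qed
  then have "G \<in> invariant_sets \<mu> F"
    using F_inv(1) G_sets by (subst invariant_sets_iff_AE) (auto cong: measurable_cong_sets)
  moreover have "G \<in> invariant_sets \<mu> shift_map"
    using G_inv inv_set_iff[of G 1] by simp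
  ultimately have "prob G = 0 \<or> prob G = 1" using ergodic by (auto simp: jointly_ergodic_def)
  with G_pos have G1: "prob G = 1" by simp
  show ?thesis
  proof (rule measure_eqI)
    show "sets \<mu> = sets uniform_bernoulli" by (simp add: sets_uniform_bernoulli)
    fix B assume "B \<in> sets \<mu>"
    then have B: "B \<in> sets borel" by simp
    have "AE x in \<mu>. x \<in> G" using G1 G_sets by (simp add: AE_in_set_eq_1)
    then have "AE x in \<mu>. x \<in> G \<inter> C \<longleftrightarrow> x \<in> C" for C by eventually_elim simp
    then have G_Int: "emeasure \<mu> (G \<inter> C) = emeasure \<mu> C" if "C \<in> sets borel" for C
      by (rule emeasure_AE_eq) (use that G_sets in auto)
    have "emeasure \<mu> UNIV = 1" using emeasure_space_1 by simp
    then show "emeasure \<mu> B = emeasure uniform_bernoulli B"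
      using \<kappa>_eq[OF B] \<kappa>[OF B] \<kappa>[of UNIV] G_Int[OF B] G_Int[of UNIV] by simp
  qed
qed

end

theorem proposition5p1:
  fixes F :: "(int \<Rightarrow> 'p::prime_card mod_ring) \<Rightarrow> (int \<Rightarrow> 'p mod_ring)"
    and \<mu> :: "(int \<Rightarrow> 'p mod_ring) measure"
    and p p\<^sub>1 r :: nat
    and U :: "int set"
  assumes p: "p = CARD('p)"
    and linear: "linear_ca F"
    and nontrivial: "\<not> trivial_ca F"
    and p1: "p\<^sub>1 = kernel_period F"
    and U: "U = smallest_neighborhood F"
    and r: "r = nat (Max (U \<union> {0}) - Min (U \<union> {0}))"
    and prob: "prob_space \<mu>"
    and borel: "sets \<mu> = sets borel"
    and F_invariant: "invariant_measure \<mu> F"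
    and shift_invariant: "invariant_measure \<mu> shift_map"
    and ergodic: "jointly_ergodic \<mu> F shift_map"
    and invariant_sets: "invariant_sets \<mu> shift_map = invariant_sets \<mu> (shift_map ^^ (p * p\<^sub>1))"
    and entropy: "ks_entropy \<mu> F > 0"
  shows "\<mu> = uniform_bernoulli \<and> p\<^sub>1 dvd (\<Prod>i<r. p ^ r - p ^ i)"
proof -
  have F_meas: "F \<in> borel \<rightarrow>\<^sub>M borel"
    using linear by (intro borel_measurable_continuous_onI) (simp add: linear_ca_def cellular_automaton_def)
  have distr_F: "distr \<mu> borel F = \<mu>"
    by (rule distr_eq_invariant[OF F_meas borel F_invariant])
  interpret S: shift_invariant \<mu>
  proof (intro shift_invariant.intro shift_invariant_axioms.intro prob borel)
    show "distr \<mu> borel shift_map = \<mu>"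
      by (rule distr_eq_invariant[OF _ borel shift_invariant]) (simp add: shift_map_eq_tr)
  qed
  have ca: "cellular_automaton F" using linear by (simp add: linear_ca_def)
  obtain W where "neighborhood F W"
    using cellular_automaton_has_neighborhood[OF ca] by blast
  then have nbhd: "neighborhood F U" unfolding U by (rule smallest_neighborhood)
  then obtain a b where ab: "U = {a..b}" by (auto simp: neighborhood_def)
  have local: "F x m = F y n" if "\<And>u. u \<in> U \<Longrightarrow> x (m + u) = y (n + u)" for x y m n
    using nbhd that unfolding neighborhood_iff by blast
  define R where "R = nat (max \<bar>a\<bar> \<bar>b\<bar>)"
  have "\<exists>h>0. \<forall>n. real n * h \<le> S.H n"
  proof (rule S.entropy_rate_pos[OF F_meas distr_F _ entropy])
    fix x y :: "int \<Rightarrow> 'p mod_ring" and m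
    assume eq: "\<And>i. \<bar>i - m\<bar> \<le> int R \<Longrightarrow> x i = y i"
    show "F x m = F y m"
      by (rule local, rule eq) (auto simp: ab R_def)
  qed
  then obtain h where h: "h > 0" "\<And>n. real n * h \<le> S.H n" by blast
  \<comment> \<open>A one-point neighborhood is excluded by nontriviality. An empty one makes
    \<open>F\<close> constant, and invariance then leaves a single symbol with no entropy, against
    \<open>h > 0\<close>.\<close>
  have less: "a < b"
  proof (rule ccontr)
    assume "\<not> a < b"
    moreover have "U \<noteq> {a}" using nontrivial by (auto simp: trivial_ca_def U)
    ultimately have empty: "U = {}" using ab by (cases "a = b") auto
    define k where "k = restrict (F undefined) {0..<int 1}"
    have "S.H 1 = S.ent (\<lambda>x. restrict (F x) {0..<int 1})"
      unfolding S.H_def S.went_def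
      by (rule S.ent_invariant[symmetric, OF S.simple_restrict F_meas distr_F]) simp
    also have "(\<lambda>x. restrict (F x) {0..<int 1}) = (\<lambda>_. k)"
      unfolding k_def by (intro ext restrict_ext local) (simp add: empty)
    also have "S.ent (\<lambda>_. k) = 0"
      using S.ent_eq[of "\<lambda>_. k" "{k}"] S.prob_space by simp
    finally have "S.H 1 = 0" .
    with h(2)[of 1] h(1) show False by simp
  qed
  obtain c where c: "degree c = nat (b - a)" "coeff c 0 \<noteq> 0" "\<And>x m. F x m = act c x (m + a)"
    using linear_ca_bipermutative[OF linear _ less] U ab by metis
  have c_ne: "c \<noteq> 0" using c(2) by auto
  have deg_pos: "degree c > 0" using c(1) less by simp
  have K: "kernel F = ker c"
  proof -
    have "(\<forall>m. act c x (m + a) = 0) \<longleftrightarrow> (\<forall>m. act c x m = 0)" for x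
      by (metis diff_add_cancel)
    then show ?thesis by (simp add: kernel_def ker_def fun_eq_iff c(3))
  qed
  have p_gt1: "p > 1" unfolding p by (rule prime_gt_1_nat[OF prime_card])
  have p1_pos: "p\<^sub>1 > 0" using kernel_period(1)[OF c(2) K] p1 by simp
  have per: "x (i + int p\<^sub>1) = x i" if "x \<in> ker c" for x i
    using fun_cong[OF kernel_period(2)[OF c(2) K that], of i] by (simp add: shift_funpow p1)
  have inv: "S.inv_set 1 B" if "S.inv_set (int (p * p\<^sub>1)) B" for B
  proof -
    have "B \<in> invariant_sets \<mu> (shift_map ^^ (p * p\<^sub>1))" using that by (simp only: S.inv_set_iff)
    then have "B \<in> invariant_sets \<mu> (shift_map ^^ 1)" using invariant_sets by simp
    then show ?thesis unfolding S.inv_set_iff by simp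
  qed
  have distr_c: "distr \<mu> borel (act c) = \<mu>"
  proof -
    have "act c = tr (- a) \<circ> F" by (simp add: fun_eq_iff tr_apply c(3))
    then have "distr \<mu> borel (act c) = distr (distr \<mu> borel F) borel (tr (- a))"
      using F_meas by (subst distr_distr) (auto cong: measurable_cong_sets)
    then show ?thesis by (simp only: distr_F S.distr_tr)
  qed
  \<comment> \<open>Each factor \<open>c\<close> costs a factor \<open>p\<close> in the period, and
    the hypothesis at \<open>p * p\<^sub>1\<close> is lifted along with it.\<close>
  have kf: "kernel_fibres \<mu> (c ^ n) (int (p ^ n * p\<^sub>1))" if n: "n > 0" for n
  proof (intro kernel_fibres.intro kernel_fibres_axioms.intro)
    show "shift_invariant \<mu>" by unfold_locales
    show "coeff (c ^ n) 0 \<noteq> 0" using c(2) by (simp add: coeff_0_power)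
    show "distr \<mu> borel (act (c ^ n)) = \<mu>"
      unfolding act_power by (rule S.distr_funpow[OF measurable_act_fun distr_c])
    show "tr (int (p ^ n * p\<^sub>1)) d = d" if "d \<in> ker (c ^ n)" for d
      using ker_power_periodic[OF per that] by (simp add: fun_eq_iff tr_apply p)
    show "S.inv_set 1 B" if "S.inv_set (int (p ^ n * p\<^sub>1)) B" for B
      by (rule S.inv_set_prime_power[OF _ p1_pos n inv that]) (use prime_card[where 'a='p] p in simp_all)
  qed
  have lnp: "ln (real p) > 0" using p_gt1 by simp
  have "\<mu> = uniform_bernoulli"
  proof (rule S.uniform_if_large_fibres[OF c(2,3) F_meas distr_F ergodic kf])
    \<comment> \<open>Of the gain \<open>h / 2\<close> per degree, half absorbs
      \<open>ln L + 1\<close> once \<open>n\<close> is large. The other half must come from the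
      exceptional set, which supplies at most \<open>ln p\<close> per degree and unit of
      mass.\<close>
    show "h / (4 * ln (real p)) > 0" using h(1) lnp by simp
    fix L :: nat assume L: "L \<ge> 1"
    obtain n :: nat where n: "real n > 4 * (ln (real L) + 1) / h" using reals_Archimedean2 by blast
    have "0 < 4 * (ln (real L) + 1) / h" using L h(1) by (intro divide_pos_pos mult_pos_pos add_nonneg_pos) auto
    with n have n0: "n > 0" by (cases n) auto
    interpret K: kernel_fibres \<mu> "c ^ n" "int (p ^ n * p\<^sub>1)" by (rule kf[OF n0])
    let ?P = "S.prob {x. L < card (K.fibre_support x)}"
    have deg: "degree (c ^ n) = n * degree c" by (simp add: degree_power_eq[OF c_ne])
    have deg0: "degree (c ^ n) > 0" using deg n0 deg_pos by simp
    let ?d = "real (degree (c ^ n))"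
    have "?d * (h / 2) \<le> ln (real L) + ?d * ln (real p) * ?P + 1"
      using K.fibre_support_large[OF h(2,1) deg0 L] by (simp add: p)
    moreover have "ln (real L) + 1 \<le> ?d * (h / 4)"
    proof -
      have "ln (real L) + 1 \<le> real n * (h / 4)" using n h(1) by (simp add: field_simps)
      also have "\<dots> \<le> ?d * (h / 4)"
        using deg deg_pos h(1) by (intro mult_right_mono of_nat_mono) auto
      finally show ?thesis .
    qed
    ultimately have "?d * (h / 4) \<le> ?d * (ln (real p) * ?P)" by (simp add: algebra_simps)
    then have "h / 4 \<le> ln (real p) * ?P" using deg0 by (simp add: mult_le_cancel_left)
    then have "h / (4 * ln (real p)) \<le> ?P" using lnp by (simp add: field_simps)
    with n0 show "\<exists>n>0. h / (4 * ln (real p)) \<le> S.prob {x. L < card (kernel_fibres.fibre_support \<mu> (c ^ n) x)}"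
      by blast
  qed
  moreover have "p\<^sub>1 dvd (\<Prod>i<r. p ^ r - p ^ i)"
  proof -
    have "finite U" using ab by simp
    \<comment> \<open>Adjoining 0 to the neighborhood can only widen it, so \<open>r\<close> is at
      least \<open>b - a\<close>, the degree of \<open>c\<close>.\<close>
    then have "b \<le> Max (U \<union> {0})" "Min (U \<union> {0}) \<le> a"
      using Max_ge[of "U \<union> {0}" b] Min_le[of "U \<union> {0}" a] ab less by simp_all
    then have "degree c \<le> r" unfolding r c(1) by (intro nat_mono) simp
    have "p\<^sub>1 dvd (\<Prod>i<degree c. p ^ degree c - p ^ i)"
      using kernel_period_dvd[OF c(2) K] by (simp add: p p1)
    also have "\<dots> dvd (\<Prod>i<r. p ^ r - p ^ i)" by (rule GL_order_dvd) fact
    finally show ?thesis .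
  qed
  ultimately show ?thesis ..
qed

end
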